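(* Let $0<|q|<1$ with a fixed choice of $q^{1/2}$, and let $N\in\mathbb Z$. Define the intertwiners $$\tilde\Phi^*=\sum_{\lambda,\mu,\nu}\big((-1)^Nq^{\frac12}\big)^{|\lambda|}f_\lambda^N\big(-q^{-\frac12}\big)^{|\mu|}f_\mu^{-1}\,q^{\frac12|\nu|}\,C_{\nu'\mu\lambda}\,|\lambda\rangle\otimes|\mu\rangle\otimes\langle\nu|,$$ $$\tilde\Phi=\sum_{\lambda,\mu,\nu}\big(-(-1)^Nq^{-\frac12}\big)^{|\lambda|}f_\lambda^{-N}\,q^{\frac12|\mu|}f_\mu\,(-q^{-\frac12})^{|\nu|}\,C_{\nu\mu'\lambda'}\,\langle\lambda|\otimes\langle\mu|\otimes|\nu\rangle .$$ Then $$\tilde\Phi^*=\mathcal N_\varnothing^{-1}\;{}^3\langle0|\exp\Big[\sum_{n>0}\frac1n\Big(-(-1)^nb_n^{(1)}a_n^{(3)}+a_{-n}^{(2)}a_n^{(3)}+(-1)^nb_{-n}^{(1)}a_{-n}^{(2)}\Big)\Big]q^{\frac N2\hat w^{(1)}}q^{L_0^{(1)}}|0\rangle^1_{\mathcal S}|0\rangle^2,$$ $$\tilde\Phi=\mathcal N_\varnothing^{-1}\;{}^2\langle0|\;{}^1_{\mathcal S}\langle0|\,(-q)^{-L_0^{(1)}}q^{-\frac N2\hat w^{(1)}}\exp\Big[\sum_{n>0}\frac1n\Big((-1)^nb_n^{(1)}a_n^{(2)}+a_n^{(2)}a_{-n}^{(3)}-(-1)^nb_{-n}^{(1)}a_{-n}^{(3)}\Big)\Big]|0\rangle^3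 .$$
   Context: For a partition $\lambda$: $\lambda'$ is the conjugate, $|\lambda|$ the size, $\kappa_\lambda=\sum_i\lambda_i(\lambda_i-2i+1)$, $\rho=(-\tfrac12,-\tfrac32,\dots)$, $q^{-\lambda-\rho}=(q^{-\lambda_i+i-1/2})_{i\ge1}$; $s_{\lambda/\eta}$ are skew Schur functions. Sums run over all partitions. $f_\lambda=(-1)^{|\lambda|}q^{\kappa_\lambda/2}$. Topological vertex: $C_{\lambda\mu\nu}=q^{\kappa_\mu/2}s_{\nu'}(q^{-\rho})\sum_\eta s_{\lambda'/\eta}(q^{-\nu-\rho})s_{\mu/\eta}(q^{-\nu'-\rho})$. Free fermion modes $\psi_r,\psi_r^\dagger$ ($r\in\mathbb Z+\frac12$): $\{\psi_r,\psi^\dagger_s\}=\delta_{r+s,0}$, other anticommutators zero, vacuum $\psi_r|0\rangle=\psi^\dagger_r|0\rangle=0$ for $r>0$; $:\ :$ is fermionic normal ordering. Define $$a_n=-\sum_r:\psi_r\psi^\dagger_{n-r}:,\quad b_n=-\sum_rq^{n(r+1/2)}:\psi^\dagger_r\psi_{-r}:+\frac1{1-q^{-n}}\ (n\ne0),$$ $$\hat w=\sum_rr^2:\psi^\dagger_r\psi_{-r}:,\quad L_0=\sum_{n>0}a_{-n}a_n .$$ One has $[a_m,a_n]=m\delta_{m+n,0}$. With $\mathrm{diag}(\lambda)=\#\{i:i\le\lambda_i\}$, $$|\lambda\rangle=\prod_{i=1}^{\mathrm{diag}(\lambda)}\big[(-1)^{-\lambda_i+i}\psi_{-\lambda'_i+i-1/2}\psi^\dagger_{-\lambda_i+i-1/2}\big]|0\rangle$$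 is a basis of the charge-zero sector, on which everything acts; $\langle\lambda|$ is the dual basis, $\langle0|=\langle\varnothing|$. S-dual vacuum: $|0\rangle_{\mathcal S}=|\varnothing\rangle_{\mathcal S}=\mathcal N_\varnothing\exp\big[-\sum_{n>0}\frac{a_{-n}}n\sum_{l>0}q^{(l-1)n}\big]|0\rangle$ and ${}_{\mathcal S}\langle0|={}_{\mathcal S}\langle\varnothing|=\mathcal N_\varnothing\langle0|\exp\big[\sum_{n>0}\frac{a_n}n\sum_{l>0}q^{ln}\big]$, with $\mathcal N_\varnothing=\prod_{n\ge1}(1-q^n)^{-n/2}$. Superscripts $1,2,3$ label three copies of the Fock space, corresponding to the first, second and third tensor factors; an operator with superscript $(i)$ acts on the $i$-th copy. $\tilde\Phi^*$ is an element with ket components in copies 1, 2 and a bra component in copy 3; $\tilde\Phi$ has bra components in copies 1, 2 and a ket component in copy 3. These are formal infinite sums, and the equalities mean equality of all coefficients of $|\lambda\rangle\otimes|\mu\rangle\otimes\langle\nu|$ (resp. $\langle\lambda|\otimes\langle\mu|\otimes|\nu\rangle$).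
   Formalization: In the second identity the operator (-q)^{-L_0^{(1)}} is replaced by q^{-L_0^{(1)}}: as printed it fails, since at λ=(1), μ=ν=∅ the left side is -1/(1-q) while the printed right side is +1/(1-q). *)

theory Defs
  imports "HOL-Analysis.Analysis"
begin

section \<open>Partitions\<close>

text \<open>
  A partition is an eventually vanishing, weakly decreasing sequence of naturals. Indices start
  at 0, so \<open>l i\<close> is the part \<open>\<lambda>\<^sub>i\<^sub>+\<^sub>1\<close>; this shifts the usual formulas by one.
\<close>

type_synonym ptn = "nat \<Rightarrow> nat"

definition partitions :: "ptn set" where
  "partitions = {l. antimono l \<and> finite {i. l i \<noteq> 0}}"

definition empty_ptn :: ptn where
  "empty_ptn = (\<lambda>_. 0)"

definition psize :: "ptn \<Rightarrow> nat" where
  "psize l = (\<Sum>i | l i \<noteq> 0. l i)"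

definition conjugate :: "ptn \<Rightarrow> ptn" where
  "conjugate l = (\<lambda>j. card {i. j < l i})"

definition diag_len :: "ptn \<Rightarrow> nat" where
  "diag_len l = card {i. i < l i}"

definition kappa :: "ptn \<Rightarrow> int" where
  "kappa l = (\<Sum>i | l i \<noteq> 0. int (l i) * (int (l i) - 2 * (int i + 1) + 1))"

section \<open>Skew Schur functions and the topological vertex\<close>

definition skew_cells :: "ptn \<Rightarrow> ptn \<Rightarrow> (nat \<times> nat) set" where
  "skew_cells l e = {(i, j). e i \<le> j \<and> j < l i}"

text \<open>Semistandard tableaux of shape \<open>l / e\<close>, extended by 0 outside the shape.\<close>

definition ssyt :: "ptn \<Rightarrow> ptn \<Rightarrow> (nat \<times> nat \<Rightarrow> nat) set" where
  "ssyt l e = {T.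
     (\<forall>c. c \<notin> skew_cells l e \<longrightarrow> T c = 0) \<and>
     (\<forall>i j j'. (i, j) \<in> skew_cells l e \<longrightarrow> (i, j') \<in> skew_cells l e \<longrightarrow> j < j' \<longrightarrow> T (i, j) \<le> T (i, j')) \<and>
     (\<forall>i i' j. (i, j) \<in> skew_cells l e \<longrightarrow> (i', j) \<in> skew_cells l e \<longrightarrow> i < i' \<longrightarrow> T (i, j) < T (i', j))}"

text \<open>Value of \<open>s\<^bsub>l/e\<^esub>\<close> at the infinite sequence \<open>x 0, x 1, \<dots>\<close>; it vanishes unless \<open>e \<subseteq> l\<close>.\<close>

definition skew_schur :: "ptn \<Rightarrow> ptn \<Rightarrow> (nat \<Rightarrow> complex) \<Rightarrow> complex" where
  "skew_schur l e x =
     (if e \<le> l then (\<Sum>\<^sub>\<infinity>T\<in>ssyt l e. \<Prod>c\<in>skew_cells l e. x (T c)) else 0)"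

text \<open>
  Throughout, \<open>qh\<close> is the chosen square root of \<open>q\<close>, and \<open>q\<^bsup>m/2\<^esup>\<close> is \<open>qh powi m\<close>.
  The sequence \<open>q\<^bsup>-\<lambda>-\<rho>\<^esup>\<close>, whose entry at the shifted index \<open>i\<close> is \<open>q\<^bsup>-\<lambda>\<^sub>i\<^sub>+\<^sub>1 + (i+1) - 1/2\<^esup>\<close>:
\<close>

definition q_seq :: "complex \<Rightarrow> ptn \<Rightarrow> nat \<Rightarrow> complex" where
  "q_seq qh l = (\<lambda>i. qh powi (- 2 * int (l i) + 2 * (int i + 1) - 1))"

definition framing :: "complex \<Rightarrow> ptn \<Rightarrow> complex" where
  "framing qh l = (- 1) ^ psize l * qh powi kappa l"

definition top_vertex :: "complex \<Rightarrow> ptn \<Rightarrow> ptn \<Rightarrow> ptn \<Rightarrow> complex" where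
  "top_vertex qh la mu nu =
     qh powi kappa mu * skew_schur (conjugate nu) empty_ptn (q_seq qh empty_ptn) *
     (\<Sum>\<^sub>\<infinity>eta\<in>partitions. skew_schur (conjugate la) eta (q_seq qh nu) *
                          skew_schur mu eta (q_seq qh (conjugate nu)))"

section \<open>The free fermion Fock space\<close>

text \<open>
  The half-integer \<open>r = k + 1/2\<close> is represented by the integer \<open>k\<close>; thus \<open>r > 0\<close> means \<open>k \<ge> 0\<close>,
  and \<open>- r\<close> is represented by \<open>- k - 1\<close>.

  A basis vector is a semi-infinite wedge \<open>v\<^bsub>s\<^sub>1\<^esub> \<and> v\<^bsub>s\<^sub>2\<^esub> \<and> \<dots>\<close> with \<open>s\<^sub>1 < s\<^sub>2 < \<dots>\<close>, given by its set of
  labels, which differs from the nonnegative integers (the vacuum) in finitely many places.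
  Here \<open>\<psi>\<^sub>r\<close> wedges with the label \<open>r\<close>, and \<open>\<psi>\<^sup>\<dagger>\<^sub>r\<close> contracts with the label \<open>- r\<close>.
  Vectors are formal, possibly infinite, linear combinations of basis vectors: the S-dual
  vacuum is one of these.
\<close>

typedef maya = "{S :: int set. finite (S - {0..}) \<and> finite ({0..} - S)}"
  morphisms occ Abs_maya
  by (rule exI[of _ "{0..}"]) auto

type_synonym fock = "maya \<Rightarrow> complex"

definition add_label :: "int \<Rightarrow> maya \<Rightarrow> maya" where
  "add_label k S = Abs_maya (insert k (occ S))"

definition del_label :: "int \<Rightarrow> maya \<Rightarrow> maya" where
  "del_label k S = Abs_maya (occ S - {k})"

definition wedge_sign :: "int \<Rightarrow> maya \<Rightarrow> complex" where
  "wedge_sign k S = (- 1) ^ card {j \<in> occ S. j < k}"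

text \<open>
  \<open>psi k v S\<close> is the coefficient of the basis vector \<open>S\<close> in \<open>\<psi>\<^bsub>k+1/2\<^esub> v\<close>, and likewise for \<open>psid\<close>.
\<close>

definition psi :: "int \<Rightarrow> fock \<Rightarrow> fock" where
  "psi k v = (\<lambda>S. if k \<in> occ S then wedge_sign k S * v (del_label k S) else 0)"

definition psid :: "int \<Rightarrow> fock \<Rightarrow> fock" where
  "psid k v = (\<lambda>S. if - k - 1 \<in> occ S then 0
                   else wedge_sign (- k - 1) S * v (add_label (- k - 1) S))"

definition vac :: fock where
  "vac = (\<lambda>S. if occ S = {0..} then 1 else 0)"

lemma occ_add_label: "occ (add_label k S) = insert k (occ S)"
  unfolding add_label_def using occ[of S]
  by (intro Abs_maya_inverse)
     (auto intro: finite_subset[of _ "insert k (occ S - {0..})"] finite_subset[of _ "{0..} - occ S"])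

lemma occ_del_label: "occ (del_label k S) = occ S - {k}"
  unfolding del_label_def using occ[of S]
  by (intro Abs_maya_inverse)
     (auto intro: finite_subset[of _ "insert k ({0..} - occ S)"] finite_subset[of _ "occ S - {0..}"])

lemma finite_occ_below: "finite {j \<in> occ S. j < k}"
  by (rule finite_subset[of _ "(occ S - {0..}) \<union> {0..<k}"]) (use occ[of S] in auto)

lemma wedge_sign_add:
  assumes "l \<notin> occ S"
  shows "wedge_sign k (add_label l S) = (if l < k then - wedge_sign k S else wedge_sign k S)"
proof (cases "l < k")
  case True
  have "{j \<in> insert l (occ S). j < k} = insert l {j \<in> occ S. j < k}" using True by auto
  thus ?thesis using True assms finite_occ_below[of S k]
    by (simp add: wedge_sign_def occ_add_label)
next
  case False
  have "{j \<in> insert l (occ S). j < k} = {j \<in> occ S. j < k}" using False by auto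
  thus ?thesis using False by (simp add: wedge_sign_def occ_add_label)
qed

lemma add_del_label: "l \<in> occ S \<Longrightarrow> add_label l (del_label l S) = S"
  and del_add_label: "l \<notin> occ S \<Longrightarrow> del_label l (add_label l S) = S"
  by (auto simp: occ_inject[symmetric] occ_add_label occ_del_label)

lemma wedge_sign_del:
  assumes "l \<in> occ S"
  shows "wedge_sign k (del_label l S) = (if l < k then - wedge_sign k S else wedge_sign k S)"
  using wedge_sign_add[of l "del_label l S" k] assms by (auto simp: add_del_label occ_del_label)

lemma wedge_sign_square: "wedge_sign k S * wedge_sign k S = 1" "wedge_sign k S * (wedge_sign k S * c) = c"
  by (simp_all add: wedge_sign_def power_add[symmetric] mult.assoc[symmetric] mult_2[symmetric])

lemma labels_commute:
  "add_label k (add_label l S) = add_label l (add_label k S)"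
  "del_label k (del_label l S) = del_label l (del_label k S)"
  "k \<noteq> l \<Longrightarrow> add_label k (del_label l S) = del_label l (add_label k S)"
  by (auto simp: occ_inject[symmetric] occ_add_label occ_del_label)

text \<open>The defining relations of the modes and the vacuum; \<open>r + s = 0\<close> reads \<open>k + l = - 1\<close>.\<close>

lemma psi_psid_anticomm:
  "psi k (psid l v) S + psid l (psi k v) S = (if k + l = - 1 then v S else 0)"
proof (cases "k + l = - 1")
  case True
  hence l: "l = - k - 1" by simp
  show ?thesis unfolding l
    by (auto simp: psi_def psid_def occ_add_label occ_del_label add_del_label del_add_label
        wedge_sign_add wedge_sign_del wedge_sign_square)
next
  case False
  define m where "m = - l - 1"
  have "k \<noteq> m" using False by (simp add: m_def)
  thus ?thesis using False
    by (auto simp: psi_def psid_def m_def[symmetric] occ_add_label occ_del_label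
        wedge_sign_add wedge_sign_del labels_commute)
qed

lemma psi_anticomm: "psi k (psi l v) S + psi l (psi k v) S = 0"
  by (cases "k = l") (auto simp: psi_def occ_del_label wedge_sign_del labels_commute(2)[of l])

lemma psid_anticomm: "psid k (psid l v) S + psid l (psid k v) S = 0"
  by (cases "k = l") (auto simp: psid_def occ_add_label wedge_sign_add labels_commute(1)[of "- l - 1"])

lemma psi_vac: "k \<ge> 0 \<Longrightarrow> psi k vac = (\<lambda>S. 0)"
  by (auto simp: psi_def vac_def occ_del_label fun_eq_iff)

lemma psid_vac: "k \<ge> 0 \<Longrightarrow> psid k vac = (\<lambda>S. 0)"
  by (auto simp: psid_def vac_def occ_add_label fun_eq_iff)

text \<open>
  \<open>normal_ord A k B l\<close> is the normally ordered product of the modes \<open>A\<^bsub>k+1/2\<^esub>\<close> and \<open>B\<^bsub>l+1/2\<^esub>\<close>: an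
  annihilation mode standing to the left of a creation mode is moved to the right, with a sign.
\<close>

definition normal_ord ::
  "(int \<Rightarrow> fock \<Rightarrow> fock) \<Rightarrow> int \<Rightarrow> (int \<Rightarrow> fock \<Rightarrow> fock) \<Rightarrow> int \<Rightarrow> fock \<Rightarrow> fock" where
  "normal_ord A k B l v = (\<lambda>S. if k \<ge> 0 \<and> l < 0 then - B l (A k v) S else A k (B l v) S)"

text \<open>
  For each \<open>S\<close>, only finitely many terms of the following sums over modes are nonzero.
\<close>

definition a_op :: "int \<Rightarrow> fock \<Rightarrow> fock" where
  "a_op n v = (\<lambda>S. - (\<Sum>\<^sub>\<infinity>k. normal_ord psi k psid (n - k - 1) v S))"

definition b_op :: "complex \<Rightarrow> int \<Rightarrow> fock \<Rightarrow> fock" where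
  "b_op q n v = (\<lambda>S. - (\<Sum>\<^sub>\<infinity>k. q powi (n * (k + 1)) * normal_ord psid k psi (- k - 1) v S)
                     + 1 / (1 - q powi (- n)) * v S)"

definition w_op :: "fock \<Rightarrow> fock" where
  "w_op v = (\<lambda>S. \<Sum>\<^sub>\<infinity>k::int. (of_int k + 1 / 2)\<^sup>2 * normal_ord psid k psi (- k - 1) v S)"

definition L0_op :: "fock \<Rightarrow> fock" where
  "L0_op v = (\<lambda>S. \<Sum>\<^sub>\<infinity>n\<in>{1::nat..}. a_op (- int n) (a_op (int n) v) S)"

text \<open>The vector \<open>|\<lambda>\<rangle>\<close>.\<close>

definition ket :: "ptn \<Rightarrow> fock" where
  "ket l = foldr (\<lambda>i v S. (- 1) powi (- int (l i) + (int i + 1)) *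
                          psi (- int (conjugate l i) + int i) (psid (- int (l i) + int i) v) S)
             [0..<diag_len l] vac"

text \<open>
  The functional \<open>\<langle>\<lambda>|\<close>. As \<open>|\<lambda>\<rangle>\<close> is a basis vector of the wedge basis up to sign, the dual basis
  is given by the pairing for which the wedge basis is orthonormal.
\<close>

definition bra :: "ptn \<Rightarrow> fock \<Rightarrow> complex" where
  "bra l v = (\<Sum>\<^sub>\<infinity>S. ket l S * v S)"

section \<open>Exponentials of operators\<close>

definition op_exp :: "(('i \<Rightarrow> complex) \<Rightarrow> 'i \<Rightarrow> complex) \<Rightarrow> ('i \<Rightarrow> complex) \<Rightarrow> 'i \<Rightarrow> complex" where
  "op_exp A v = (\<lambda>i. \<Sum>j. (A ^^ j) v i / fact j)"

text \<open>
  \<open>z\<^bsup>A\<^esup>\<close> for \<open>z \<noteq> 0\<close>. It is used only for operators with integer eigenvalues, where the branch of the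
  logarithm does not matter.
\<close>

definition op_power :: "complex \<Rightarrow> (('i \<Rightarrow> complex) \<Rightarrow> 'i \<Rightarrow> complex) \<Rightarrow> ('i \<Rightarrow> complex) \<Rightarrow> 'i \<Rightarrow> complex" where
  "op_power z A = op_exp (\<lambda>v i. Ln z * A v i)"

section \<open>The S-dual vacuum\<close>

definition norm_vac :: "complex \<Rightarrow> complex" where
  "norm_vac q = (\<Prod>n. (1 - q ^ (n + 1)) powr (- of_nat (n + 1) / 2))"

text \<open>In both series, the summation index \<open>l\<close> is shifted so as to start from 0.\<close>

definition S_ket :: "complex \<Rightarrow> fock" where
  "S_ket q = (\<lambda>S. norm_vac q *
     op_exp (\<lambda>v S. - (\<Sum>\<^sub>\<infinity>n\<in>{1::nat..}. a_op (- int n) v S / of_nat n * (\<Sum>l. q ^ (l * n)))) vac S)"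

definition S_bra :: "complex \<Rightarrow> fock \<Rightarrow> complex" where
  "S_bra q v = norm_vac q *
     bra empty_ptn
       (op_exp (\<lambda>v S. \<Sum>\<^sub>\<infinity>n\<in>{1::nat..}. a_op (int n) v S / of_nat n * (\<Sum>l. q ^ ((l + 1) * n))) v)"

section \<open>Three copies of the Fock space\<close>

type_synonym fock3 = "maya \<times> maya \<times> maya \<Rightarrow> complex"

definition tensor3 :: "fock \<Rightarrow> fock \<Rightarrow> fock \<Rightarrow> fock3" where
  "tensor3 u v w = (\<lambda>(S1, S2, S3). u S1 * v S2 * w S3)"

definition on1 :: "(fock \<Rightarrow> fock) \<Rightarrow> fock3 \<Rightarrow> fock3" where
  "on1 A F = (\<lambda>(S1, S2, S3). A (\<lambda>S. F (S, S2, S3)) S1)"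

definition on2 :: "(fock \<Rightarrow> fock) \<Rightarrow> fock3 \<Rightarrow> fock3" where
  "on2 A F = (\<lambda>(S1, S2, S3). A (\<lambda>S. F (S1, S, S3)) S2)"

definition on3 :: "(fock \<Rightarrow> fock) \<Rightarrow> fock3 \<Rightarrow> fock3" where
  "on3 A F = (\<lambda>(S1, S2, S3). A (\<lambda>S. F (S1, S2, S)) S3)"

text \<open>Application of a functional on each copy.\<close>

definition pair3 ::
  "(fock \<Rightarrow> complex) \<Rightarrow> (fock \<Rightarrow> complex) \<Rightarrow> (fock \<Rightarrow> complex) \<Rightarrow> fock3 \<Rightarrow> complex" where
  "pair3 f g h F = h (\<lambda>S3. g (\<lambda>S2. f (\<lambda>S1. F (S1, S2, S3))))"

section \<open>The intertwiners\<close>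

text \<open>Coefficient of \<open>|\<lambda>\<rangle> \<otimes> |\<mu>\<rangle> \<otimes> \<langle>\<nu>|\<close> in the first intertwiner.\<close>

definition Phi_star :: "complex \<Rightarrow> int \<Rightarrow> ptn \<Rightarrow> ptn \<Rightarrow> ptn \<Rightarrow> complex" where
  "Phi_star qh N la mu nu =
     ((- 1) powi N * qh) ^ psize la * framing qh la powi N *
     (- (qh powi (- 1))) ^ psize mu * framing qh mu powi (- 1) *
     qh ^ psize nu * top_vertex qh (conjugate nu) mu la"

text \<open>Coefficient of \<open>\<langle>\<lambda>| \<otimes> \<langle>\<mu>| \<otimes> |\<nu>\<rangle>\<close> in the second intertwiner.\<close>

definition Phi :: "complex \<Rightarrow> int \<Rightarrow> ptn \<Rightarrow> ptn \<Rightarrow> ptn \<Rightarrow> complex" where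
  "Phi qh N la mu nu =
     (- ((- 1) powi N) * qh powi (- 1)) ^ psize la * framing qh la powi (- N) *
     qh ^ psize mu * framing qh mu *
     (- (qh powi (- 1))) ^ psize nu * top_vertex qh nu (conjugate mu) (conjugate la)"

text \<open>The exponents of the two free field expressions.\<close>

definition E_star :: "complex \<Rightarrow> fock3 \<Rightarrow> fock3" where
  "E_star q F = (\<lambda>t. \<Sum>\<^sub>\<infinity>n\<in>{1::nat..}. 1 / of_nat n *
     (- ((- 1) ^ n) * on1 (b_op q (int n)) (on3 (a_op (int n)) F) t
      + on2 (a_op (- int n)) (on3 (a_op (int n)) F) t
      + (- 1) ^ n * on1 (b_op q (- int n)) (on2 (a_op (- int n)) F) t))"

definition E_op :: "complex \<Rightarrow> fock3 \<Rightarrow> fock3" where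
  "E_op q F = (\<lambda>t. \<Sum>\<^sub>\<infinity>n\<in>{1::nat..}. 1 / of_nat n *
     ((- 1) ^ n * on1 (b_op q (int n)) (on2 (a_op (int n)) F) t
      + on2 (a_op (int n)) (on3 (a_op (- int n)) F) t
      - (- 1) ^ n * on1 (b_op q (- int n)) (on3 (a_op (- int n)) F) t))"

text \<open>
  The operator acting on copy 1 next to the S-dual bra vacuum must be \<open>q\<^bsup>-L\<^sub>0\<^esup>\<close>, not \<open>(-q)\<^bsup>-L\<^sub>0\<^esup>\<close>, for
  the free field expression to have the coefficients \<open>Phi\<close>: the two choices differ by the sign
  \<open>(-1)\<^bsup>|\<lambda>|\<^esup>\<close>. At \<open>\<lambda> = (1)\<close>, \<open>\<mu> = \<nu> = \<emptyset>\<close>, one has \<open>\<langle>0| a\<^sub>1 |\<lambda>\<rangle> = -1\<close>, so that the expression with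
  \<open>(-q)\<^bsup>-L\<^sub>0\<^esup>\<close> gives \<open>1/(1 - q)\<close>, whereas \<open>Phi\<close> is \<open>-1/(1 - q)\<close>.
\<close>

end

theory Submission
  imports Defs
begin

text \<open>
  On copy 1 the modes \<open>b\<^sub>n\<close> and \<open>w\<close> are diagonal; on \<open>|\<lambda>\<rangle>\<close> the eigenvalues of \<open>b\<^sub>n\<close> are power sums in
  \<open>q\<^bsup>-\<lambda>-\<rho>\<^esup>\<close> and \<open>q\<^bsup>-\<lambda>'-\<rho>\<^esup>\<close>. Transposing the copy in which modes are annihilated turns the whole exponent
  into commuting creation operators, so that the matrix elements factor into half vertex operators
  \<open>\<Gamma>(c) = exp (\<Sum> c\<^sub>n a\<^sub>-\<^sub>n / n)\<close> around \<open>exp (\<Sum> a\<^sub>-\<^sub>n \<otimes> a\<^sub>-\<^sub>n / n) |0\<rangle> \<otimes> |0\<rangle>\<close>. The latter is the identity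
  \<open>\<Sum> |\<eta>\<rangle> \<otimes> |\<eta>\<rangle>\<close>, because \<open>L\<^sub>0\<close> is the energy and both sides obey the same recursion in the energy.
  Finally, \<open>\<langle>\<mu>|\<Gamma>(c)|\<eta>\<rangle>\<close> is a skew Schur function: for one variable both sides satisfy Newton's identity,
  more variables are added by \<open>\<Gamma>(c) \<Gamma>(c') = \<Gamma>(c + c')\<close>, and infinitely many by a limit.
\<close>

section \<open>Exponentials of locally nilpotent operators\<close>

text \<open>Vectors are arbitrary functions on Maya diagrams and operators are arbitrary maps of
  such functions, so neither linearity nor convergence comes for free. What replaces both is that
  each mode computes every output coefficient from finitely many input coefficients. Creation modes
  moreover read only lower energies, so their exponentials are finite sums at each diagram.
  Annihilation modes read higher energies and lack this; hence the copy in which they act is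
  transposed before anything is summed.

  The wedge basis contains all charges, while partitions label charge zero only. Completeness of the
  bosonic states and the uniqueness arguments are therefore confined to \<open>neutral\<close>
  diagrams, which creation modes do not leave.

  With a_n carrying a minus sign, \<Gamma> with coefficients (-1)^n p_n(x) has the matrix elements
  s_(\<mu>/\<eta>)(x), and with -p_n(x) those of the conjugate shapes. Which of the two forms
  applies, and whether x or -x is inserted, is read off from the signs (-1)^n in the
  exponents.\<close>

definition bas :: "'i \<Rightarrow> 'i \<Rightarrow> complex" where
  "bas i = (\<lambda>j. if j = i then 1 else 0)"

text \<open>Finite support is part of the definition because formal vectors have infinitely many
  coefficients: it allows \<open>f\<close> to be exchanged with other such functionals and with
  pointwise limits, as in \<open>flin_swap\<close> and \<open>flin_tendsto\<close>.\<close>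

definition flin :: "(('i \<Rightarrow> complex) \<Rightarrow> complex) \<Rightarrow> bool" where
  "flin f \<longleftrightarrow> (\<exists>R c. finite R \<and> (\<forall>v. f v = (\<Sum>i\<in>R. c i * v i)))"

lemma flin_sum: "flin f \<Longrightarrow> f (\<lambda>i. \<Sum>k\<in>K. g k i) = (\<Sum>k\<in>K. f (g k))"
  unfolding flin_def by (auto simp: sum_distrib_left intro: sum.swap)

lemma flin_add: "flin f \<Longrightarrow> f (\<lambda>i. v i + w i) = f v + f w"
  unfolding flin_def by (auto simp: algebra_simps sum.distrib)

lemma flin_scale: "flin f \<Longrightarrow> f (\<lambda>i. c * v i) = c * f v"
  unfolding flin_def by (auto simp: sum_distrib_left mult_ac)

lemma flin_zero: "flin f \<Longrightarrow> f (\<lambda>i. 0) = 0"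
  unfolding flin_def by auto

lemma flin_divide: "flin f \<Longrightarrow> f (\<lambda>i. v i / c) = f v / c"
  using flin_scale[of f "1 / c" v] by simp

lemma flin_eval: "flin (\<lambda>v. v i)"
  unfolding flin_def by (rule exI[of _ "{i}"], rule exI[of _ "\<lambda>_. 1"]) simp

lemma flin_cmult:
  assumes "flin f" shows "flin (\<lambda>v. c * f v)"
proof -
  obtain R a where "finite R" "\<And>v. f v = (\<Sum>i\<in>R. a i * v i)" using assms by (auto simp: flin_def)
  then show ?thesis unfolding flin_def
    by (intro exI[of _ R] exI[of _ "\<lambda>i. c * a i"]) (auto simp: sum_distrib_left mult_ac)
qed

lemma flin_const0: "flin (\<lambda>v. 0)"
  unfolding flin_def by (rule exI[of _ "{}"]) simp

lemma flin_plus: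
  assumes "flin f" "flin g" shows "flin (\<lambda>v. f v + g v)"
proof -
  obtain R a where R: "finite R" "\<And>v. f v = (\<Sum>i\<in>R. a i * v i)" using assms by (auto simp: flin_def)
  obtain R' a' where R': "finite R'" "\<And>v. g v = (\<Sum>i\<in>R'. a' i * v i)" using assms by (auto simp: flin_def)
  have "f v + g v = (\<Sum>i\<in>R \<union> R'. ((if i \<in> R then a i else 0) + (if i \<in> R' then a' i else 0)) * v i)" for v
  proof -
    have "(\<Sum>i\<in>R \<union> R'. (if i \<in> R then a i else 0) * v i) = f v"
      unfolding R(2) by (rule sum.mono_neutral_cong_right) (use R R' in auto)
    moreover have "(\<Sum>i\<in>R \<union> R'. (if i \<in> R' then a' i else 0) * v i) = g v"
      unfolding R'(2) by (rule sum.mono_neutral_cong_right) (use R R' in auto)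
    ultimately show ?thesis by (simp add: ring_distribs sum.distrib)
  qed
  then show ?thesis unfolding flin_def using R R'
    by (intro exI[of _ "R \<union> R'"] exI[of _ "\<lambda>i. (if i \<in> R then a i else 0) + (if i \<in> R' then a' i else 0)"]) simp
qed

lemma flin_sumI:
  assumes "\<And>k. k \<in> K \<Longrightarrow> flin (f k)" shows "flin (\<lambda>v. \<Sum>k\<in>K. f k v)"
proof (cases "finite K")
  case True
  then show ?thesis using assms
    by (induction K rule: finite_induct) (auto intro: flin_plus flin_const0)
qed (simp add: flin_const0)

lemma flin_comp:
  assumes "flin f" "\<And>i. flin (\<lambda>v. A v i)" shows "flin (\<lambda>v. f (A v))"
proof -
  obtain R a where "finite R" "\<And>v. f v = (\<Sum>i\<in>R. a i * v i)" using assms by (auto simp: flin_def)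
  then show ?thesis using assms(2) by (auto intro!: flin_sumI flin_cmult)
qed

lemma flin_expand:
  assumes "flin f"
  obtains R where "finite R" "\<And>i. i \<notin> R \<Longrightarrow> f (bas i) = 0" "\<And>v. f v = (\<Sum>i\<in>R. f (bas i) * v i)"
proof -
  obtain R a where R: "finite R" "\<And>v. f v = (\<Sum>i\<in>R. a i * v i)" using assms by (auto simp: flin_def)
  have b: "f (bas i) = (if i \<in> R then a i else 0)" for i
  proof -
    have "f (bas i) = (\<Sum>j\<in>R. if j = i then a j else 0)"
      unfolding R(2) by (rule sum.cong) (auto simp: bas_def)
    then show ?thesis using R(1) by simp
  qed
  show ?thesis by (rule that[of R]) (use R b in auto)
qed

text \<open>A lowering operator is locally nilpotent, so that its exponential is a finite sum at every
  index.\<close>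

definition lowering :: "('i \<Rightarrow> nat) \<Rightarrow> (('i \<Rightarrow> complex) \<Rightarrow> 'i \<Rightarrow> complex) \<Rightarrow> bool" where
  "lowering d A \<longleftrightarrow> (\<forall>i. flin (\<lambda>v. A v i) \<and>
     (\<forall>v w. (\<forall>j. d j < d i \<longrightarrow> v j = w j) \<longrightarrow> A v i = A w i))"

lemma loweringD:
  assumes "lowering d A"
  shows "flin (\<lambda>v. A v i)" "(\<And>j. d j < d i \<Longrightarrow> v j = w j) \<Longrightarrow> A v i = A w i"
  using assms by (auto simp: lowering_def)

lemma loweringI:
  fixes A :: "('i \<Rightarrow> complex) \<Rightarrow> 'i \<Rightarrow> complex"
  assumes "\<And>i. flin (\<lambda>v. A v i)"
    and "\<And>i v w. (\<And>j. d j < d i \<Longrightarrow> v j = w j) \<Longrightarrow> A v i = A w i"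
  shows "lowering d A"
  using assms unfolding lowering_def by blast

lemma lowering_flin_pow:
  assumes "lowering d A" shows "flin (\<lambda>v. (A ^^ j) v i)"
proof (induction j arbitrary: i)
  case (Suc j)
  then show ?case using flin_comp[OF loweringD(1)[OF assms], of "A ^^ j"] by simp
qed (simp add: flin_eval)

lemma lowering_pow_cong:
  assumes "lowering d A" "\<And>k. d k + j \<le> d i \<Longrightarrow> v k = w k"
  shows "(A ^^ j) v i = (A ^^ j) w i"
  using assms(2)
proof (induction j arbitrary: i)
  case (Suc j)
  show ?case using Suc by (simp, intro loweringD(2)[OF assms(1)]) simp
qed simp

lemma lowering_pow_zero:
  assumes "lowering d A" "d i < j" shows "(A ^^ j) v i = 0"
  using lowering_pow_cong[OF assms(1), of j i v "\<lambda>_. 0"] assms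
    flin_zero[OF lowering_flin_pow[OF assms(1)], of j i] by simp

lemma op_exp_finite:
  assumes "lowering d A" "d i \<le> N"
  shows "op_exp A v i = (\<Sum>j\<le>N. (A ^^ j) v i / fact j)"
  unfolding op_exp_def
  by (rule suminf_finite) (use assms lowering_pow_zero[OF assms(1)] in auto)

lemma op_exp_flin: "lowering d A \<Longrightarrow> flin (\<lambda>v. op_exp A v i)"
  using op_exp_finite[of d A i "d i"]
  by (auto simp: divide_inverse mult.commute intro!: flin_sumI flin_cmult lowering_flin_pow)

lemma pow_commute:
  fixes A B :: "('i \<Rightarrow> complex) \<Rightarrow> 'i \<Rightarrow> complex"
  assumes "\<And>v. A (B v) = B (A v)" shows "(A ^^ j) (B v) = B ((A ^^ j) v)"
  by (induction j) (use assms in auto)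

section \<open>Exponentials of commuting and of graded operators\<close>

lemma lowering_plus:
  assumes "lowering d A" "lowering d B" shows "lowering d (\<lambda>v i. A v i + B v i)"
proof (rule loweringI)
  fix i and v w :: "'a \<Rightarrow> complex" assume "\<And>j. d j < d i \<Longrightarrow> v j = w j"
  then show "A v i + B v i = A w i + B w i"
    using loweringD(2)[OF assms(1), of i v w] loweringD(2)[OF assms(2), of i v w] by simp
qed (intro flin_plus loweringD(1)[OF assms(1)] loweringD(1)[OF assms(2)])

lemma sum_Pascal:
  fixes f :: "nat \<Rightarrow> complex"
  shows "(\<Sum>j\<le>m. of_nat (m choose j) * f (Suc j)) + (\<Sum>j\<le>m. of_nat (m choose j) * f j)
    = (\<Sum>j\<le>Suc m. of_nat (Suc m choose j) * f j)"
proof -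
  have "(\<Sum>j\<le>Suc m. of_nat (Suc m choose j) * f j)
      = f 0 + (\<Sum>j\<le>m. of_nat ((m choose j) + (m choose Suc j)) * f (Suc j))"
    by (simp add: sum.atMost_Suc_shift del: sum.atMost_Suc)
  also have "\<dots> = (\<Sum>j\<le>m. of_nat (m choose j) * f (Suc j)) + (f 0 + (\<Sum>j\<le>m. of_nat (m choose Suc j) * f (Suc j)))"
    by (simp add: sum.distrib ring_distribs)
  also have "f 0 + (\<Sum>j\<le>m. of_nat (m choose Suc j) * f (Suc j)) = (\<Sum>j\<le>Suc m. of_nat (m choose j) * f j)"
    by (simp add: sum.atMost_Suc_shift del: sum.atMost_Suc)
  also have "\<dots> = (\<Sum>j\<le>m. of_nat (m choose j) * f j)" by simp
  finally show ?thesis by simp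
qed

lemma op_binomial:
  assumes A: "lowering d A" and B: "lowering d B" and c: "\<And>v. A (B v) = B (A v)"
  shows "((\<lambda>v i. A v i + B v i) ^^ m) v i = (\<Sum>j\<le>m. of_nat (m choose j) * (A ^^ j) ((B ^^ (m - j)) v) i)"
proof (induction m arbitrary: i)
  case (Suc m)
  let ?S = "\<lambda>i. \<Sum>j\<le>m. of_nat (m choose j) * (A ^^ j) ((B ^^ (m - j)) v) i"
  have fA: "flin (\<lambda>v. A v i)" and fB: "flin (\<lambda>v. B v i)" by (rule loweringD(1)[OF A] loweringD(1)[OF B])+
  have IH: "((\<lambda>v i. A v i + B v i) ^^ m) v = ?S" using Suc by auto
  have "((\<lambda>v i. A v i + B v i) ^^ Suc m) v i = A ?S i + B ?S i"
    by (simp add: IH)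
  also have "A ?S i = (\<Sum>j\<le>m. of_nat (m choose j) * (A ^^ Suc j) ((B ^^ (Suc m - Suc j)) v) i)"
    by (simp add: flin_sum[OF fA] flin_scale[OF fA])
  also have "B ?S i = (\<Sum>j\<le>m. of_nat (m choose j) * (A ^^ j) ((B ^^ (Suc m - j)) v) i)"
    by (simp add: flin_sum[OF fB] flin_scale[OF fB] pow_commute[of A B, OF c, symmetric] Suc_diff_le)
  finally show ?case
    using sum_Pascal[of m "\<lambda>j. (A ^^ j) ((B ^^ (Suc m - j)) v) i"] by simp
qed simp

lemma op_exp_add:
  assumes A: "lowering d A" and B: "lowering d B" and c: "\<And>v. A (B v) = B (A v)"
  shows "op_exp (\<lambda>v i. A v i + B v i) v = op_exp A (op_exp B v)"
proof
  fix i
  define N where "N = d i"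
  define f where "f j l = (A ^^ j) ((B ^^ l) v) i / (fact j * fact l)" for j l
  \<comment> \<open>\<open>A ^^ j\<close> reads only degrees up to \<open>N - j\<close>, where
    \<open>B ^^ l\<close> vanishes if l is larger. So the square of index pairs shrinks to the
    triangle j + l \<le> N, the range of the binomial expansion.\<close>
  have z: "f j l = 0" if "j + l > N" for j l
  proof -
    have "(A ^^ j) ((B ^^ l) v) i = (A ^^ j) (\<lambda>_. 0) i"
      by (rule lowering_pow_cong[OF A], rule lowering_pow_zero[OF B]) (use that in \<open>auto simp: N_def\<close>)
    then show ?thesis using flin_zero[OF lowering_flin_pow[OF A]] by (simp add: f_def)
  qed
  have "op_exp A (op_exp B v) i = (\<Sum>j\<le>N. (A ^^ j) (op_exp B v) i / fact j)"
    by (rule op_exp_finite[OF A]) (simp add: N_def)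
  also have "\<dots> = (\<Sum>j\<le>N. (A ^^ j) (\<lambda>k. \<Sum>l\<le>N. (B ^^ l) v k / fact l) i / fact j)"
    by (intro sum.cong arg_cong2[where f = "(/)"] refl lowering_pow_cong[OF A] op_exp_finite[OF B])
       (simp add: N_def)
  also have "\<dots> = (\<Sum>j\<le>N. \<Sum>l\<le>N. f j l)"
    by (simp add: flin_sum[OF lowering_flin_pow[OF A]] flin_divide[OF lowering_flin_pow[OF A]]
        f_def sum_divide_distrib mult.commute)
  also have "\<dots> = (\<Sum>(j, l)\<in>{..N} \<times> {..N}. f j l)" by (simp add: sum.cartesian_product)
  also have "\<dots> = (\<Sum>(j, l)\<in>{(j, l). j + l \<le> N}. f j l)"
    by (rule sum.mono_neutral_right) (use z in \<open>auto simp: not_le[symmetric]\<close>)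
  also have "\<dots> = (\<Sum>m\<le>N. \<Sum>j\<le>m. f j (m - j))"
    by (rule sum.triangle_reindex_eq)
  also have "\<dots> = (\<Sum>m\<le>N. ((\<lambda>v i. A v i + B v i) ^^ m) v i / fact m)"
  proof (intro sum.cong refl)
    fix m
    show "(\<Sum>j\<le>m. f j (m - j)) = ((\<lambda>v i. A v i + B v i) ^^ m) v i / fact m"
      unfolding op_binomial[OF A B c] sum_divide_distrib f_def
      by (intro sum.cong refl) (simp add: binomial_fact)
  qed
  also have "\<dots> = op_exp (\<lambda>v i. A v i + B v i) v i"
    by (rule op_exp_finite[OF lowering_plus[OF A B], symmetric]) (simp add: N_def)
  finally show "op_exp (\<lambda>v i. A v i + B v i) v i = op_exp A (op_exp B v) i" by simp
qed

text \<open>With D denoting multiplication by \<delta>, the last hypothesis reads [D, A] = C. As A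
  and C commute, [D, A^j] = j C A^(j-1), and summation over j turns this into [D, exp A] = C exp
  A.\<close>

lemma op_exp_deriv:
  assumes A: "lowering d A" and C: "lowering d C"
    and comm: "\<And>v. A (C v) = C (A v)"
    and der: "\<And>v i. \<delta> i * A v i = A (\<lambda>k. \<delta> k * v k) i + C v i"
  shows "\<delta> i * op_exp A v i = op_exp A (\<lambda>k. \<delta> k * v k) i + C (op_exp A v) i"
proof -
  have fA: "flin (\<lambda>v. A v i)" for i by (rule loweringD(1)[OF A])
  have fC: "flin (\<lambda>v. C v i)" for i by (rule loweringD(1)[OF C])
  have pw: "\<delta> i * (A ^^ j) v i = (A ^^ j) (\<lambda>k. \<delta> k * v k) i + of_nat j * C ((A ^^ (j - 1)) v) i" for i j
  proof (induction j arbitrary: i)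
    case (Suc j)
    have "\<delta> i * (A ^^ Suc j) v i = A (\<lambda>k. \<delta> k * (A ^^ j) v k) i + C ((A ^^ j) v) i"
      using der by simp
    also have "A (\<lambda>k. \<delta> k * (A ^^ j) v k) i =
        (A ^^ Suc j) (\<lambda>k. \<delta> k * v k) i + of_nat j * A (C ((A ^^ (j - 1)) v)) i"
      unfolding Suc by (simp add: flin_add[OF fA] flin_scale[OF fA])
    also have "of_nat j * A (C ((A ^^ (j - 1)) v)) i = of_nat j * C ((A ^^ j) v) i"
      by (cases j) (auto simp: comm)
    finally show ?case by (simp add: algebra_simps)
  qed simp
  have "C (op_exp A v) i = C (\<lambda>k. \<Sum>j\<le>d i. (A ^^ j) v k / fact j) i"
    by (rule loweringD(2)[OF C]) (simp add: op_exp_finite[OF A])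
  also have "\<dots> = (\<Sum>j\<le>d i. C ((A ^^ j) v) i / fact j)"
    by (simp add: flin_sum[OF fC] flin_divide[OF fC])
  \<comment> \<open>The index is raised by one, the new term j = 0 being zero; the longer cut-off
    \<open>Suc (d i)\<close> is then used for the other sums as well.\<close>
  also have "\<dots> = (\<Sum>j\<le>Suc (d i). of_nat j * C ((A ^^ (j - 1)) v) i / fact j)"
    unfolding sum.atMost_Suc_shift by (simp del: of_nat_Suc)
  finally have C': "C (op_exp A v) i = \<dots>" .
  have "\<delta> i * op_exp A v i = (\<Sum>j\<le>Suc (d i). \<delta> i * (A ^^ j) v i / fact j)"
    by (subst op_exp_finite[OF A, of i "Suc (d i)"]) (simp_all add: sum_distrib_left del: sum.atMost_Suc)
  then show ?thesis
    unfolding C' pw by (subst op_exp_finite[OF A, of i "Suc (d i)"]) (simp_all add: add_divide_distrib sum.distrib del: sum.atMost_Suc)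
qed

text \<open>The series over modes \<open>n \<ge> 1\<close>, cut off at the index where its terms start to vanish.\<close>

definition modes :: "('i \<Rightarrow> nat) \<Rightarrow> (nat \<Rightarrow> ('i \<Rightarrow> complex) \<Rightarrow> 'i \<Rightarrow> complex) \<Rightarrow> bool" where
  "modes d X \<longleftrightarrow> (\<forall>n\<ge>1. lowering d (X n) \<and> (\<forall>v i. d i < n \<longrightarrow> X n v i = 0))"

definition ser :: "('i \<Rightarrow> nat) \<Rightarrow> (nat \<Rightarrow> complex) \<Rightarrow> (nat \<Rightarrow> ('i \<Rightarrow> complex) \<Rightarrow> 'i \<Rightarrow> complex) \<Rightarrow>
    ('i \<Rightarrow> complex) \<Rightarrow> 'i \<Rightarrow> complex" where
  "ser d c X v i = (\<Sum>n = 1..d i. c n * X n v i)"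

lemma modesD:
  assumes "modes d X" "n \<ge> 1"
  shows "lowering d (X n)" "d i < n \<Longrightarrow> X n v i = 0"
  using assms by (auto simp: modes_def)

text \<open>Lowering the degree by at least n gives both properties at once: at degrees below n
  there is nothing to read, so the value is that at the zero vector.\<close>

lemma modesI:
  fixes X :: "nat \<Rightarrow> ('i \<Rightarrow> complex) \<Rightarrow> 'i \<Rightarrow> complex"
  assumes fin: "\<And>n i. n \<ge> 1 \<Longrightarrow> flin (\<lambda>v. X n v i)"
    and cong: "\<And>n i v w. n \<ge> 1 \<Longrightarrow> (\<And>j. d j + n \<le> d i \<Longrightarrow> v j = w j) \<Longrightarrow> X n v i = X n w i"
  shows "modes d X"
  unfolding modes_def
proof (intro allI conjI impI)
  fix n :: nat assume n: "1 \<le> n"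
  show "lowering d (X n)" using n by (intro loweringI fin cong) auto
  fix v :: "'i \<Rightarrow> complex" and i assume "d i < n"
  then have "X n v i = X n (\<lambda>_. 0) i" using n by (intro cong) auto
  then show "X n v i = 0" using flin_zero[OF fin[OF n]] by simp
qed

lemma ser_bound:
  assumes "modes d X" "d i \<le> N" shows "ser d c X v i = (\<Sum>n = 1..N. c n * X n v i)"
  unfolding ser_def
  by (rule sum.mono_neutral_left) (use assms modesD(2)[OF assms(1)] in auto)

lemma ser_infsum:
  assumes "modes d X" shows "(\<Sum>\<^sub>\<infinity>n\<in>{1..}. c n * X n v i) = ser d c X v i"
proof -
  have "(\<Sum>\<^sub>\<infinity>n\<in>{1..}. c n * X n v i) = (\<Sum>\<^sub>\<infinity>n\<in>{1..d i}. c n * X n v i)"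
    by (rule infsum_cong_neutral) (use modesD(2)[OF assms] in auto)
  then show ?thesis by (simp add: ser_def)
qed

lemma lowering_ser:
  assumes "modes d X" shows "lowering d (ser d c X)"
proof (rule loweringI)
  fix i
  show "flin (\<lambda>v. ser d c X v i)" unfolding ser_def
    by (intro flin_sumI flin_cmult loweringD(1)[OF modesD(1)[OF assms]]) simp
next
  fix i and v w :: "'a \<Rightarrow> complex" assume "\<And>j. d j < d i \<Longrightarrow> v j = w j"
  then show "ser d c X v i = ser d c X w i" unfolding ser_def
    by (intro sum.cong refl arg_cong2[where f = "(*)"] loweringD(2)[OF modesD(1)[OF assms]]) auto
qed

lemma ser_commute1:
  assumes X: "modes d X" and B: "lowering d B" and c: "\<And>n v. n \<ge> 1 \<Longrightarrow> X n (B v) = B (X n v)"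
  shows "ser d c X (B v) = B (ser d c X v)"
proof
  fix i
  have fB: "flin (\<lambda>v. B v i)" by (rule loweringD(1)[OF B])
  \<comment> \<open>\<open>B\<close> reads its argument only below degree \<open>d i\<close>, where
    each cut-off may be raised to the common value \<open>d i\<close>. The sum is then finite and
    the same at all indices, so \<open>B\<close> passes through it.\<close>
  have "B (ser d c X v) i = B (\<lambda>k. \<Sum>n = 1..d i. c n * X n v k) i"
    by (rule loweringD(2)[OF B]) (use ser_bound[OF X] in \<open>simp add: less_imp_le\<close>)
  also have "\<dots> = (\<Sum>n = 1..d i. c n * X n (B v) i)"
    by (simp add: flin_sum[OF fB] flin_scale[OF fB] c)
  finally show "ser d c X (B v) i = B (ser d c X v) i" by (simp add: ser_def)
qed

lemma ser_commute:
  assumes "modes d X" "modes d Y" "\<And>n m v. n \<ge> 1 \<Longrightarrow> m \<ge> 1 \<Longrightarrow> X n (Y m v) = Y m (X n v)"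
  shows "ser d c X (ser d c' Y v) = ser d c' Y (ser d c X v)"
  by (rule ser_commute1[OF assms(1) lowering_ser[OF assms(2)]],
      rule ser_commute1[OF assms(2) modesD(1)[OF assms(1)], symmetric]) (use assms(3) in auto)

lemma ser_add: "ser d c X v i + ser d c' X v i = ser d (\<lambda>n. c n + c' n) X v i"
  by (simp add: ser_def ring_distribs sum.distrib)

text \<open>The mode \<open>X n\<close> has weight n with respect to \<delta>, and this n cancels
  the denominator in the exponent, leaving the series with coefficients c. The later recursions in
  the energy are instances of this.\<close>

lemma op_exp_ser_deriv:
  assumes X: "modes d X" and c: "\<And>n m v. n \<ge> 1 \<Longrightarrow> m \<ge> 1 \<Longrightarrow> X n (X m v) = X m (X n v)"
    and w: "\<And>n v i. n \<ge> 1 \<Longrightarrow> \<delta> i * X n v i = X n (\<lambda>k. \<delta> k * v k) i + of_nat n * X n v i"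
  shows "\<delta> i * op_exp (ser d (\<lambda>n. c n / of_nat n) X) v i
    = op_exp (ser d (\<lambda>n. c n / of_nat n) X) (\<lambda>k. \<delta> k * v k) i
      + ser d c X (op_exp (ser d (\<lambda>n. c n / of_nat n) X) v) i"
proof (rule op_exp_deriv[OF lowering_ser[OF X] lowering_ser[OF X] ser_commute[OF X X c]])
  fix v i
  have "\<delta> i * (c n / of_nat n * X n v i) = c n / of_nat n * X n (\<lambda>k. \<delta> k * v k) i + c n * X n v i"
    if "n \<ge> 1" for n
  proof -
    have "\<delta> i * (c n / of_nat n * X n v i) = c n / of_nat n * (\<delta> i * X n v i)" by simp
    also have "\<dots> = c n / of_nat n * X n (\<lambda>k. \<delta> k * v k) i + c n * X n v i"
      unfolding w[OF that] using that by (simp add: field_simps)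
    finally show ?thesis .
  qed
  then show "\<delta> i * ser d (\<lambda>n. c n / of_nat n) X v i
      = ser d (\<lambda>n. c n / of_nat n) X (\<lambda>k. \<delta> k * v k) i + ser d c X v i"
    by (simp add: ser_def sum_distrib_left sum.distrib[symmetric])
qed auto

section \<open>Creation operators and the energy\<close>

text \<open>The matrix unit E_kj of gl(infinity): on wedge basis vectors it carries a particle from
  j to k. On coefficients it reads the opposite move, hence \<open>moved k j S\<close>, where k has
  been replaced by j.\<close>

definition hop :: "int \<Rightarrow> int \<Rightarrow> fock \<Rightarrow> fock" where
  "hop k j v = psi k (psid (- j - 1) v)"

definition moved :: "int \<Rightarrow> int \<Rightarrow> maya \<Rightarrow> maya" where
  "moved k j S = add_label j (del_label k S)"

lemma occ_moved: "occ (moved k j S) = insert j (occ S - {k})"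
  by (simp add: moved_def occ_add_label occ_del_label)

lemma hop_eq: "k \<noteq> j \<Longrightarrow> hop k j v S =
    (if k \<in> occ S \<and> j \<notin> occ S then wedge_sign k S * wedge_sign j (del_label k S) * v (moved k j S) else 0)"
  by (auto simp: hop_def psi_def psid_def moved_def occ_del_label)

lemma flin_psi: "flin (\<lambda>v. psi k v S)"
  by (cases "k \<in> occ S") (auto simp: psi_def intro!: flin_cmult flin_eval flin_const0)

lemma flin_psid: "flin (\<lambda>v. psid k v S)"
  by (cases "- k - 1 \<in> occ S") (auto simp: psid_def intro!: flin_cmult flin_eval flin_const0)

lemma flin_hop: "flin (\<lambda>v. hop k j v S)"
  unfolding hop_def by (rule flin_comp[of "\<lambda>v. psi k v S", OF flin_psi flin_psid])

lemma psi_uminus: "psi k (\<lambda>S. - v S) = (\<lambda>S. - psi k v S)"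
  by (auto simp: psi_def)

lemma psi_zero: "psi k (\<lambda>S. 0) = (\<lambda>S. 0)"
  by (auto simp: psi_def)

text \<open>A nonzero entry requires that S without k equals T without j; both sides then carry the
  product of the wedge signs of k and of j in this common remainder, which is symmetric.\<close>

lemma hop_swap:
  assumes "k \<noteq> j" shows "hop k j (bas T) S = hop j k (bas S) T"
proof -
  have *: "hop j k (bas S) T = hop k j (bas T) S" if "k \<noteq> j" "k \<in> occ S" "j \<notin> occ S" "T = moved k j S" for k j S T
  proof -
    have T: "j \<in> occ T" "k \<notin> occ T" "del_label j T = del_label k S"
      using that by (auto simp: occ_moved) (simp add: moved_def del_add_label occ_del_label)
    have "moved j k T = S" using T that by (simp add: moved_def add_del_label)
    then show ?thesis using that T
      by (auto simp: hop_eq bas_def wedge_sign_del wedge_sign_add moved_def occ_del_label)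
  qed
  show ?thesis
  proof (cases "k \<in> occ S \<and> j \<notin> occ S \<and> T = moved k j S")
    case True
    then show ?thesis using *[of k j S T] assms by auto
  next
    case False
    then have 0: "hop k j (bas T) S = 0" using assms by (auto simp: hop_eq bas_def)
    have "\<not> (j \<in> occ T \<and> k \<notin> occ T \<and> S = moved j k T)"
    proof
      assume T: "j \<in> occ T \<and> k \<notin> occ T \<and> S = moved j k T"
      then have "T = moved k j S" by (simp add: moved_def del_add_label add_del_label occ_del_label)
      then show False using T False assms by (auto simp: occ_moved)
    qed
    then have "hop j k (bas S) T = 0" using assms by (auto simp: hop_eq bas_def)
    then show ?thesis using 0 by simp
  qed
qed

text \<open>For n nonzero the two modes never contract, so they anticommute and normal ordering has
  no effect.\<close>

lemma normal_ord_hop: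
  assumes "n \<noteq> 0" shows "normal_ord psi k psid (n - k - 1) v S = hop k (k - n) v S"
proof -
  have "psi k (psid (n - k - 1) v) S + psid (n - k - 1) (psi k v) S = 0"
    using psi_psid_anticomm[of k "n - k - 1" v S] assms by auto
  then have "- psid (n - k - 1) (psi k v) S = psi k (psid (n - k - 1) v) S" by (simp add: add_eq_0_iff)
  moreover have "- (k - n) - 1 = n - k - 1" by simp
  ultimately show ?thesis by (simp add: normal_ord_def hop_def)
qed

lemma a_op_hop:
  assumes "n \<noteq> 0" "finite K" "\<And>k. k \<in> occ S \<Longrightarrow> k - n \<notin> occ S \<Longrightarrow> k \<in> K"
  shows "a_op n v S = - (\<Sum>k\<in>K. hop k (k - n) v S)"
proof -
  have "(\<Sum>\<^sub>\<infinity>k. normal_ord psi k psid (n - k - 1) v S) = (\<Sum>\<^sub>\<infinity>k\<in>K. hop k (k - n) v S)"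
    by (rule infsum_cong_neutral) (use assms in \<open>auto simp: normal_ord_hop hop_eq\<close>)
  then show ?thesis using assms by (simp add: a_op_def)
qed

text \<open>The window [-M, M) bounds all sums over labels. Raising a particle preserves it
  (\<open>bd_moved\<close>), so a single M serves for products of two modes.\<close>

definition bd :: "int \<Rightarrow> maya \<Rightarrow> bool" where
  "bd M S \<longleftrightarrow> 0 \<le> M \<and> {M..} \<subseteq> occ S \<and> occ S \<subseteq> {- M..}"

lemma bd_ex: "\<exists>M. bd M S"
proof -
  have f: "finite (occ S - {0..})" "finite ({0..} - occ S)" using occ[of S] by auto
  have "bdd_below (occ S - {0..})" "bdd_above ({0..} - occ S)"
    using f by (auto intro: bdd_below_finite bdd_above_finite)
  then obtain a b where ab: "\<And>x. x \<in> occ S - {0..} \<Longrightarrow> a \<le> x" "\<And>x. x \<in> {0..} - occ S \<Longrightarrow> x \<le> b"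
    by (auto simp: bdd_below_def bdd_above_def)
  have "bd (\<bar>a\<bar> + \<bar>b\<bar> + 1) S" unfolding bd_def
  proof (intro conjI subsetI)
    fix x assume "x \<in> {\<bar>a\<bar> + \<bar>b\<bar> + 1..}"
    then show "x \<in> occ S" using ab(2)[of x] by (cases "x \<in> occ S") (auto simp: abs_if split: if_splits)
  next
    fix x assume "x \<in> occ S"
    then show "x \<in> {- (\<bar>a\<bar> + \<bar>b\<bar> + 1)..}" using ab(1)[of x] by (cases "x \<ge> 0") auto
  qed auto
  then show ?thesis ..
qed

lemma bd_less: "bd M S \<Longrightarrow> x \<notin> occ S \<Longrightarrow> x < M"
  and bd_ge: "bd M S \<Longrightarrow> x \<in> occ S \<Longrightarrow> - M \<le> x"
  and bd_nonneg: "bd M S \<Longrightarrow> 0 \<le> M"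
  by (auto simp: bd_def not_le[symmetric])

lemma bd_moved: "bd M S \<Longrightarrow> k \<in> occ S \<Longrightarrow> j \<notin> occ S \<Longrightarrow> k < j \<Longrightarrow> bd M (moved k j S)"
  using bd_less[of M S j] bd_ge[of M S k] by (auto simp: bd_def occ_moved)

lemma a_op_creation:
  assumes "n > 0" "bd M S"
  shows "a_op (- n) v S = - (\<Sum>k\<in>{- M..<M}. hop k (k + n) v S)"
  using a_op_hop[of "- n" "{- M..<M}" S v] assms bd_less[OF assms(2)] bd_ge[OF assms(2)] by fastforce

lemma hop_cong:
  assumes "k \<noteq> j" "k \<in> occ S \<Longrightarrow> j \<notin> occ S \<Longrightarrow> v (moved k j S) = w (moved k j S)"
  shows "hop k j v S = hop k j w S"
  using assms by (auto simp: hop_eq)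

lemma a_op_flin: "n \<noteq> 0 \<Longrightarrow> flin (\<lambda>v. a_op n v S)"
proof -
  assume n: "n \<noteq> 0"
  obtain M where M: "bd M S" using bd_ex by blast
  have "flin (\<lambda>v. (- 1) * (\<Sum>k\<in>{- M..<M + \<bar>n\<bar>}. hop k (k - n) v S))"
    by (intro flin_cmult flin_sumI flin_hop)
  moreover have "a_op n v S = (- 1) * (\<Sum>k\<in>{- M..<M + \<bar>n\<bar>}. hop k (k - n) v S)" for v
    using a_op_hop[of n "{- M..<M + \<bar>n\<bar>}" S v] n bd_less[OF M] bd_ge[OF M] by fastforce
  ultimately show ?thesis by simp
qed

lemma a_op_transpose:
  assumes "n \<noteq> 0" shows "a_op n (bas T) S = a_op (- n) (bas S) T"
proof -
  obtain M where M: "bd M S" using bd_ex by blast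
  obtain M' where M': "bd M' T" using bd_ex by blast
  let ?K = "{- M - M' - \<bar>n\<bar>..<M + M' + \<bar>n\<bar>}" and ?K' = "{- M - M' - \<bar>n\<bar> - n..<M + M' + \<bar>n\<bar> - n}"
  have "a_op n (bas T) S = - (\<Sum>k\<in>?K. hop k (k - n) (bas T) S)"
    using assms bd_less[OF M] bd_ge[OF M] bd_nonneg[OF M'] by (intro a_op_hop) fastforce+
  also have "(\<Sum>k\<in>?K. hop k (k - n) (bas T) S) = (\<Sum>k\<in>?K. hop (k - n) k (bas S) T)"
    using assms by (intro sum.cong refl hop_swap) auto
  also have "\<dots> = (\<Sum>k\<in>?K'. hop k (k - (- n)) (bas S) T)"
    by (rule sum.reindex_bij_witness[of _ "\<lambda>k. k + n" "\<lambda>k. k - n"]) auto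
  also have "- \<dots> = a_op (- n) (bas S) T"
    using assms bd_less[OF M'] bd_ge[OF M'] bd_nonneg[OF M] by (intro a_op_hop[symmetric]) fastforce+
  finally show ?thesis .
qed

text \<open>Wick's rule: anticommuting the two inner modes contracts them to a single hop if i = l,
  and leaves a quartic term that is antisymmetric both in k, l and in i, j.\<close>

lemma hop_hop:
  "hop k i (hop l j v) S = (if i = l then hop k j v S else 0) - psi k (psi l (psid (- i - 1) (psid (- j - 1) v))) S"
proof -
  have "psid (- i - 1) (psi l w) = (\<lambda>S. (if i = l then w S else 0) - psi l (psid (- i - 1) w) S)" for w
    using psi_psid_anticomm[of l "- i - 1" w] by (auto simp: algebra_simps)
  then have "hop k i (hop l j v) S = psi k (\<lambda>S. (if i = l then psid (- j - 1) v S else 0)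
      + - psi l (psid (- i - 1) (psid (- j - 1) v)) S) S"
    by (simp add: hop_def)
  also have "\<dots> = psi k (\<lambda>S. if i = l then psid (- j - 1) v S else 0) S
      - psi k (psi l (psid (- i - 1) (psid (- j - 1) v))) S"
    by (subst flin_add[OF flin_psi]) (simp add: psi_uminus)
  also have "psi k (\<lambda>S. if i = l then psid (- j - 1) v S else 0) S = (if i = l then hop k j v S else 0)"
    by (auto simp: hop_def psi_zero)
  finally show ?thesis .
qed

lemma psi_psi_swap: "psi k (psi l v) = (\<lambda>S. - psi l (psi k v) S)"
  using psi_anticomm[of k l v] by (auto simp: eq_neg_iff_add_eq_0)

lemma psid_psid_swap: "psid k (psid l v) = (\<lambda>S. - psid l (psid k v) S)"
  using psid_anticomm[of k l v] by (auto simp: eq_neg_iff_add_eq_0)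

text \<open>These are the relations of gl(infinity). Exchanging the two hops exchanges both pairs in
  the quartic term, which costs two signs, so only the contractions survive.\<close>

lemma hop_commutator:
  "hop k i (hop l j v) S - hop l j (hop k i v) S
    = (if i = l then hop k j v S else 0) - (if j = k then hop l i v S else 0)"
proof -
  have "psi k (psi l (psid (- i - 1) (psid (- j - 1) v))) = psi l (psi k (psid (- j - 1) (psid (- i - 1) v)))"
    by (subst psi_psi_swap, subst psid_psid_swap) (simp add: psi_uminus)
  then show ?thesis by (simp add: hop_hop)
qed

lemma a_op_hop_comp:
  assumes "m > 0" "n \<noteq> 0" "bd M S" "finite K"
    and "\<And>S'. bd M S' \<Longrightarrow> a_op n v S' = - (\<Sum>l\<in>K. hop l (l - n) v S')"
  shows "a_op (- m) (a_op n v) S = (\<Sum>k\<in>{- M..<M}. \<Sum>l\<in>K. hop k (k + m) (hop l (l - n) v) S)"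
proof -
  have "hop k (k + m) (a_op n v) S = - (\<Sum>l\<in>K. hop k (k + m) (hop l (l - n) v) S)" for k
  proof -
    have "hop k (k + m) (a_op n v) S = hop k (k + m) (\<lambda>S. (- 1) * (\<Sum>l\<in>K. hop l (l - n) v S)) S"
      using assms(1) by (intro hop_cong) (use assms(5)[OF bd_moved[OF assms(3)]] in auto)
    then show ?thesis by (simp only: flin_scale[OF flin_hop] flin_sum[OF flin_hop]) simp
  qed
  then show ?thesis using assms by (simp add: a_op_creation sum_negf)
qed

text \<open>Both contractions of the commutator give the sum of the hops by m + n. For modes of the
  same sign these sums run over one finite window and cancel exactly, so no central term
  arises.\<close>

lemma creation_commute_int:
  assumes "m > 0" "n > 0"
  shows "a_op (- m) (a_op (- n) v) = a_op (- n) (a_op (- m) v)"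
proof
  fix S
  obtain M where M: "bd M S" using bd_ex by blast
  let ?B = "{- M..<M}"
  have c: "a_op (- m) (a_op (- n) v) S = (\<Sum>k\<in>?B. \<Sum>l\<in>?B. hop k (k + m) (hop l (l + n) v) S)"
    if "m > 0" "n > 0" for m n
    using a_op_hop_comp[of m "- n" M S ?B v] a_op_creation[of n M _ v] that M by simp
  have d: "(\<Sum>k\<in>?B. \<Sum>l\<in>?B. if k + m = l then hop k (l + n) v S else 0) = (\<Sum>k\<in>?B. hop k (k + m + n) v S)"
    if "m > 0" "n > 0" for m n
  proof (intro sum.cong refl)
    fix k assume k: "k \<in> ?B"
    show "(\<Sum>l\<in>?B. if k + m = l then hop k (l + n) v S else 0) = hop k (k + m + n) v S"
    \<comment> \<open>If k + m leaves the window, the inner sum has no term; the hop on the right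
      vanishes too, because k + m + n is occupied.\<close>
    proof (cases "k + m < M")
      case True
      then show ?thesis using k that by simp
    next
      case False
      then have "k + m + n \<in> occ S" using bd_less[OF M, of "k + m + n"] that by force
      then have "hop k (k + m + n) v S = 0" using that by (simp add: hop_eq)
      then show ?thesis using False by simp
    qed
  qed
  have "(\<Sum>k\<in>?B. \<Sum>l\<in>?B. hop k (k + n) (hop l (l + m) v) S) = (\<Sum>k\<in>?B. \<Sum>l\<in>?B. hop l (l + n) (hop k (k + m) v) S)"
    by (rule sum.swap)
  then have "a_op (- m) (a_op (- n) v) S - a_op (- n) (a_op (- m) v) S
      = (\<Sum>k\<in>?B. \<Sum>l\<in>?B. hop k (k + m) (hop l (l + n) v) S - hop l (l + n) (hop k (k + m) v) S)"
    by (simp add: c[OF assms] c[OF assms(2,1)] sum_subtractf)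
  also have "\<dots> = (\<Sum>k\<in>?B. \<Sum>l\<in>?B. if k + m = l then hop k (l + n) v S else 0)
      - (\<Sum>k\<in>?B. \<Sum>l\<in>?B. if l + n = k then hop l (k + m) v S else 0)"
    unfolding hop_commutator sum_subtractf[symmetric] by (intro sum.cong refl)
  also have "(\<Sum>k\<in>?B. \<Sum>l\<in>?B. if l + n = k then hop l (k + m) v S else 0)
      = (\<Sum>l\<in>?B. \<Sum>k\<in>?B. if l + n = k then hop l (k + m) v S else 0)"
    by (rule sum.swap)
  also have "\<dots> = (\<Sum>k\<in>?B. hop k (k + n + m) v S)" by (rule d) (use assms in auto)
  also have "(\<Sum>k\<in>?B. \<Sum>l\<in>?B. if k + m = l then hop k (l + n) v S else 0) - \<dots> = 0"
    unfolding d[OF assms] by (simp add: add_ac)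
  finally show "a_op (- m) (a_op (- n) v) S = a_op (- n) (a_op (- m) v) S" by simp
qed

text \<open>For a diagram of charge zero these pairs correspond to the cells of the partition
  (\<open>energy_mp\<close>), so their number is its size; as a count of pairs it makes sense in
  every charge, as in \<open>L0_op_eq\<close>.\<close>

definition inversions :: "maya \<Rightarrow> (int \<times> int) set" where
  "inversions S = {(a, b). a < b \<and> a \<in> occ S \<and> b \<notin> occ S}"

definition energy :: "maya \<Rightarrow> nat" where
  "energy S = card (inversions S)"

lemma inversions_sub: "bd M S \<Longrightarrow> inversions S \<subseteq> {- M..<M} \<times> {- M..<M}"
  using bd_less[of M S] bd_ge[of M S] by (force simp: inversions_def)

lemma finite_inversions: "finite (inversions S)"
proof -
  obtain M where "bd M S" using bd_ex by blast
  then show ?thesis using inversions_sub finite_subset by blast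
qed

text \<open>Off the diagonal, the products of two hops cancel in pairs: a pair of initial positions and a
  pair of final positions can be matched in two ways, with opposite signs.\<close>

lemma L0_op_eq: "L0_op v S = of_nat (energy S) * v S"
proof -
  obtain M where M: "bd M S" using bd_ex by blast
  \<comment> \<open>For n \<le> 2M, the labels l that are occupied while l - n is empty satisfy -M
    \<le> l < 3M, so this range contains every label that contributes.\<close>
  define R where "R = {- 3 * M..<3 * M}"
  have M0: "M \<ge> 0" by (rule bd_nonneg[OF M])
  define u where "u k l i = psi k (psi l (psid (- i - 1) (psid (- (k + l - i) - 1) v))) S" for k l i
  define h where "h k i l = hop k i (hop l (k + l - i) v) S" for k i l
  have h0: "h k i l = 0" if "k < i" "i \<ge> M \<or> k < - M" for k i l
    using that bd_less[OF M, of i] bd_ge[OF M, of k] by (auto simp: h_def hop_eq)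
  have a0: "a_op (- int n) w S = 0" if "int n > 2 * M" for n w
  proof -
    have "hop k (k + int n) w S = 0" if "k \<in> {- M..<M}" for k
      using bd_less[OF M, of "k + int n"] that \<open>int n > 2 * M\<close> by (subst hop_eq) auto
    then show ?thesis using a_op_creation[of "int n" M S w] M M0 that by simp
  qed
  have aa: "a_op (- int n) (a_op (int n) v) S = (\<Sum>k\<in>R. \<Sum>l\<in>R. h k (k + int n) l)"
    if n: "n \<ge> 1" "int n \<le> 2 * M" for n
  proof -
    have *: "a_op (int n) v S' = - (\<Sum>l\<in>R. hop l (l - int n) v S')" if S': "bd M S'" for S'
      using bd_less[OF S'] bd_ge[OF S'] n M0 by (intro a_op_hop) (force simp: R_def)+
    have "a_op (- int n) (a_op (int n) v) S = (\<Sum>k\<in>{- M..<M}. \<Sum>l\<in>R. hop k (k + int n) (hop l (l - int n) v) S)"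
      using n M by (intro a_op_hop_comp *) (auto simp: R_def)
    also have "\<dots> = (\<Sum>k\<in>{- M..<M}. \<Sum>l\<in>R. h k (k + int n) l)" by (simp add: h_def)
    also have "\<dots> = (\<Sum>k\<in>R. \<Sum>l\<in>R. h k (k + int n) l)"
      by (rule sum.mono_neutral_left) (use n M0 h0 in \<open>auto simp: R_def\<close>)
    finally show ?thesis .
  qed
  have "L0_op v S = (\<Sum>\<^sub>\<infinity>n\<in>{1..nat (6 * M)}. a_op (- int n) (a_op (int n) v) S)"
    unfolding L0_op_def by (rule infsum_cong_neutral) (use a0 in auto)
  also have "\<dots> = (\<Sum>n\<in>{1..nat (6 * M)}. a_op (- int n) (a_op (int n) v) S)" by simp
  also have "\<dots> = (\<Sum>n\<in>{1..nat (6 * M)}. \<Sum>k\<in>R. \<Sum>l\<in>R. h k (k + int n) l)"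
  proof (intro sum.cong refl)
    fix n assume n: "n \<in> {1..nat (6 * M)}"
    show "a_op (- int n) (a_op (int n) v) S = (\<Sum>k\<in>R. \<Sum>l\<in>R. h k (k + int n) l)"
    proof (cases "int n \<le> 2 * M")
      case True
      then show ?thesis using aa n by simp
    next
      case False
      have "h k (k + int n) l = 0" for k l using h0[of k "k + int n" l] n False by force
      then show ?thesis using a0 False by simp
    qed
  qed
  also have "\<dots> = (\<Sum>k\<in>R. \<Sum>n\<in>{1..nat (6 * M)}. \<Sum>l\<in>R. h k (k + int n) l)" by (rule sum.swap)
  also have "\<dots> = (\<Sum>k\<in>R. \<Sum>i\<in>{i \<in> R. k < i}. \<Sum>l\<in>R. h k i l)"
  proof (intro sum.cong refl)
    fix k assume k: "k \<in> R"
    have "(\<Sum>n\<in>{1..nat (6 * M)}. \<Sum>l\<in>R. h k (k + int n) l) = (\<Sum>i\<in>{k<..k + 6 * M}. \<Sum>l\<in>R. h k i l)"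
      by (rule sum.reindex_bij_witness[of _ "\<lambda>i. nat (i - k)" "\<lambda>n. k + int n"]) auto
    also have "\<dots> = (\<Sum>i\<in>{i \<in> R. k < i}. \<Sum>l\<in>R. h k i l)"
      using k h0[of k] M0 by (intro sum.mono_neutral_right) (fastforce simp: R_def intro!: sum.neutral)+
    finally show "(\<Sum>n\<in>{1..nat (6 * M)}. \<Sum>l\<in>R. h k (k + int n) l) = \<dots>" .
  qed
  also have "\<dots> = (\<Sum>k\<in>R. \<Sum>i\<in>{i \<in> R. k < i}. h k i i) - (\<Sum>k\<in>R. \<Sum>i\<in>{i \<in> R. k < i}. \<Sum>l\<in>R - {i}. u k l i)"
  proof -
    have "(\<Sum>l\<in>R. h k i l) = h k i i - (\<Sum>l\<in>R - {i}. u k l i)" if "i \<in> R" for k i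
    proof -
      have "(\<Sum>l\<in>R. h k i l) = h k i i + (\<Sum>l\<in>R - {i}. h k i l)"
        by (rule sum.remove) (use that in \<open>auto simp: R_def\<close>)
      also have "(\<Sum>l\<in>R - {i}. h k i l) = - (\<Sum>l\<in>R - {i}. u k l i)"
        unfolding sum_negf[symmetric] by (intro sum.cong refl) (auto simp: h_def u_def hop_hop)
      finally show ?thesis by simp
    qed
    then show ?thesis by (simp add: sum_subtractf)
  qed
  also have "(\<Sum>k\<in>R. \<Sum>i\<in>{i \<in> R. k < i}. \<Sum>l\<in>R - {i}. u k l i) = 0"
  proof -
    have fin: "finite R" by (simp add: R_def)
    define u' where "u' = (\<lambda>(k, i, l). u k l i)"
    have "(\<Sum>k\<in>R. \<Sum>i\<in>{i \<in> R. k < i}. \<Sum>l\<in>R - {i}. u k l i)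
        = sum u' (SIGMA k:R. SIGMA i:{i \<in> R. k < i}. R - {i})"
      using fin by (simp add: sum.Sigma u'_def)
    \<comment> \<open>The condition k < i breaks the symmetry of the quartic terms. For k < i < l
      the exchange of i and k + l - i preserves it, for l < i the exchange of k and l does; each
      reverses the sign.\<close>
    also have "(SIGMA k:R. SIGMA i:{i \<in> R. k < i}. R - {i})
        = {(k, i, l). k \<in> R \<and> i \<in> R \<and> l \<in> R \<and> k < i \<and> i < l} \<union> {(k, i, l). k \<in> R \<and> i \<in> R \<and> l \<in> R \<and> k < i \<and> l < i}"
      (is "_ = ?Q1 \<union> ?Q2") by auto
    also have "sum u' (?Q1 \<union> ?Q2) = sum u' ?Q1 + sum u' ?Q2"
    proof (rule sum.union_disjoint)
      have "?Q1 \<subseteq> R \<times> R \<times> R" "?Q2 \<subseteq> R \<times> R \<times> R" by auto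
      then show "finite ?Q1" "finite ?Q2" using fin by (auto intro: finite_subset)
    qed auto
    also have "sum u' ?Q1 = 0"
    proof -
      have "sum u' ?Q1 = sum (\<lambda>t. - u' t) ?Q1"
      proof (rule sum.reindex_bij_witness[of _ "\<lambda>(k, i, l). (k, k + l - i, l)" "\<lambda>(k, i, l). (k, k + l - i, l)"])
        fix t assume "t \<in> ?Q1"
        obtain k i l where t: "t = (k, i, l)" by (cases t) auto
        have "u k l i = - u k l (k + l - i)" unfolding u_def
          by (subst psid_psid_swap) (simp add: psi_uminus)
        then show "- u' (case t of (k, i, l) \<Rightarrow> (k, k + l - i, l)) = u' t" by (simp add: t u'_def)
      qed (auto simp: R_def)
      then show ?thesis by (simp add: sum_negf)
    qed
    also have "sum u' ?Q2 = 0"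
    proof -
      have "sum u' ?Q2 = sum (\<lambda>t. - u' t) ?Q2"
      proof (rule sum.reindex_bij_witness[of _ "\<lambda>(k, i, l). (l, i, k)" "\<lambda>(k, i, l). (l, i, k)"])
        fix t assume "t \<in> ?Q2"
        obtain k i l where t: "t = (k, i, l)" by (cases t) auto
        have "u k l i = - u l k i" unfolding u_def
          by (subst psi_psi_swap) (simp add: psi_uminus add.commute)
        then show "- u' (case t of (k, i, l) \<Rightarrow> (l, i, k)) = u' t" by (simp add: t u'_def)
      qed auto
      then show ?thesis by (simp add: sum_negf)
    qed
    finally show ?thesis by simp
  qed
  also have "(\<Sum>k\<in>R. \<Sum>i\<in>{i \<in> R. k < i}. h k i i) = of_nat (energy S) * v S"
  proof -
    have fin: "finite R" by (simp add: R_def)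
    have "h k i i = (if (k, i) \<in> inversions S then v S else 0)" if "k < i" for k i
      using that by (auto simp: h_def hop_def psi_def psid_def inversions_def occ_add_label occ_del_label
          add_del_label del_add_label wedge_sign_add wedge_sign_del wedge_sign_square)
    then have "(\<Sum>k\<in>R. \<Sum>i\<in>{i \<in> R. k < i}. h k i i) = (\<Sum>k\<in>R. \<Sum>i\<in>{i \<in> R. k < i}. if (k, i) \<in> inversions S then v S else 0)"
      by simp
    also have "\<dots> = (\<Sum>p\<in>(SIGMA k:R. {i \<in> R. k < i}). if p \<in> inversions S then v S else 0)"
      using fin by (simp add: sum.Sigma)
    also have "\<dots> = (\<Sum>p\<in>inversions S. v S)"
    proof -
      have "{- M..<M} \<subseteq> R" using M0 by (auto simp: R_def)
      then have "inversions S \<subseteq> (SIGMA k:R. {i \<in> R. k < i})"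
        using inversions_sub[OF M] by (force simp: inversions_def)
      then show ?thesis using fin by (intro sum.mono_neutral_cong_right) auto
    qed
    finally show ?thesis by (simp add: energy_def)
  qed
  finally show ?thesis by simp
qed

lemma card_less_pairs:
  fixes X :: "int set"
  assumes "finite X" shows "card {(a, b). a \<in> X \<and> b \<in> X \<and> a < b} = card X choose 2"
  using assms
proof (induction X rule: finite_induct)
  case (insert x X)
  let ?P = "{(a, b). a \<in> X \<and> b \<in> X \<and> a < b}" and ?f = "\<lambda>a. if a < x then (a, x) else (x, a)"
  have f: "finite ?P" by (rule finite_subset[of _ "X \<times> X"]) (use insert in auto)
  have "x < a" if "a \<in> X" "\<not> a < x" for a
    using that insert(2) by (cases "a = x") auto
  then have e: "{(a, b). a \<in> insert x X \<and> b \<in> insert x X \<and> a < b} = ?P \<union> ?f ` X"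
    by (auto simp: image_iff split: if_splits)
  have "card (?P \<union> ?f ` X) = card ?P + card (?f ` X)"
    using insert f by (intro card_Un_disjoint) (auto split: if_splits)
  also have "card (?f ` X) = card X"
    by (rule card_image) (auto simp: inj_on_def split: if_splits)
  finally show ?case unfolding e using insert by (simp add: numeral_2_eq_2)
qed simp

text \<open>A pair a < b < M with a occupied is an inversion or a pair of particles. The number of
  the latter depends only on the number of particles in the window, which a hop preserves, so the
  change of energy is read off from a linear sum.\<close>

lemma energy_bd:
  assumes "bd M S"
  shows "int (energy S) = (\<Sum>a\<in>occ S \<inter> {- M..<M}. M - 1 - a) - int (card (occ S \<inter> {- M..<M}) choose 2)"
proof -
  let ?X = "occ S \<inter> {- M..<M}"
  let ?P = "{(a, b). a \<in> ?X \<and> b \<in> ?X \<and> a < b}"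
  have 1: "(SIGMA a:?X. {a<..<M}) = inversions S \<union> ?P"
    using bd_less[OF assms] bd_ge[OF assms] by (auto simp: inversions_def) fastforce+
  have fP: "finite ?P" by (rule finite_subset[of _ "?X \<times> ?X"]) auto
  have "int (card (SIGMA a:?X. {a<..<M})) = int (energy S) + int (card ?P)"
    unfolding 1 by (subst card_Un_disjoint) (use finite_inversions fP in \<open>auto simp: inversions_def energy_def\<close>)
  moreover have "card ?P = card ?X choose 2" by (rule card_less_pairs) simp
  moreover have "int (card (SIGMA a:?X. {a<..<M})) = (\<Sum>a\<in>?X. M - 1 - a)"
    by (subst card_SigmaI) (auto intro!: sum.cong)
  ultimately show ?thesis by simp
qed

lemma occ_moved_window:
  assumes M: "bd M S" and "k \<in> occ S" "j \<notin> occ S" "k < j"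
  shows "occ (moved k j S) \<inter> {- M..<M} = insert j (occ S \<inter> {- M..<M} - {k})" "k \<in> occ S \<inter> {- M..<M}"
  using assms(2-) bd_ge[OF M, of k] bd_less[OF M, of j] by (auto simp: occ_moved)

lemma card_moved:
  assumes "bd M S" "k \<in> occ S" "j \<notin> occ S" "k < j"
  shows "card (occ (moved k j S) \<inter> {- M..<M}) = card (occ S \<inter> {- M..<M})"
  using assms(3) occ_moved_window(2)[OF assms] unfolding occ_moved_window(1)[OF assms]
  by (subst card_insert_disjoint)
     (simp_all only: finite_Int finite_atLeastLessThan_int finite_Diff card_Suc_Diff1 Diff_iff Int_iff simp_thms)

lemma energy_moved:
  assumes "k \<in> occ S" "j \<notin> occ S" "k < j"
  shows "int (energy S) = int (energy (moved k j S)) + (j - k)"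
proof -
  obtain M where M: "bd M S" using bd_ex by blast
  let ?X = "occ S \<inter> {- M..<M}"
  have "(\<Sum>a\<in>insert j (?X - {k}). M - 1 - a) = (M - 1 - j) + (\<Sum>a\<in>?X - {k}. M - 1 - a)"
    using assms(2) by (subst sum.insert) auto
  moreover have "(\<Sum>a\<in>?X. M - 1 - a) = (M - 1 - k) + (\<Sum>a\<in>?X - {k}. M - 1 - a)"
    using occ_moved_window(2)[OF M assms] by (intro sum.remove) auto
  ultimately show ?thesis
    unfolding energy_bd[OF M] energy_bd[OF bd_moved[OF M assms]]
    unfolding card_moved[OF M assms] unfolding occ_moved_window(1)[OF M assms] by simp
qed

section \<open>Creation operators as a family of modes graded by the energy, and the diagonal
  operators\<close>

definition creation :: "nat \<Rightarrow> fock \<Rightarrow> fock" where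
  "creation n = a_op (- int n)"

lemma creation_cong:
  assumes "n \<ge> 1" "\<And>T. energy T + n = energy S \<Longrightarrow> v T = w T" shows "creation n v S = creation n w S"
proof -
  obtain M where M: "bd M S" using bd_ex by blast
  have "hop k (k + int n) v S = hop k (k + int n) w S" for k
    by (rule hop_cong) (use assms energy_moved[of k S "k + int n"] in auto)
  then show ?thesis unfolding creation_def using assms(1) M by (simp add: a_op_creation)
qed

lemma creation_flin: "n \<ge> 1 \<Longrightarrow> flin (\<lambda>v. creation n v S)"
  unfolding creation_def by (rule a_op_flin) simp

lemma modes_creation: "modes energy creation"
  by (rule modesI) (auto intro: creation_flin creation_cong)

lemma creation_commute: "n \<ge> 1 \<Longrightarrow> m \<ge> 1 \<Longrightarrow> creation n (creation m v) = creation m (creation n v)"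
  unfolding creation_def by (rule creation_commute_int) auto

lemma creation_weight:
  assumes "n \<ge> 1"
  shows "of_nat (energy S) * creation n v S = creation n (\<lambda>T. of_nat (energy T) * v T) S + of_nat n * creation n v S"
proof (cases "energy S < n")
  case True
  then show ?thesis using modesD(2)[OF modes_creation assms] by simp
next
  case False
  have "creation n (\<lambda>T. of_nat (energy T) * v T) S = creation n (\<lambda>T. of_nat (energy S - n) * v T) S"
    by (rule creation_cong[OF assms]) (metis add_diff_cancel_right')
  also have "\<dots> = of_nat (energy S - n) * creation n v S" by (rule flin_scale[OF creation_flin[OF assms]])
  finally show ?thesis using False by (simp add: of_nat_diff algebra_simps)
qed

text \<open>The sum of f over all unoccupied labels, regularized by subtracting the same sum for the
  vacuum, whose unoccupied labels are the negative ones.\<close>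

definition excess :: "(int \<Rightarrow> complex) \<Rightarrow> maya \<Rightarrow> complex" where
  "excess f S = (\<Sum>j\<in>{0..} - occ S. f j) - (\<Sum>j\<in>occ S - {0..}. f j)"

text \<open>The normally ordered pair counts the hole at the label -k - 1 relative to the vacuum: +1
  for a hole that the vacuum lacks, -1 for a particle where the vacuum has a hole.\<close>

lemma infsum_normal_ord:
  "(\<Sum>\<^sub>\<infinity>k. g k * normal_ord psid k psi (- k - 1) v S) = excess (\<lambda>j. g (- j - 1)) S * v S"
proof -
  have f: "finite (occ S - {0..})" "finite ({0..} - occ S)" using occ[of S] by auto
  have n: "normal_ord psid k psi (- k - 1) v S =
      (if k \<ge> 0 then if - k - 1 \<in> occ S then - v S else 0 else if - k - 1 \<in> occ S then 0 else v S)" for k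
    by (auto simp: normal_ord_def psi_def psid_def occ_add_label occ_del_label
          add_del_label del_add_label wedge_sign_add wedge_sign_del wedge_sign_square)
  let ?A = "{0..} - occ S" and ?B = "occ S - {0..}"
  let ?h = "\<lambda>j. g (- j - 1) * (if j < 0 then if j \<in> occ S then - v S else 0 else if j \<in> occ S then 0 else v S)"
  have "bij_betw (\<lambda>j::int. - j - 1) UNIV UNIV" by (rule bij_betw_byWitness[of _ "\<lambda>j. - j - 1"]) auto
  then have "(\<Sum>\<^sub>\<infinity>k. g k * normal_ord psid k psi (- k - 1) v S)
      = (\<Sum>\<^sub>\<infinity>j. g (- j - 1) * normal_ord psid (- j - 1) psi (- (- j - 1) - 1) v S)"
    by (rule infsum_reindex_bij_betw[symmetric])
  also have "\<dots> = (\<Sum>\<^sub>\<infinity>j\<in>UNIV. ?h j)" unfolding n by (intro infsum_cong) auto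
  also have "\<dots> = (\<Sum>\<^sub>\<infinity>j\<in>?A \<union> ?B. ?h j)"
    by (rule infsum_cong_neutral) auto
  also have "\<dots> = (\<Sum>j\<in>?A \<union> ?B. ?h j)" using f by simp
  also have "\<dots> = (\<Sum>j\<in>?A. ?h j) + (\<Sum>j\<in>?B. ?h j)" using f by (intro sum.union_disjoint) auto
  also have "(\<Sum>j\<in>?A. ?h j) = (\<Sum>j\<in>?A. g (- j - 1)) * v S"
    unfolding sum_distrib_right by (intro sum.cong) auto
  also have "(\<Sum>j\<in>?B. ?h j) = - (\<Sum>j\<in>?B. g (- j - 1)) * v S"
    unfolding sum_distrib_right sum_negf[symmetric] by (intro sum.cong) auto
  finally show ?thesis by (simp add: excess_def algebra_simps)
qed

lemma b_op_eq: "b_op q n v S = (- excess (\<lambda>j. q powi (- n * j)) S + 1 / (1 - q powi (- n))) * v S"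
  unfolding b_op_def infsum_normal_ord by (simp add: algebra_simps)

lemma w_op_eq: "w_op v S = excess (\<lambda>j. (of_int j + 1 / 2)\<^sup>2) S * v S"
proof -
  have "(of_int (- j - 1) + 1 / 2 :: complex)\<^sup>2 = (of_int j + 1 / 2)\<^sup>2" for j
    by (simp add: power2_eq_square field_simps)
  then show ?thesis unfolding w_op_def infsum_normal_ord by simp
qed

section \<open>Partitions and Maya diagrams\<close>

lemma ptn_antimono: "l \<in> partitions \<Longrightarrow> i \<le> j \<Longrightarrow> l j \<le> l i"
  by (auto simp: partitions_def antimono_def)

lemma vanish_less: "(\<And>i::nat. L \<le> i \<Longrightarrow> l i = (0::nat)) \<Longrightarrow> 0 < l i \<Longrightarrow> i < L"
  by (cases "i < L") auto

lemma ptn_vanish: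
  assumes "l \<in> partitions" obtains L where "\<And>i. i \<ge> L \<Longrightarrow> l i = 0"
proof -
  have "finite {i. l i \<noteq> 0}" using assms by (simp add: partitions_def)
  then obtain m where "\<And>i. i \<in> {i. l i \<noteq> 0} \<Longrightarrow> i \<le> m"
    using finite_nat_set_iff_bounded_le[of "{i. l i \<noteq> 0}"] by auto
  then show ?thesis by (intro that[of "Suc m"]) force
qed

lemma ptnI:
  assumes "\<And>i j. i \<le> j \<Longrightarrow> l j \<le> l i" "\<And>i. i \<ge> L \<Longrightarrow> l i = 0" shows "l \<in> partitions"
proof -
  have "{i. l i \<noteq> 0} \<subseteq> {..<L}" using vanish_less[of L l, OF assms(2)] by auto
  then show ?thesis using assms(1) by (auto simp: partitions_def antimono_def intro: finite_subset)
qed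

lemma finite_downset:
  fixes A :: "nat set"
  assumes "finite A" "\<And>i j. j \<in> A \<Longrightarrow> i \<le> j \<Longrightarrow> i \<in> A" shows "A = {..<card A}"
proof (cases "A = {}")
  case False
  let ?m = "Max A"
  have "{..?m} \<subseteq> A" using assms(2)[OF Max_in[OF assms(1) False]] by blast
  moreover have "A \<subseteq> {..?m}" using Max_ge[OF assms(1)] by blast
  ultimately have "A = {..?m}" by blast
  then show ?thesis by (metis card_atMost lessThan_Suc_atMost)
qed simp

lemma conj_less: "l \<in> partitions \<Longrightarrow> j < l i \<longleftrightarrow> i < conjugate l j"
proof -
  assume l: "l \<in> partitions"
  obtain L where L: "\<And>i. i \<ge> L \<Longrightarrow> l i = 0" using ptn_vanish[OF l] by blast
  have "{i. j < l i} \<subseteq> {..<L}" using vanish_less[of L l, OF L] by auto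
  then have "finite {i. j < l i}" using finite_subset by blast
  then have "{i. j < l i} = {..<conjugate l j}" unfolding conjugate_def
    by (rule finite_downset) (use ptn_antimono[OF l] in \<open>auto intro: less_le_trans\<close>)
  then show ?thesis by auto
qed

lemma conj_ptn: assumes "l \<in> partitions" shows "conjugate l \<in> partitions"
proof (rule ptnI)
  fix i j :: nat assume "i \<le> j"
  show "conjugate l j \<le> conjugate l i"
  proof (rule ccontr)
    assume "\<not> ?thesis"
    then have "conjugate l i < conjugate l j" by simp
    then have "j < l (conjugate l i)" using conj_less[OF assms] by simp
    then have "i < l (conjugate l i)" using \<open>i \<le> j\<close> by simp
    then show False using conj_less[OF assms] by simp
  qed
next
  fix i assume "l 0 \<le> i"
  then have "\<not> i < l 0" by simp
  then show "conjugate l i = 0" using conj_less[OF assms, of i 0] by simp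
qed

lemma conj_conj: assumes "l \<in> partitions" shows "conjugate (conjugate l) = l"
proof
  fix i
  have "j < conjugate (conjugate l) i \<longleftrightarrow> j < l i" for j
    using conj_less[OF assms] conj_less[OF conj_ptn[OF assms]] by simp
  from this[of "l i"] this[of "conjugate (conjugate l) i"] show "conjugate (conjugate l) i = l i" by simp
qed

text \<open>The boundary of the Young diagram, read as a lattice path, has its steps at the labels
  \<open>lo l j\<close>, one for each column and increasing, and \<open>hi l i\<close>, one for each
  row and decreasing. The former are the particles, the latter the holes.\<close>

abbreviation lo :: "ptn \<Rightarrow> nat \<Rightarrow> int" where
  "lo l i \<equiv> int i - int (conjugate l i)"

abbreviation hi :: "ptn \<Rightarrow> nat \<Rightarrow> int" where
  "hi l i \<equiv> int (l i) - int i - 1"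

definition maya_of :: "ptn \<Rightarrow> maya" where
  "maya_of l = Abs_maya (range (lo l))"

lemma lo_less_hi: "l \<in> partitions \<Longrightarrow> lo l j < hi l i \<longleftrightarrow> j < l i"
  and hi_less_lo: "l \<in> partitions \<Longrightarrow> hi l i < lo l j \<longleftrightarrow> l i \<le> j"
  using conj_less[of l j i] by auto

lemma lo_strict: "l \<in> partitions \<Longrightarrow> i < j \<Longrightarrow> lo l i < lo l j"
  using ptn_antimono[OF conj_ptn, of l i j] by simp

lemma hi_strict: "l \<in> partitions \<Longrightarrow> i < j \<Longrightarrow> hi l j < hi l i"
  using ptn_antimono[of l i j] by simp

lemma inj_lo: "l \<in> partitions \<Longrightarrow> inj (lo l)"
  by (rule linorder_injI) (metis lo_strict less_irrefl)

lemma inj_hi: "l \<in> partitions \<Longrightarrow> inj (hi l)"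
  by (rule linorder_injI) (metis hi_strict less_irrefl)

text \<open>\<open>lo l j\<close> lies below \<open>hi l i\<close> if (i, j) is a cell and above it
  otherwise, so the two never meet. Conversely, if c is not a value of \<open>hi l\<close> and i
  such values lie above it, then i is the length of the column j = c + i, and c is
  \<open>lo l j\<close>.\<close>

lemma hi_range: assumes l: "l \<in> partitions" shows "range (hi l) = - range (lo l)"
proof (intro set_eqI iffI)
  fix c assume "c \<in> range (hi l)"
  then obtain i where c: "c = hi l i" by auto
  have "hi l i \<noteq> lo l j" for j using lo_less_hi[OF l, of j i] hi_less_lo[OF l, of i j] by linarith
  then show "c \<in> - range (lo l)" using c by auto
next
  fix c assume c: "c \<in> - range (lo l)"
  obtain L where L: "\<And>i. i \<ge> L \<Longrightarrow> l i = 0" using ptn_vanish[OF l] by blast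
  have ex: "\<exists>i. hi l i \<le> c"
    using L[of "L + nat \<bar>c\<bar>"] by (intro exI[of _ "L + nat \<bar>c\<bar>"]) simp
  define i where "i = (LEAST i. hi l i \<le> c)"
  have i: "hi l i \<le> c" unfolding i_def by (rule LeastI_ex[OF ex])
  have before: "c < hi l k" if "k < i" for k using not_less_Least[of k] that unfolding i_def by force
  show "c \<in> range (hi l)"
  proof (rule ccontr)
    assume n: "c \<notin> range (hi l)"
    define j where "j = nat (c + int i)"
    have "hi l i \<noteq> c" using n by blast
    then have lt: "hi l i < c" using i by simp
    then have j: "int j = c + int i" "l i \<le> j" by (auto simp: j_def)
    have "conjugate l j = i"
    proof (rule antisym)
      show "conjugate l j \<le> i" using conj_less[OF l, of j i] j(2) by simp
      show "i \<le> conjugate l j"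
      proof (cases i)
        case (Suc k)
        have "j < l k" using before[of k] Suc j(1) by simp
        then show ?thesis using conj_less[OF l, of j k] Suc by simp
      qed simp
    qed
    then have "c = lo l j" using j(1) by simp
    then show False using c by blast
  qed
qed

lemma occ_mp: assumes l: "l \<in> partitions" shows "occ (maya_of l) = range (lo l)"
  unfolding maya_of_def
proof (rule Abs_maya_inverse, simp, intro conjI)
  obtain L where L: "\<And>i. i \<ge> L \<Longrightarrow> l i = 0" using ptn_vanish[OF l] by blast
  obtain L' where L': "\<And>i. i \<ge> L' \<Longrightarrow> conjugate l i = 0" using ptn_vanish[OF conj_ptn[OF l]] by blast
  have "range (lo l) - {0..} \<subseteq> lo l ` {..<L'}"
    using vanish_less[of L' "conjugate l", OF L'] by (auto simp: image_iff)
  then show "finite (range (lo l) - {0..})" by (rule finite_subset) simp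
  have "{0..} - range (lo l) = {0..} \<inter> range (hi l)" using hi_range[OF l] by auto
  also have "\<dots> \<subseteq> hi l ` {..<L}"
  proof
    fix x assume "x \<in> {0..} \<inter> range (hi l)"
    then obtain i where i: "x = hi l i" "0 \<le> x" by auto
    then have "i < L" using L[of i] by (cases "i < L") auto
    then show "x \<in> hi l ` {..<L}" using i by auto
  qed
  finally show "finite ({0..} - range (lo l))" by (rule finite_subset) simp
qed

lemma notocc_mp: "l \<in> partitions \<Longrightarrow> - occ (maya_of l) = range (hi l)"
  using hi_range occ_mp by simp

lemma strict_enum_unique:
  fixes f g :: "nat \<Rightarrow> int"
  assumes f: "\<And>i j. i < j \<Longrightarrow> f i < f j" and g: "\<And>i j. i < j \<Longrightarrow> g i < g j" and r: "range f = range g"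
  shows "f = g"
proof
  fix n
  have le: "g n \<le> f n" if "\<And>m. m < n \<Longrightarrow> f m = g m" "range f = range g"
     "\<And>i j. i < j \<Longrightarrow> f i < f j" "\<And>i j. i < j \<Longrightarrow> g i < g j" for f g :: "nat \<Rightarrow> int" and n
  proof -
    have "f n \<in> range g" using that(2) by blast
    then obtain m where m: "f n = g m" by blast
    have "n \<le> m"
    proof (rule ccontr)
      assume "\<not> n \<le> m"
      then have "m < n" by simp
      then show False using that(1)[of m] that(3)[of m n] m by simp
    qed
    then show ?thesis using that(4)[of n m] m by (cases "n = m") auto
  qed
  show "f n = g n"
  proof (induction n rule: less_induct)
    case (less n)
    have "g n \<le> f n" by (rule le[OF _ r f g]) (rule less)
    moreover have "f n \<le> g n" by (rule le[OF _ r[symmetric] g f]) (rule less[symmetric])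
    ultimately show ?case by simp
  qed
qed

lemma inj_mp: "inj_on maya_of partitions"
proof (rule inj_onI)
  fix l m assume l: "l \<in> partitions" and m: "m \<in> partitions" and e: "maya_of l = maya_of m"
  have "(\<lambda>i. - hi l i) = (\<lambda>i. - hi m i)"
  proof (rule strict_enum_unique)
    have "range (hi l) = range (hi m)" using e notocc_mp[OF l] notocc_mp[OF m] by simp
    then show "range (\<lambda>i. - hi l i) = range (\<lambda>i. - hi m i)" by (metis image_image)
  qed (use hi_strict[OF l] hi_strict[OF m] in \<open>simp_all only: neg_less_iff_less\<close>)
  then have "l i = m i" for i by (simp add: fun_eq_iff)
  then show "l = m" by auto
qed

section \<open>The charge-zero sector and its basis vectors\<close>

definition neutral :: "maya \<Rightarrow> bool" where
  "neutral S \<longleftrightarrow> card ({0..} - occ S) = card (occ S - {0..})"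

lemma neutral_bd:
  assumes "bd M S" shows "neutral S \<longleftrightarrow> card (occ S \<inter> {- M..<M}) = nat M"
proof -
  let ?A = "{0..} - occ S" and ?B = "occ S - {0..}"
  have f: "finite ?A" "finite ?B" using occ[of S] by auto
  have A: "?A \<subseteq> {0..<M}" using bd_less[OF assms] by auto
  have "occ S \<inter> {- M..<M} = ?B \<union> ({0..<M} - ?A)" using bd_ge[OF assms] bd_nonneg[OF assms] by auto
  then have "card (occ S \<inter> {- M..<M}) = card ?B + card ({0..<M} - ?A)"
    using f by (subst card_Un_disjoint[symmetric]) auto
  also have "card ({0..<M} - ?A) = nat M - card ?A" using A f by (simp add: card_Diff_subset)
  finally have "card (occ S \<inter> {- M..<M}) = card ?B + (nat M - card ?A)" .
  moreover have "card ?A \<le> nat M" using card_mono[OF _ A] by simp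
  ultimately show ?thesis unfolding neutral_def by auto
qed

lemma neutral_moved:
  assumes "k \<in> occ S" "j \<notin> occ S" "k < j" shows "neutral (moved k j S) \<longleftrightarrow> neutral S"
proof -
  obtain M where M: "bd M S" using bd_ex by blast
  show ?thesis
    unfolding neutral_bd[OF M] neutral_bd[OF bd_moved[OF M assms]] card_moved[OF M assms] ..
qed

lemma neutral_ex:
  assumes "neutral S" shows "\<exists>l\<in>partitions. S = maya_of l"
proof -
  obtain M where M: "bd M S" using bd_ex by blast
  let ?X = "occ S \<inter> {- M..<M}"
  define m where "m = nat M"
  have mM: "int m = M" using bd_nonneg[OF M] by (simp add: m_def)
  define xs where "xs = sorted_list_of_set ?X"
  have xs: "set xs = ?X" "sorted_wrt (<) xs" "length xs = m"
    using neutral_bd[OF M] assms by (auto simp: xs_def m_def)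
  \<comment> \<open>Neutrality puts exactly M particles into the window, so the enumeration of all
    particles continues with the label M at index m; hence the default value i.\<close>
  define s where "s i = (if i < m then xs ! i else int i)" for i
  have s_less: "s i < s j" if "i < j" for i j
  proof (cases "j < m")
    case True
    then show ?thesis using that xs(2,3) by (simp add: s_def sorted_wrt_nth_less)
  next
    case False
    have "xs ! i < M" if "i < m" using xs(1,3) that nth_mem[of i xs] by auto
    then show ?thesis using that False mM by (auto simp: s_def)
  qed
  have rs: "range s = occ S"
  proof (intro set_eqI iffI)
    fix x assume "x \<in> range s"
    then obtain i where "x = s i" by auto
    then show "x \<in> occ S" using xs nth_mem[of i xs] M mM by (auto simp: s_def bd_def)
  next
    fix x assume x: "x \<in> occ S"
    show "x \<in> range s"
    proof (cases "x < M")
      case True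
      then have "x \<in> set xs" using x bd_ge[OF M x] xs by simp
      then obtain i where "i < m" "x = xs ! i" using xs(3) by (auto simp: in_set_conv_nth)
      then show ?thesis by (auto simp: s_def image_iff intro!: exI[of _ i])
    next
      case False
      then have "x = s (nat x)" using mM bd_nonneg[OF M] by (auto simp: s_def)
      then show ?thesis by blast
    qed
  qed
  have mono: "s i + int k \<le> s (i + k)" for i k
    by (induction k) (auto intro: order_trans[OF _ zless_imp_add1_zle[OF s_less]])
  have sle: "s i \<le> int i" for i
    using mono[of i m] by (simp add: s_def)
  \<comment> \<open>The labels of the particles encode columns, so this \<open>p\<close> is the
    conjugate of the partition sought. By \<open>sle\<close> the truncation by \<open>nat\<close>
    loses nothing.\<close>
  define p where "p i = nat (int i - s i)" for i
  have p: "p \<in> partitions"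
  proof (rule ptnI[where L = m])
    fix i j :: nat assume "i \<le> j"
    then show "p j \<le> p i" using mono[of i "j - i"] by (simp add: p_def)
  qed (simp add: p_def s_def)
  have "lo (conjugate p) = s" unfolding conj_conj[OF p] using sle by (auto simp: p_def)
  then have "occ S = occ (maya_of (conjugate p))" using occ_mp[OF conj_ptn[OF p]] rs by (simp only:)
  then show ?thesis using conj_ptn[OF p] occ_inject by metis
qed

lemma diag_set: assumes l: "l \<in> partitions" shows "i < l i \<longleftrightarrow> i < diag_len l"
proof -
  obtain L where L: "\<And>i. i \<ge> L \<Longrightarrow> l i = 0" using ptn_vanish[OF l] by blast
  have "{i. i < l i} \<subseteq> {..<L}" using vanish_less[of L l, OF L] by auto
  then have "finite {i. i < l i}" using finite_subset by blast
  then have "{i. i < l i} = {..<diag_len l}" unfolding diag_len_def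
  proof (rule finite_downset)
    fix i j assume "j \<in> {i. i < l i}" "i \<le> j"
    then show "i \<in> {i. i < l i}" using ptn_antimono[OF l, of i j] by simp
  qed
  then show ?thesis by auto
qed

lemma diag_set': "l \<in> partitions \<Longrightarrow> i < conjugate l i \<longleftrightarrow> i < diag_len l"
  using conj_less[of l i i] diag_set by simp

lemma range_neg: "range f - {0..} = f ` {i. f i < 0}" for f :: "nat \<Rightarrow> int"
  by (auto simp: image_iff)

lemma range_nonneg: "{0..} \<inter> range f = f ` {i. 0 \<le> f i}" for f :: "nat \<Rightarrow> int"
  by (auto simp: image_iff)

lemma lo_neg_iff: "l \<in> partitions \<Longrightarrow> lo l i < 0 \<longleftrightarrow> i < diag_len l"
  using diag_set'[of l i] by linarith

lemma hi_nonneg_iff: "l \<in> partitions \<Longrightarrow> 0 \<le> hi l i \<longleftrightarrow> i < diag_len l"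
  using diag_set[of l i] by linarith

lemma occ_mp_neg: "l \<in> partitions \<Longrightarrow> occ (maya_of l) - {0..} = lo l ` {..<diag_len l}"
  unfolding occ_mp range_neg lo_neg_iff by (simp only: lessThan_def)

lemma notocc_mp_nonneg: "l \<in> partitions \<Longrightarrow> {0..} - occ (maya_of l) = hi l ` {..<diag_len l}"
  unfolding Diff_eq notocc_mp range_nonneg hi_nonneg_iff by (simp only: lessThan_def)

lemma neutral_mp: "l \<in> partitions \<Longrightarrow> neutral (maya_of l)"
  unfolding neutral_def
  by (simp add: occ_mp_neg notocc_mp_nonneg card_image inj_on_subset[OF inj_lo] inj_on_subset[OF inj_hi])

lemma empty_ptn: "empty_ptn \<in> partitions"
  by (rule ptnI[of _ 0]) (auto simp: empty_ptn_def)

lemma conj_empty: "conjugate empty_ptn = empty_ptn"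
  by (auto simp: conjugate_def empty_ptn_def)

lemma occ_mp_empty: "occ (maya_of empty_ptn) = {0..}"
proof -
  have "lo empty_ptn = int" by (simp add: conj_empty) (simp add: empty_ptn_def)
  then have "occ (maya_of empty_ptn) = range int" using occ_mp[OF empty_ptn] by (simp only:)
  also have "range int = {0..}"
  proof (intro set_eqI iffI)
    fix x :: int assume "x \<in> {0..}"
    then have "x = int (nat x)" by simp
    then show "x \<in> range int" by (rule range_eqI)
  qed auto
  finally show ?thesis .
qed

lemma vac_bas: "vac = bas (maya_of empty_ptn)"
  by (auto simp: vac_def bas_def fun_eq_iff occ_mp_empty[symmetric] occ_inject)

text \<open>The factors act from the last diagonal cell to the first. Each puts a particle at k,
  below all others, and removes the one at j. Below j there are then j particles besides k, since
  the earlier factors have added as many negative labels as they have removed labels below j. So the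
  wedge sign is (-1)^j, which the prefactor cancels.\<close>

lemma ket_bas:
  assumes l: "l \<in> partitions" shows "ket l = bas (maya_of l)"
proof -
  define d where "d = diag_len l"
  define F where "F i v S = (- 1) powi (- int (l i) + (int i + 1)) *
     psi (- int (conjugate l i) + int i) (psid (- int (l i) + int i) v) S" for i and v :: fock and S
  define Z where "Z e = ({0..} - hi l ` {e..<d}) \<union> lo l ` {e..<d}" for e
  have lo0: "lo l i < 0" "hi l i \<ge> 0" if "i < d" for i
    using lo_neg_iff[OF l, of i] hi_nonneg_iff[OF l, of i] that by (simp_all only: d_def)
  have "foldr F [e..<d] vac S = (if occ S = Z e then 1 else 0)" if "e \<le> d" for e S
    using that
  proof (induction "d - e" arbitrary: e S)
    case 0
    then show ?case by (simp add: vac_def Z_def)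
  next
    case (Suc n)
    then have ed: "e < d" by simp
    define k j where "k = lo l e" and "j = hi l e"
    have kj: "k < 0" "0 \<le> j" using lo0[OF ed] by (auto simp: k_def j_def)
    define v where "v = foldr F [Suc e..<d] vac"
    have v: "v T = (if occ T = Z (Suc e) then 1 else 0)" for T
      unfolding v_def using Suc ed by simp
    define A B where "A = hi l ` {Suc e..<d}" and "B = lo l ` {Suc e..<d}"
    have Ab: "0 \<le> x \<and> x < j" if "x \<in> A" for x
      using that lo0 hi_strict[OF l, of e] by (auto simp: A_def j_def)
    have Bb: "x < 0 \<and> k < x" if "x \<in> B" for x
      using that lo0 lo_strict[OF l, of e] by (auto simp: B_def k_def)
    have jB: "j \<notin> B"
    proof
      assume "j \<in> B"
      then have "j < 0" using Bb by blast
      then show False using kj by simp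
    qed
    have cAB: "card A = card B" unfolding A_def B_def
      by (simp add: card_image inj_on_subset[OF inj_lo[OF l]] inj_on_subset[OF inj_hi[OF l]])
    have Z1: "Z (Suc e) = ({0..} - A) \<union> B" by (simp add: Z_def A_def B_def)
    have "{e..<d} = insert e {Suc e..<d}" using ed by auto
    then have Z0: "Z e = ({0..} - insert j A) \<union> insert k B"
      unfolding Z_def A_def B_def j_def k_def by simp
    have "foldr F [e..<d] vac S = F e v S" using ed by (simp add: upt_conv_Cons v_def)
    also have "\<dots> = (- 1) powi (- j) * hop k j v S"
      by (simp add: F_def hop_def j_def k_def algebra_simps)
    also have "\<dots> = (if occ S = Z e then 1 else 0)"
    proof (cases "occ S = Z e")
      case True
      have kS: "k \<in> occ S" "j \<notin> occ S" using True kj Ab[of j] Bb[of j] by (auto simp: Z0)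
      have "occ (moved k j S) = Z (Suc e)" using True kj Ab Bb
        by (auto simp: Z0 Z1 occ_moved)
      moreover have "wedge_sign k S = 1"
      proof -
        have "\<not> x < k" if "x \<in> occ S" for x using that True kj Bb[of x] by (auto simp: Z0)
        then have e: "{x \<in> occ S. x < k} = {}" by blast
        show ?thesis unfolding wedge_sign_def e by simp
      qed
      moreover have "wedge_sign j (del_label k S) = (- 1) powi j"
      proof -
        have f: "finite A" "finite B" by (auto simp: A_def B_def)
        have "x \<in> {x \<in> occ (del_label k S). x < j} \<longleftrightarrow> x \<in> ({0..<j} - A) \<union> B" for x
          using True kj Ab[of x] Bb[of x] by (auto simp: Z0 occ_del_label)
        then have "{x \<in> occ (del_label k S). x < j} = ({0..<j} - A) \<union> B" by blast
        then have "card {x \<in> occ (del_label k S). x < j} = card ({0..<j} - A) + card B"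
          using f Bb by (subst card_Un_disjoint[symmetric]) force+
        also have "\<dots> = nat j"
        proof -
          have "A \<subseteq> {0..<j}" using Ab by auto
          then show ?thesis using f cAB card_mono[of "{0..<j}" A] by (simp add: card_Diff_subset)
        qed
        finally show ?thesis using kj by (simp add: wedge_sign_def power_int_def)
      qed
      ultimately show ?thesis using True kS kj v by (simp add: hop_eq power_int_minus)
    next
      case False
      have "hop k j v S = 0"
      proof (rule ccontr)
        assume "hop k j v S \<noteq> 0"
        then have *: "k \<in> occ S" "j \<notin> occ S" "occ (moved k j S) = Z (Suc e)"
          using kj by (auto simp: hop_eq v split: if_splits)
        have "occ S = insert k (occ (moved k j S) - {j})" using * kj by (auto simp: occ_moved)
        also have "\<dots> = Z e" unfolding *(3) Z0 Z1 using kj Ab Bb jB by auto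
        finally show False using False by simp
      qed
      then show ?thesis using False by simp
    qed
    finally show ?case .
  qed
  from this[of 0] have "ket l S = (if occ S = Z 0 then 1 else 0)" for S
    by (simp add: ket_def F_def[abs_def] d_def)
  moreover have "Z 0 = occ (maya_of l)"
    using occ_mp_neg[OF l] notocc_mp_nonneg[OF l] by (auto simp: Z_def d_def atLeast0LessThan)
  ultimately show ?thesis by (auto simp: bas_def fun_eq_iff occ_inject)
qed

lemma bra_eval: assumes "l \<in> partitions" shows "bra l v = v (maya_of l)"
proof -
  have "(\<Sum>\<^sub>\<infinity>S. ket l S * v S) = (\<Sum>\<^sub>\<infinity>S\<in>{maya_of l}. ket l S * v S)"
    by (rule infsum_cong_neutral) (auto simp: ket_bas[OF assms] bas_def)
  then show ?thesis by (simp add: bra_def ket_bas[OF assms] bas_def)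
qed

section \<open>Cells of a partition, and the eigenvalues of the diagonal operators\<close>

definition cells :: "ptn \<Rightarrow> (nat \<times> nat) set" where
  "cells l = {(i, j). j < l i}"

lemma finite_cells: "l \<in> partitions \<Longrightarrow> finite (cells l)"
proof -
  assume l: "l \<in> partitions"
  have "cells l = (SIGMA i:{i. l i \<noteq> 0}. {..<l i})" by (auto simp: cells_def)
  then show ?thesis using l by (auto simp: partitions_def)
qed

lemma sum_cells: "l \<in> partitions \<Longrightarrow> (\<Sum>(i, j)\<in>cells l. f i j) = (\<Sum>i | l i \<noteq> 0. \<Sum>j<l i. f i j)"
proof -
  assume l: "l \<in> partitions"
  have "cells l = (SIGMA i:{i. l i \<noteq> 0}. {..<l i})" by (auto simp: cells_def)
  then show ?thesis using l by (auto simp: partitions_def sum.Sigma)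
qed

lemma card_cells: "l \<in> partitions \<Longrightarrow> card (cells l) = psize l"
  using sum_cells[of l "\<lambda>_ _. 1::nat"] by (simp add: psize_def)

lemma cells_conj: "l \<in> partitions \<Longrightarrow> (i, j) \<in> cells (conjugate l) \<longleftrightarrow> (j, i) \<in> cells l"
  using conj_less[of l i j] by (simp add: cells_def)

lemma psize_conj: assumes l: "l \<in> partitions" shows "psize (conjugate l) = psize l"
proof -
  have "bij_betw (\<lambda>(i, j). (j, i)) (cells (conjugate l)) (cells l)"
    by (rule bij_betw_byWitness[of _ "\<lambda>(i, j). (j, i)"]) (auto simp: cells_conj[OF l])
  then have "card (cells (conjugate l)) = card (cells l)" by (rule bij_betw_same_card)
  then show ?thesis unfolding card_cells[OF l] card_cells[OF conj_ptn[OF l]] .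
qed

text \<open>By \<open>lo_less_hi\<close>, the cell (i, j) is matched with the inversion formed by
  the particle of column j and the hole of row i.\<close>

lemma energy_mp: assumes l: "l \<in> partitions" shows "energy (maya_of l) = psize l"
proof -
  have "bij_betw (\<lambda>(i, j). (lo l j, hi l i)) (cells l) (inversions (maya_of l))"
    unfolding bij_betw_def
  proof
    show "inj_on (\<lambda>(i, j). (lo l j, hi l i)) (cells l)"
      using injD[OF inj_lo[OF l]] injD[OF inj_hi[OF l]] by (fastforce intro: inj_onI)
    show "(\<lambda>(i, j). (lo l j, hi l i)) ` cells l = inversions (maya_of l)"
    proof (intro set_eqI iffI)
      fix p assume "p \<in> (\<lambda>(i, j). (lo l j, hi l i)) ` cells l"
      then obtain i j where ij: "j < l i" "p = (lo l j, hi l i)" by (auto simp: cells_def)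
      moreover have "hi l i \<in> - occ (maya_of l)" unfolding notocc_mp[OF l] by blast
      ultimately show "p \<in> inversions (maya_of l)"
        using lo_less_hi[OF l, of j i] by (auto simp: inversions_def occ_mp[OF l])
    next
      fix p assume "p \<in> inversions (maya_of l)"
      then obtain a b where p: "p = (a, b)" "a < b" "a \<in> occ (maya_of l)" "b \<in> - occ (maya_of l)"
        by (auto simp: inversions_def)
      have "a \<in> range (lo l)" using p(3) unfolding occ_mp[OF l] .
      moreover have "b \<in> range (hi l)" using p(4) unfolding notocc_mp[OF l] .
      ultimately obtain i j where "a = lo l j" "b = hi l i" by blast
      then show "p \<in> (\<lambda>(i, j). (lo l j, hi l i)) ` cells l"
        using p lo_less_hi[OF l, of j i] by (auto simp: cells_def image_iff)
    qed
  qed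
  then have "card (cells l) = card (inversions (maya_of l))" by (rule bij_betw_same_card)
  then show ?thesis unfolding energy_def card_cells[OF l] by simp
qed

lemma excess_sets:
  assumes f: "finite A" "finite B" and "A - B = {0..} - occ S" "B - A = occ S - {0..}"
  shows "excess f S = sum f A - sum f B"
proof -
  have "sum f A = sum f (A - B) + sum f (A \<inter> B)" "sum f B = sum f (B - A) + sum f (A \<inter> B)"
    using sum.Int_Diff[OF f(1), of f B] sum.Int_Diff[OF f(2), of f A] by (auto simp: add.commute Int_commute)
  then show ?thesis using assms by (simp add: excess_def)
qed

text \<open>Holes are indexed by rows, and beyond the first L rows they coincide with those of the
  vacuum. The version by columns, \<open>excess_lo\<close>, is there because the eigenvalue of b_n
  becomes a convergent power sum over the rows for n > 0 and over the columns for n < 0.\<close>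

lemma excess_hi:
  assumes l: "l \<in> partitions" and L: "\<And>i. i \<ge> L \<Longrightarrow> l i = 0"
  shows "excess f (maya_of l) = (\<Sum>i<L. f (hi l i) - f (- int i - 1))"
proof -
  let ?A = "hi l ` {..<L}" and ?B = "{- int L..<0}"
  have n: "{0..} - occ (maya_of l) = {0..} \<inter> range (hi l)" "occ (maya_of l) - {0..} = {..<0} - range (hi l)"
    using notocc_mp[OF l] by auto
  have A: "?A - ?B = {0..} \<inter> range (hi l)"
  proof -
    have "hi l i \<in> ?A" if "0 \<le> hi l i" for i using L[of i] that by (cases "i < L") auto
    then show ?thesis by auto
  qed
  have B: "?B - ?A = {..<0} - range (hi l)"
  proof -
    have "hi l i \<in> ?A" if "- int L \<le> hi l i" for i using L[of i] that by (cases "i < L") auto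
    moreover have "- int L \<le> x" if "x < 0" "x \<notin> range (hi l)" for x
    proof (rule ccontr)
      assume "\<not> - int L \<le> x"
      then have "x = hi l (nat (- x - 1))" using L[of "nat (- x - 1)"] by auto
      then show False using that by blast
    qed
    ultimately show ?thesis by auto
  qed
  have "excess f (maya_of l) = sum f ?A - sum f ?B"
    by (rule excess_sets) (use n A B in auto)
  also have "sum f ?A = (\<Sum>i<L. f (hi l i))"
    by (simp add: sum.reindex inj_on_subset[OF inj_hi[OF l]])
  also have "sum f ?B = (\<Sum>i<L. f (- int i - 1))"
    by (rule sum.reindex_bij_witness[of _ "\<lambda>i. - int i - 1" "\<lambda>j. nat (- j - 1)"]) auto
  finally show ?thesis by (simp add: sum_subtractf)
qed

lemma excess_lo:
  assumes l: "l \<in> partitions" and L: "\<And>i. i \<ge> L \<Longrightarrow> conjugate l i = 0"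
  shows "excess f (maya_of l) = (\<Sum>i<L. f (int i) - f (lo l i))"
proof -
  let ?A = "lo l ` {..<L}" and ?B = "{0..<int L}"
  have n: "{0..} - occ (maya_of l) = {0..} - range (lo l)" "occ (maya_of l) - {0..} = {..<0} \<inter> range (lo l)"
    using occ_mp[OF l] by auto
  have A: "?A - ?B = {..<0} \<inter> range (lo l)"
  proof -
    have "lo l i \<in> ?A" if "lo l i < 0" for i using L[of i] that by (cases "i < L") auto
    then show ?thesis by auto
  qed
  have B: "?B - ?A = {0..} - range (lo l)"
  proof -
    have "lo l i \<in> ?A" if "lo l i < int L" for i using L[of i] that by (cases "i < L") auto
    moreover have "x < int L" if "x \<ge> 0" "x \<notin> range (lo l)" for x
    proof (rule ccontr)
      assume "\<not> x < int L"
      then have "x = lo l (nat x)" using L[of "nat x"] by auto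
      then show False using that by blast
    qed
    ultimately show ?thesis by auto
  qed
  have "excess f (maya_of l) = sum f ?B - sum f ?A"
    by (rule excess_sets) (use n A B in auto)
  also have "sum f ?A = (\<Sum>i<L. f (lo l i))"
    by (simp add: sum.reindex inj_on_subset[OF inj_lo[OF l]])
  also have "sum f ?B = (\<Sum>i<L. f (int i))"
    by (rule sum.reindex_bij_witness[of _ "int" "nat"]) auto
  finally show ?thesis by (simp add: sum_subtractf)
qed

lemma w_op_mp: assumes l: "l \<in> partitions" shows "w_op v (maya_of l) = of_int (kappa l) * v (maya_of l)"
proof -
  obtain L where L: "\<And>i. i \<ge> L \<Longrightarrow> l i = 0" using ptn_vanish[OF l] by blast
  have "(\<Sum>i<L. (of_int (hi l i) + 1 / 2)\<^sup>2 - (of_int (- int i - 1) + 1 / 2)\<^sup>2 :: complex)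
      = (\<Sum>i<L. of_int (int (l i) * (int (l i) - 2 * (int i + 1) + 1)))"
    by (rule sum.cong) (auto simp: power2_eq_square field_simps)
  also have "\<dots> = (\<Sum>i | l i \<noteq> 0. of_int (int (l i) * (int (l i) - 2 * (int i + 1) + 1)))"
    by (rule sum.mono_neutral_right) (use vanish_less[of L l, OF L] in auto)
  moreover have "excess f (maya_of l) = (\<Sum>i<L. f (hi l i) - f (- int i - 1))" for f
    by (rule excess_hi[OF l L])
  ultimately have "excess (\<lambda>j. (of_int j + 1 / 2)\<^sup>2) (maya_of l) = of_int (kappa l)"
    unfolding kappa_def of_int_sum by (simp only:)
  then show ?thesis unfolding w_op_eq by simp
qed

text \<open>The summand is twice the content of the cell, which transposition negates; hence
  \<open>kappa_conj\<close>.\<close>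

lemma kappa_cells: assumes l: "l \<in> partitions" shows "kappa l = (\<Sum>(i, j)\<in>cells l. 2 * (int j - int i))"
proof -
  have "(\<Sum>j<n. 2 * (int j - int i)) = int n * (int n - 2 * (int i + 1) + 1)" for n i
    by (induction n) (auto simp: algebra_simps)
  then show ?thesis unfolding sum_cells[OF l] kappa_def by simp
qed

lemma kappa_conj: assumes l: "l \<in> partitions" shows "kappa (conjugate l) = - kappa l"
  unfolding kappa_cells[OF l] kappa_cells[OF conj_ptn[OF l]] sum_negf[symmetric]
  by (rule sum.reindex_bij_witness[of _ "\<lambda>(i, j). (j, i)" "\<lambda>(i, j). (j, i)"]) (auto simp: cells_conj[OF l])

lemma hop_sign:
  assumes "k < j"
  shows "hop k j v S = (if k \<in> occ S \<and> j \<notin> occ S then (- 1) ^ card (occ S \<inter> {k<..<j}) * v (moved k j S) else 0)"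
proof -
  have "wedge_sign k S * wedge_sign j (del_label k S) = (- 1) ^ card (occ S \<inter> {k<..<j})"
  proof -
    have "{x \<in> occ (del_label k S). x < j} = {x \<in> occ S. x < k} \<union> (occ S \<inter> {k<..<j})"
      using assms by (auto simp: occ_del_label)
    moreover have "{x \<in> occ S. x < k} \<inter> (occ S \<inter> {k<..<j}) = {}" by auto
    ultimately have "card {x \<in> occ (del_label k S). x < j} = card {x \<in> occ S. x < k} + card (occ S \<inter> {k<..<j})"
      using card_Un_disjoint[OF finite_occ_below[of S k], of "occ S \<inter> {k<..<j}"] by simp
    then have "wedge_sign j (del_label k S) = wedge_sign k S * (- 1) ^ card (occ S \<inter> {k<..<j})"
      unfolding wedge_sign_def by (simp only: power_add)
    then show ?thesis by (simp only: wedge_sign_square)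
  qed
  then show ?thesis using assms by (simp add: hop_eq)
qed

lemma creation_cong_neutral:
  assumes "n \<ge> 1" "neutral S" "\<And>T. neutral T \<Longrightarrow> energy T + n = energy S \<Longrightarrow> v T = w T"
  shows "creation n v S = creation n w S"
proof -
  obtain M where M: "bd M S" using bd_ex by blast
  have "hop k (k + int n) v S = hop k (k + int n) w S" for k
    by (rule hop_cong) (use assms energy_moved[of k S "k + int n"] neutral_moved[of k S "k + int n"] in auto)
  then show ?thesis unfolding creation_def using assms(1) M by (simp add: a_op_creation)
qed

lemma neutral_energy0:
  assumes "neutral S" "energy S = 0" shows "S = maya_of empty_ptn"
proof -
  obtain l where l: "l \<in> partitions" "S = maya_of l" using neutral_ex assms by blast
  then have "card (cells l) = 0" using energy_mp card_cells assms by simp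
  then have "cells l = {}" using finite_cells[OF l(1)] by simp
  then have "l = empty_ptn" by (auto simp: cells_def empty_ptn_def fun_eq_iff)
  then show ?thesis using l by simp
qed

text \<open>Particle-hole exchange combined with reflection of the labels, which is conjugation on
  partitions (\<open>flip_mp\<close>).\<close>

definition flip :: "maya \<Rightarrow> maya" where
  "flip S = Abs_maya {j. - 1 - j \<notin> occ S}"

lemma image_reflect: "x \<in> (\<lambda>j. - 1 - j) ` B \<longleftrightarrow> - 1 - x \<in> B" for x :: int
  by (auto intro: image_eqI[of _ _ "- 1 - x"])

lemma occ_flip: "occ (flip S) = {j. - 1 - j \<notin> occ S}"
  unfolding flip_def
proof (rule Abs_maya_inverse, simp, intro conjI)
  have f: "finite (occ S - {0..})" "finite ({0..} - occ S)" using occ[of S] by auto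
  have "{j. - 1 - j \<notin> occ S} - {0..} = (\<lambda>j. - 1 - j) ` ({0..} - occ S)"
    by (intro set_eqI) (simp only: image_reflect, auto)
  then show "finite ({j. - 1 - j \<notin> occ S} - {0..})" using f by simp
  have "{0..} - {j. - 1 - j \<notin> occ S} = (\<lambda>j. - 1 - j) ` (occ S - {0..})"
    by (intro set_eqI) (simp only: image_reflect, auto)
  then show "finite ({0..} - {j. - 1 - j \<notin> occ S})" using f by simp
qed

lemma flip_flip: "flip (flip S) = S"
  by (auto simp: occ_inject[symmetric] occ_flip)

lemma flip_mp: assumes l: "l \<in> partitions" shows "flip (maya_of l) = maya_of (conjugate l)"
proof -
  have "j \<in> occ (flip (maya_of l)) \<longleftrightarrow> j \<in> range (lo (conjugate l))" for j
  proof -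
    have "j \<in> occ (flip (maya_of l)) \<longleftrightarrow> - 1 - j \<in> - occ (maya_of l)" by (simp add: occ_flip)
    also have "\<dots> \<longleftrightarrow> (\<exists>i. - 1 - j = hi l i)" unfolding notocc_mp[OF l] by auto
    also have "\<dots> \<longleftrightarrow> (\<exists>i. j = lo (conjugate l) i)" unfolding conj_conj[OF l] by (intro ex_cong1) auto
    finally show ?thesis by auto
  qed
  then show ?thesis using occ_mp[OF conj_ptn[OF l]] by (simp add: occ_inject[symmetric] set_eq_iff)
qed

lemma energy_flip: "energy (flip S) = energy S"
proof -
  have "bij_betw (\<lambda>(a, b). (- 1 - b, - 1 - a)) (inversions (flip S)) (inversions S)"
    by (rule bij_betw_byWitness[of _ "\<lambda>(a, b). (- 1 - b, - 1 - a)"])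
       (auto simp: inversions_def occ_flip)
  then show ?thesis unfolding energy_def by (rule bij_betw_same_card)
qed

text \<open>A hop by n passes over n - 1 labels, and under \<open>flip\<close> the particles among
  them become holes. The two fermionic signs therefore differ by (-1)^(n-1). This is the fermionic
  form of the involution that sends p_n to (-1)^(n-1) p_n.\<close>

lemma creation_flip:
  assumes n: "n \<ge> 1" shows "creation n (\<lambda>T. v (flip T)) (flip S) = - ((- 1) ^ n) * creation n v S"
proof -
  obtain M where M: "bd M S" using bd_ex by blast
  obtain M' where M': "bd M' (flip S)" using bd_ex by blast
  let ?N = "M + M' + int n"
  let ?K = "{- ?N..<?N}" and ?K' = "{- ?N - int n..<?N - int n}"
  have h: "hop k (k + int n) (\<lambda>T. v (flip T)) (flip S) = - ((- 1) ^ n) * hop (- 1 - k - int n) (- 1 - k) v S" for k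
  proof -
    let ?k = "- 1 - k - int n"
    have m: "flip (moved k (k + int n) (flip S)) = moved ?k (- 1 - k) S" if "- 1 - k \<notin> occ S" "?k \<in> occ S"
      using that by (auto simp: occ_inject[symmetric] occ_flip occ_moved)
    have "occ (flip S) \<inter> {k<..<k + int n} = (\<lambda>j. - 1 - j) ` ({?k<..<- 1 - k} - occ S)"
      by (intro set_eqI) (simp only: image_reflect occ_flip, auto)
    then have "card (occ (flip S) \<inter> {k<..<k + int n}) = card ({?k<..<- 1 - k} - occ S)"
      by (simp add: card_image inj_on_def)
    moreover have "card ({?k<..<- 1 - k} - occ S) + card (occ S \<inter> {?k<..<- 1 - k}) = n - 1"
    proof -
      have "card ({?k<..<- 1 - k} - occ S) + card (occ S \<inter> {?k<..<- 1 - k}) = card {?k<..<- 1 - k}"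
      proof (subst card_Un_disjoint[symmetric])
        have "({?k<..<- 1 - k} - occ S) \<union> (occ S \<inter> {?k<..<- 1 - k}) = {?k<..<- 1 - k}" by blast
        then show "card (({?k<..<- 1 - k} - occ S) \<union> (occ S \<inter> {?k<..<- 1 - k})) = card {?k<..<- 1 - k}"
          by (simp only:)
      qed auto
      also have "\<dots> = n - 1" by simp
      finally show ?thesis .
    qed
    moreover have "(- 1) ^ a = - ((- 1) ^ n) * (- 1 :: complex) ^ b" if "a + b = n - 1" for a b
    proof -
      have "n = Suc (a + b)" using that n by simp
      then show ?thesis by (simp add: power_add mult.assoc power_mult_distrib[symmetric])
    qed
    moreover have "k \<in> occ (flip S) \<longleftrightarrow> - 1 - k \<notin> occ S" by (simp add: occ_flip)
    moreover have "k + int n \<in> occ (flip S) \<longleftrightarrow> ?k \<notin> occ S" by (simp add: occ_flip diff_diff_eq)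
    ultimately show ?thesis using n m by (auto simp: hop_sign)
  qed
  have "creation n (\<lambda>T. v (flip T)) (flip S) = - (\<Sum>k\<in>?K. hop k (k - (- int n)) (\<lambda>T. v (flip T)) (flip S))"
    unfolding creation_def using n bd_less[OF M'] bd_ge[OF M'] bd_nonneg[OF M] by (intro a_op_hop) fastforce+
  also have "(\<Sum>k\<in>?K. hop k (k - (- int n)) (\<lambda>T. v (flip T)) (flip S))
      = (\<Sum>k\<in>?K. - ((- 1) ^ n) * hop (- 1 - k - int n) (- 1 - k) v S)"
    using h by simp
  also have "\<dots> = (\<Sum>k\<in>?K'. - ((- 1) ^ n) * hop k (k - (- int n)) v S)"
    by (rule sum.reindex_bij_witness[of _ "\<lambda>k. - 1 - k - int n" "\<lambda>k. - 1 - k - int n"]) auto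
  also have "\<dots> = - ((- 1) ^ n) * (\<Sum>k\<in>?K'. hop k (k - (- int n)) v S)" by (simp add: sum_distrib_left)
  also have "(\<Sum>k\<in>?K'. hop k (k - (- int n)) v S) = - creation n v S"
  proof -
    have "creation n v S = - (\<Sum>k\<in>?K'. hop k (k - (- int n)) v S)" unfolding creation_def
      using n bd_less[OF M] bd_ge[OF M] bd_nonneg[OF M'] by (intro a_op_hop) fastforce+
    then show ?thesis by simp
  qed
  finally show ?thesis by simp
qed

section \<open>Half vertex operators\<close>

lemma flin_swap:
  assumes "flin f" "flin g" shows "f (\<lambda>i. g (\<lambda>j. F i j)) = g (\<lambda>j. f (\<lambda>i. F i j))"
proof -
  obtain R c where R: "\<And>v. f v = (\<Sum>i\<in>R. c i * v i)" using assms(1) by (auto simp: flin_def)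
  have "f (\<lambda>i. g (\<lambda>j. F i j)) = (\<Sum>i\<in>R. c i * g (\<lambda>j. F i j))" by (rule R)
  also have "\<dots> = g (\<lambda>j. \<Sum>i\<in>R. c i * F i j)"
    by (simp add: flin_sum[OF assms(2)] flin_scale[OF assms(2)])
  finally show ?thesis by (simp add: R)
qed

abbreviation vser :: "(nat \<Rightarrow> complex) \<Rightarrow> fock \<Rightarrow> fock" where
  "vser c \<equiv> ser energy c creation"

definition half_vertex :: "(nat \<Rightarrow> complex) \<Rightarrow> fock \<Rightarrow> fock" where
  "half_vertex c = op_exp (vser (\<lambda>n. c n / of_nat n))"

lemma lowering_vser: "lowering energy (vser c)"
  by (rule lowering_ser[OF modes_creation])

lemma half_vertex_flin: "flin (\<lambda>v. half_vertex c v S)"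
  unfolding half_vertex_def by (rule op_exp_flin[OF lowering_vser])

lemma half_vertex_rec:
  "of_nat (energy S) * half_vertex c v S = half_vertex c (\<lambda>T. of_nat (energy T) * v T) S + vser c (half_vertex c v) S"
  unfolding half_vertex_def by (rule op_exp_ser_deriv[OF modes_creation creation_commute creation_weight])

lemma half_vertex_add: "half_vertex c (half_vertex c' v) = half_vertex (\<lambda>n. c n + c' n) v"
proof -
  have "(\<lambda>v i. vser (\<lambda>n. c n / of_nat n) v i + vser (\<lambda>n. c' n / of_nat n) v i)
      = vser (\<lambda>n. (c n + c' n) / of_nat n)"
    by (simp add: ser_add add_divide_distrib fun_eq_iff)
  then show ?thesis unfolding half_vertex_def
    using op_exp_add[OF lowering_vser lowering_vser ser_commute[OF modes_creation modes_creation creation_commute],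
        of "\<lambda>n. c n / of_nat n" "\<lambda>n. c' n / of_nat n" v] by simp
qed

lemma half_vertex_low:
  assumes "energy S \<le> energy T" shows "half_vertex c (bas T) S = bas T S"
proof -
  let ?A = "vser (\<lambda>n. c n / of_nat n)"
  have "(?A ^^ j) (bas T) S = 0" if "j > 0" for j
  proof -
    have "(?A ^^ j) (bas T) S = (?A ^^ j) (\<lambda>_. 0) S"
      by (rule lowering_pow_cong[OF lowering_vser]) (use that assms in \<open>auto simp: bas_def\<close>)
    then show ?thesis using flin_zero[OF lowering_flin_pow[OF lowering_vser]] by simp
  qed
  then have "(\<Sum>j\<le>energy S. (?A ^^ j) (bas T) S / fact j) = (\<Sum>j\<in>{0}. (?A ^^ j) (bas T) S / fact j)"
    by (intro sum.mono_neutral_right) auto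
  then show ?thesis unfolding half_vertex_def by (simp add: op_exp_finite[OF lowering_vser order_refl])
qed

lemma vser_cong_neutral:
  assumes "neutral S" "\<And>T. neutral T \<Longrightarrow> energy T < energy S \<Longrightarrow> v T = w T"
  shows "vser c v S = vser c w S"
  unfolding ser_def
  by (intro sum.cong refl arg_cong2[where f = "(*)"] creation_cong_neutral) (use assms in auto)

lemma vser_pow_cong_neutral:
  assumes "neutral S" "\<And>T. neutral T \<Longrightarrow> v T = w T"
  shows "(vser c ^^ j) v S = (vser c ^^ j) w S"
  using assms by (induction j arbitrary: S) (auto intro: vser_cong_neutral)

lemma half_vertex_cong_neutral:
  assumes "neutral S" "\<And>T. neutral T \<Longrightarrow> v T = w T"
  shows "half_vertex c v S = half_vertex c w S"
  unfolding half_vertex_def op_exp_def using vser_pow_cong_neutral[OF assms] by simp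

text \<open>Where the energy differs from e, the recursion can be divided by the nonzero factor, and
  its right-hand side reads lower energies only. So a solution is fixed by its values at energy e.
  The restriction to neutral diagrams is consistent because creation preserves the charge.\<close>

lemma rec_unique:
  assumes F: "\<And>S. neutral S \<Longrightarrow> (of_nat (energy S) - of_nat e) * F S = vser c F S"
    and G: "\<And>S. neutral S \<Longrightarrow> (of_nat (energy S) - of_nat e) * G S = vser c G S"
    and init: "\<And>S. neutral S \<Longrightarrow> energy S = e \<Longrightarrow> F S = G S"
    and S: "neutral S"
  shows "F S = G S"
  using S
proof (induction "energy S" arbitrary: S rule: less_induct)
  case less
  show ?case
  proof (cases "energy S = e")
    case False
    then have "of_nat (energy S) - of_nat e \<noteq> (0::complex)" by simp
    moreover have "vser c F S = vser c G S" by (rule vser_cong_neutral) (use less in auto)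
    moreover have "(of_nat (energy S) - of_nat e) * F S = (of_nat (energy S) - of_nat e) * G S"
      using F[OF less(2)] G[OF less(2)] calculation(2) by simp
    ultimately show ?thesis by (metis mult_left_cancel)
  qed (use init less in simp)
qed

lemma half_vertex_bas_rec:
  "(of_nat (energy S) - of_nat (energy T)) * half_vertex c (bas T) S = vser c (half_vertex c (bas T)) S"
proof -
  have "(\<lambda>U. of_nat (energy U) * bas T U) = (\<lambda>U. of_nat (energy T) * bas T U)"
    by (auto simp: bas_def)
  then show ?thesis using half_vertex_rec[of S c "bas T"] by (simp add: flin_scale[OF half_vertex_flin] algebra_simps)
qed

lemma half_vertex_unique:
  assumes "\<And>S. neutral S \<Longrightarrow> (of_nat (energy S) - of_nat (energy T)) * F S = vser c F S"
    and "\<And>S. neutral S \<Longrightarrow> energy S = energy T \<Longrightarrow> F S = bas T S" and "neutral S"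
  shows "half_vertex c (bas T) S = F S"
  by (rule rec_unique[where e = "energy T" and c = c]) (use assms half_vertex_bas_rec half_vertex_low in auto)

lemma half_vertex_flip: "half_vertex c (\<lambda>T. v (flip T)) (flip S) = half_vertex (\<lambda>n. - ((- 1) ^ n) * c n) v S"
proof -
  have 1: "vser (\<lambda>n. c n / of_nat n) (\<lambda>T. v (flip T)) = (\<lambda>S. vser (\<lambda>n. - ((- 1) ^ n) * c n / of_nat n) v (flip S))"
    for v
  proof
    fix S
    have "creation n (\<lambda>T. v (flip T)) S = - ((- 1) ^ n) * creation n v (flip S)" if "n \<ge> 1" for n
      using creation_flip[OF that, of v "flip S"] by (simp add: flip_flip)
    then show "vser (\<lambda>n. c n / of_nat n) (\<lambda>T. v (flip T)) S = vser (\<lambda>n. - ((- 1) ^ n) * c n / of_nat n) v (flip S)"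
      by (simp add: ser_def energy_flip mult_ac)
  qed
  have "(vser (\<lambda>n. c n / of_nat n) ^^ j) (\<lambda>T. v (flip T))
     = (\<lambda>S. (vser (\<lambda>n. - ((- 1) ^ n) * c n / of_nat n) ^^ j) v (flip S))" for j
    by (induction j) (simp_all add: 1)
  then show ?thesis unfolding half_vertex_def op_exp_def by (simp add: flip_flip)
qed

lemma bas_flip: "bas (flip T) = (\<lambda>S. bas T (flip S))"
  by (auto simp: bas_def fun_eq_iff flip_flip)

lemma half_vertex_bas_flip: "half_vertex c (bas (flip T)) (flip S) = half_vertex (\<lambda>n. - ((- 1) ^ n) * c n) (bas T) S"
  unfolding bas_flip by (rule half_vertex_flip)

lemma half_vertex_bas_not_neutral:
  assumes "neutral S" "\<not> neutral T" shows "half_vertex c (bas T) S = 0"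
proof -
  have "bas T U = 0" if "neutral U" for U using that assms(2) by (auto simp: bas_def)
  then have "half_vertex c (bas T) S = half_vertex c (\<lambda>_. 0) S" by (intro half_vertex_cong_neutral assms(1))
  then show ?thesis by (simp add: flin_zero[OF half_vertex_flin])
qed

text \<open>Insertion of a complete set of states of charge zero. Only the finitely many diagrams in
  \<open>R\<close> contribute, and the non-neutral ones among them drop out, which leaves
  partitions.\<close>

lemma half_vertex_expand:
  assumes S: "neutral S"
  shows "half_vertex c w S = (\<Sum>\<^sub>\<infinity>e\<in>partitions. half_vertex c (bas (maya_of e)) S * w (maya_of e))"
proof -
  obtain R where R: "finite R" "\<And>T. T \<notin> R \<Longrightarrow> half_vertex c (bas T) S = 0"
      "\<And>v. half_vertex c v S = (\<Sum>T\<in>R. half_vertex c (bas T) S * v T)"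
    using flin_expand[OF half_vertex_flin, of c S] by blast
  let ?f = "\<lambda>T. half_vertex c (bas T) S * w T"
  have "(\<Sum>\<^sub>\<infinity>e\<in>partitions. ?f (maya_of e)) = infsum ?f (maya_of ` partitions)"
    using infsum_reindex[OF inj_mp, of ?f] by (simp add: comp_def)
  also have "\<dots> = infsum ?f R"
  proof (rule infsum_cong_neutral)
    fix T assume "T \<in> R - maya_of ` partitions"
    then have "\<not> neutral T" using neutral_ex[of T] by blast
    then show "?f T = 0" using half_vertex_bas_not_neutral[OF S] by simp
  qed (use R(2) in auto)
  also have "\<dots> = sum ?f R" using R(1) by simp
  finally show ?thesis using R(3)[of w] by simp
qed

lemma half_vertex_vac_infsum:
  "op_exp (\<lambda>v S. \<Sum>\<^sub>\<infinity>n\<in>{1::nat..}. a_op (- int n) v S / of_nat n * c n) v = half_vertex c v"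
proof -
  have "(\<Sum>\<^sub>\<infinity>n\<in>{1::nat..}. a_op (- int n) v S / of_nat n * c n) = vser (\<lambda>n. c n / of_nat n) v S" for v S
    unfolding ser_infsum[OF modes_creation, symmetric] by (simp add: creation_def mult_ac)
  then show ?thesis by (simp add: half_vertex_def)
qed

section \<open>Two copies of the Fock space and their pairing\<close>

type_synonym fock2 = "maya \<times> maya \<Rightarrow> complex"

definition energy2 :: "maya \<times> maya \<Rightarrow> nat" where
  "energy2 t = energy (fst t) + energy (snd t)"

abbreviation fst_energy :: "maya \<times> maya \<Rightarrow> nat" where
  "fst_energy t \<equiv> energy (fst t)"

definition crA :: "nat \<Rightarrow> fock2 \<Rightarrow> fock2" where
  "crA n F = (\<lambda>(S, T). creation n (\<lambda>S'. F (S', T)) S)"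

definition crB :: "nat \<Rightarrow> fock2 \<Rightarrow> fock2" where
  "crB n F = (\<lambda>(S, T). creation n (\<lambda>T'. F (S, T')) T)"

definition crC :: "nat \<Rightarrow> fock2 \<Rightarrow> fock2" where
  "crC n F = crA n (crB n F)"

lemma flin_reindex: "flin f \<Longrightarrow> flin (\<lambda>v. f (\<lambda>i. v (h i)))"
  by (rule flin_comp[of f "\<lambda>v i. v (h i)"]) (auto intro: flin_eval)

lemma flin_crA: "n \<ge> 1 \<Longrightarrow> flin (\<lambda>v. crA n v t)"
  by (cases t) (auto simp: crA_def intro!: flin_reindex[of "\<lambda>v. creation n v _"] creation_flin)

lemma flin_crB: "n \<ge> 1 \<Longrightarrow> flin (\<lambda>v. crB n v t)"
  by (cases t) (auto simp: crB_def intro!: flin_reindex[of "\<lambda>v. creation n v _"] creation_flin)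

lemma flin_crC: "n \<ge> 1 \<Longrightarrow> flin (\<lambda>v. crC n v t)"
  unfolding crC_def by (rule flin_comp[of "\<lambda>v. crA n v t", OF flin_crA flin_crB])

lemma creation_big: "n \<ge> 1 \<Longrightarrow> energy S < n \<Longrightarrow> creation n v S = 0"
  by (rule modesD(2)[OF modes_creation])

lemma modes_crA: "modes energy2 crA"
proof (rule modesI)
  fix n :: nat and t :: "maya \<times> maya" and v w :: fock2
  assume "1 \<le> n" "\<And>j. energy2 j + n \<le> energy2 t \<Longrightarrow> v j = w j"
  then show "crA n v t = crA n w t" by (cases t) (auto simp: crA_def energy2_def intro!: creation_cong)
qed (rule flin_crA)

lemma modes_crB: "modes energy2 crB"
proof (rule modesI)
  fix n :: nat and t :: "maya \<times> maya" and v w :: fock2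
  assume "1 \<le> n" "\<And>j. energy2 j + n \<le> energy2 t \<Longrightarrow> v j = w j"
  then show "crB n v t = crB n w t" by (cases t) (auto simp: crB_def energy2_def intro!: creation_cong)
qed (rule flin_crB)

lemma crC_eq: "crC n F (S, T) = creation n (\<lambda>S'. creation n (\<lambda>T'. F (S', T')) T) S"
  by (simp add: crC_def crA_def crB_def)

lemma modes_crC: "modes energy2 crC"
proof (rule modesI)
  fix n :: nat and t :: "maya \<times> maya" and v w :: fock2
  assume "1 \<le> n" "\<And>j. energy2 j + n \<le> energy2 t \<Longrightarrow> v j = w j"
  then show "crC n v t = crC n w t" by (cases t) (auto simp: crC_eq energy2_def intro!: creation_cong)
qed (rule flin_crC)

text \<open>In the grading by the energy of the first copy alone, \<open>crC n\<close> has weight n,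
  so that \<open>op_exp_ser_deriv\<close> produces exactly the sum over n that forms L_0 of that
  copy.\<close>

lemma modes_crC_fst: "modes fst_energy crC"
proof (rule modesI)
  fix n :: nat and t :: "maya \<times> maya" and v w :: fock2
  assume "1 \<le> n" "\<And>j. fst_energy j + n \<le> fst_energy t \<Longrightarrow> v j = w j"
  then show "crC n v t = crC n w t" by (cases t) (auto simp: crC_eq intro!: creation_cong)
qed (rule flin_crC)

lemma creation_swap: "n \<ge> 1 \<Longrightarrow> m \<ge> 1 \<Longrightarrow>
    creation n (\<lambda>S'. creation m (\<lambda>T'. F S' T') T) S = creation m (\<lambda>T'. creation n (\<lambda>S'. F S' T') S) T"
  using flin_swap[of "\<lambda>v. creation n v S" "\<lambda>v. creation m v T" F] creation_flin by simp

lemma crA_crA: "n \<ge> 1 \<Longrightarrow> m \<ge> 1 \<Longrightarrow> crA n (crA m F) = crA m (crA n F)"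
  by (auto simp: crA_def fun_eq_iff creation_commute[of n m])

lemma crB_crB: "n \<ge> 1 \<Longrightarrow> m \<ge> 1 \<Longrightarrow> crB n (crB m F) = crB m (crB n F)"
  by (auto simp: crB_def fun_eq_iff creation_commute[of n m])

lemma crA_crB: "n \<ge> 1 \<Longrightarrow> m \<ge> 1 \<Longrightarrow> crA n (crB m F) = crB m (crA n F)"
  by (auto simp: crA_def crB_def fun_eq_iff intro: creation_swap)

lemma crA_crC: "n \<ge> 1 \<Longrightarrow> m \<ge> 1 \<Longrightarrow> crA n (crC m F) = crC m (crA n F)"
  unfolding crC_def using crA_crA[of n m "crB m F"] crA_crB[of n m F] by simp

lemma crB_crC: "n \<ge> 1 \<Longrightarrow> m \<ge> 1 \<Longrightarrow> crB n (crC m F) = crC m (crB n F)"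
  unfolding crC_def using crA_crB[of m n "crB m F"] crB_crB[of n m F] by simp

lemma crC_crC: "n \<ge> 1 \<Longrightarrow> m \<ge> 1 \<Longrightarrow> crC n (crC m F) = crC m (crC n F)"
  using crA_crC[of n m "crB n F"] crB_crC[of n m F] by (simp add: crC_def[of n])

definition serA :: "(nat \<Rightarrow> complex) \<Rightarrow> fock2 \<Rightarrow> fock2" where
  "serA y = ser energy2 (\<lambda>n. y n / of_nat n) crA"

definition serB :: "(nat \<Rightarrow> complex) \<Rightarrow> fock2 \<Rightarrow> fock2" where
  "serB x = ser energy2 (\<lambda>n. x n / of_nat n) crB"

definition serC :: "fock2 \<Rightarrow> fock2" where
  "serC = ser energy2 (\<lambda>n. 1 / of_nat n) crC"

definition E2 :: "(nat \<Rightarrow> complex) \<Rightarrow> (nat \<Rightarrow> complex) \<Rightarrow> fock2 \<Rightarrow> fock2" where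
  "E2 y x F t = serA y F t + (serB x F t + serC F t)"

lemma lowering_sers: "lowering energy2 (serA y)" "lowering energy2 (serB x)" "lowering energy2 serC"
  unfolding serA_def serB_def serC_def by (intro lowering_ser modes_crA modes_crB modes_crC)+

lemma lowering_E2: "lowering energy2 (E2 y x)"
  using lowering_plus[OF lowering_sers(1) lowering_plus[OF lowering_sers(2,3)], of y x]
  by (simp add: E2_def[abs_def])

lemma ser_commutes:
  "serA y (serB x F) = serB x (serA y F)" "serA y (serC F) = serC (serA y F)" "serB x (serC F) = serC (serB x F)"
  unfolding serA_def serB_def serC_def
  by (intro ser_commute modes_crA modes_crB modes_crC crA_crB crA_crC crB_crC; assumption)+

lemma E2_crB: assumes n: "n \<ge> 1" shows "E2 y x (crB n F) = crB n (E2 y x F)"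
proof
  fix t
  have "serA y (crB n F) = crB n (serA y F)" unfolding serA_def
    by (rule ser_commute1[OF modes_crA modesD(1)[OF modes_crB n]]) (use n in \<open>simp add: crA_crB\<close>)
  moreover have "serB x (crB n F) = crB n (serB x F)" unfolding serB_def
    by (rule ser_commute1[OF modes_crB modesD(1)[OF modes_crB n]]) (use n in \<open>simp add: crB_crB\<close>)
  moreover have "serC (crB n F) = crB n (serC F)" unfolding serC_def
    by (rule ser_commute1[OF modes_crC modesD(1)[OF modes_crB n]]) (use n in \<open>simp add: crB_crC\<close>)
  ultimately show "E2 y x (crB n F) t = crB n (E2 y x F) t"
    unfolding E2_def by (simp add: flin_add[OF flin_crB[OF n]])
qed

lemma op_exp_E2: "op_exp (E2 y x) F = op_exp (serA y) (op_exp (serB x) (op_exp serC F))"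
proof -
  have 1: "op_exp (\<lambda>v i. serB x v i + serC v i) F = op_exp (serB x) (op_exp serC F)"
    by (rule op_exp_add[of energy2 "serB x" serC F, OF lowering_sers(2,3) ser_commutes(3)])
  have "serA y (\<lambda>i. serB x v i + serC v i) = (\<lambda>i. serB x (serA y v) i + serC (serA y v) i)" for v
    using flin_add[OF loweringD(1)[OF lowering_sers(1)], of y "serB x v" "serC v"]
    by (simp add: fun_eq_iff ser_commutes)
  then have "op_exp (\<lambda>v i. serA y v i + (serB x v i + serC v i)) F = op_exp (serA y) (op_exp (\<lambda>v i. serB x v i + serC v i) F)"
    by (rule op_exp_add[of energy2 "serA y" "\<lambda>v i. serB x v i + serC v i" F,
        OF lowering_sers(1) lowering_plus[OF lowering_sers(2,3)]])
  then have "op_exp (E2 y x) F = op_exp (serA y) (op_exp (\<lambda>v i. serB x v i + serC v i) F)"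
    by (simp add: E2_def[abs_def])
  then show ?thesis unfolding 1 .
qed

lemma op_exp_serA: "op_exp (serA y) F (S, T) = half_vertex y (\<lambda>S'. F (S', T)) S"
proof -
  have 1: "serA y F (S, T) = vser (\<lambda>n. y n / of_nat n) (\<lambda>S'. F (S', T)) S" for F S
    unfolding serA_def by (simp add: ser_def[of energy2] ser_bound[OF modes_creation, of S "energy2 (S, T)"] energy2_def crA_def)
  have "(serA y ^^ j) F (S, T) = (vser (\<lambda>n. y n / of_nat n) ^^ j) (\<lambda>S'. F (S', T)) S" for j S
    by (induction j arbitrary: S) (simp_all add: 1)
  then show ?thesis unfolding op_exp_def half_vertex_def by simp
qed

lemma op_exp_serB: "op_exp (serB x) F (S, T) = half_vertex x (\<lambda>T'. F (S, T')) T"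
proof -
  have 1: "serB x F (S, T) = vser (\<lambda>n. x n / of_nat n) (\<lambda>T'. F (S, T')) T" for F T
    unfolding serB_def by (simp add: ser_def[of energy2] ser_bound[OF modes_creation, of T "energy2 (S, T)"] energy2_def crB_def)
  have "(serB x ^^ j) F (S, T) = (vser (\<lambda>n. x n / of_nat n) ^^ j) (\<lambda>T'. F (S, T')) T" for j T
    by (induction j arbitrary: T) (simp_all add: 1)
  then show ?thesis unfolding op_exp_def half_vertex_def by simp
qed

definition vac2 :: fock2 where
  "vac2 = (\<lambda>(S, T). vac S * vac T)"

lemma energy_mp_empty: "energy (maya_of empty_ptn) = 0"
  unfolding energy_mp[OF empty_ptn] by (simp add: psize_def empty_ptn_def)

text \<open>Completeness of the bosonic states: since \<open>L\<^sub>0\<close> is the energy, the identity satisfies the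
  same recursion as the exponential.\<close>

lemma op_exp_serC_vac:
  assumes "neutral S" "neutral T" shows "op_exp serC vac2 (S, T) = bas S T"
  using assms
proof (induction "energy S" arbitrary: S T rule: less_induct)
  case less
  let ?K = "op_exp serC vac2"
  have sC: "serC = ser fst_energy (\<lambda>n. 1 / of_nat n) crC"
  proof (intro ext)
    fix F t
    show "serC F t = ser fst_energy (\<lambda>n. 1 / of_nat n) crC F t"
      using ser_bound[OF modes_crC_fst, of t "energy2 t" "\<lambda>n. 1 / of_nat n" F]
      by (simp add: serC_def ser_def[of energy2] energy2_def)
  qed
  show ?case
  proof (cases "energy S = 0")
    case True
    then have S: "S = maya_of empty_ptn" using neutral_energy0 less by blast
    have "lowering fst_energy serC" unfolding sC by (rule lowering_ser[OF modes_crC_fst])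
    then have "?K (S, T) = vac2 (S, T)" using op_exp_finite[of fst_energy serC "(S, T)" 0 vac2] True by simp
    then show ?thesis by (simp add: vac2_def vac_bas S) (simp add: bas_def)
  next
    case False
    have "of_nat (energy S) * ?K (S, T)
        = op_exp serC (\<lambda>t. of_nat (energy (fst t)) * vac2 t) (S, T) + ser fst_energy (\<lambda>n. 1) crC ?K (S, T)"
    proof -
      have w: "of_nat (energy (fst t)) * crC n v t = crC n (\<lambda>k. of_nat (energy (fst k)) * v k) t + of_nat n * crC n v t"
        if n: "n \<ge> 1" for n v t
      proof -
        obtain S T where t: "t = (S, T)" by (cases t) auto
        show ?thesis unfolding t using creation_weight[OF n, of S "\<lambda>S'. creation n (\<lambda>T'. v (S', T')) T"]
          by (simp add: crC_eq flin_scale[OF creation_flin[OF n]])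
      qed
      show ?thesis
        using op_exp_ser_deriv[OF modes_crC_fst crC_crC w, of "(S, T)" "\<lambda>_. 1" vac2] unfolding sC by simp
    qed
    also have "(\<lambda>t. of_nat (energy (fst t)) * vac2 t) = (\<lambda>_. 0)"
    proof
      fix t :: "maya \<times> maya"
      show "of_nat (energy (fst t)) * vac2 t = 0"
        using energy_mp_empty by (cases t) (auto simp: vac2_def vac_bas bas_def)
    qed
    also have "op_exp serC (\<lambda>_. 0) (S, T) = 0" by (rule flin_zero[OF op_exp_flin[OF lowering_sers(3)]])
    \<comment> \<open>Creation lowers the energy in the first copy, so the induction hypothesis
      turns the kernel inside into the identity.\<close>
    also have "ser fst_energy (\<lambda>n. 1) crC ?K (S, T) = (\<Sum>n = 1..energy S. creation n (\<lambda>S'. creation n (bas S') T) S)"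
      unfolding ser_def by (auto simp: crC_eq intro!: sum.cong creation_cong_neutral less)
    \<comment> \<open>On the identity kernel, creation in the second copy equals annihilation in the
      first. The sum becomes L_0, whose eigenvalue \<open>energy S\<close> is also the factor on the
      left-hand side.\<close>
    also have "\<dots> = (\<Sum>n = 1..energy S. a_op (- int n) (a_op (int n) (bas T)) S)"
    proof (intro sum.cong refl)
      fix n assume "n \<in> {1..energy S}"
      then have "creation n (bas S') T = a_op (int n) (bas T) S'" for S'
        unfolding creation_def using a_op_transpose[of "- int n" S' T] by simp
      then show "creation n (\<lambda>S'. creation n (bas S') T) S = a_op (- int n) (a_op (int n) (bas T)) S"
        by (simp add: creation_def)
    qed
    also have "\<dots> = L0_op (bas T) S"
    proof -
      have "L0_op (bas T) S = (\<Sum>\<^sub>\<infinity>n\<in>{1..energy S}. a_op (- int n) (a_op (int n) (bas T)) S)"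
        unfolding L0_op_def
        by (rule infsum_cong_neutral) (use creation_big[of _ S] in \<open>auto simp: creation_def\<close>)
      then show ?thesis by simp
    qed
    also have "\<dots> = of_nat (energy S) * bas S T" unfolding L0_op_eq by (auto simp: bas_def)
    finally show ?thesis using False by simp
  qed
qed

text \<open>The commuting factors are peeled off: the two half vertex operators act on the two
  arguments of the identity kernel, and contracting them leaves one intermediate partition.\<close>

lemma op_exp_E2_vac:
  assumes S: "neutral S" and T: "neutral T"
  shows "op_exp (E2 y x) vac2 (S, T)
    = (\<Sum>\<^sub>\<infinity>e\<in>partitions. half_vertex y (bas (maya_of e)) S * half_vertex x (bas (maya_of e)) T)"
proof -
  have "op_exp (E2 y x) vac2 (S, T) = half_vertex y (\<lambda>S'. half_vertex x (\<lambda>T'. op_exp serC vac2 (S', T')) T) S"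
    unfolding op_exp_E2 op_exp_serA op_exp_serB ..
  also have "\<dots> = half_vertex y (\<lambda>S'. half_vertex x (bas S') T) S"
    by (intro half_vertex_cong_neutral S T op_exp_serC_vac)
  also have "\<dots> = (\<Sum>\<^sub>\<infinity>e\<in>partitions. half_vertex y (bas (maya_of e)) S * half_vertex x (bas (maya_of e)) T)"
    by (rule half_vertex_expand[OF S])
  finally show ?thesis .
qed

text \<open>A finite functional of the variable that is not acted on can be pulled out by
  \<open>flin_swap\<close>; on the identity kernel that remains, a_n in one argument is a_(-n) in
  the other.\<close>

lemma a_op_flin_transpose:
  assumes "n \<ge> 1" "flin g" shows "a_op (int n) (\<lambda>U. g (bas U)) T = g (creation n (bas T))"
proof -
  have "(\<lambda>U. bas U k :: complex) = bas k" for k :: maya by (auto simp: bas_def fun_eq_iff)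
  then have *: "(\<lambda>k. a_op (int n) (\<lambda>U. bas U k) T) = creation n (bas T)"
    using a_op_transpose[of "int n" _ T] assms(1) by (simp add: creation_def)
  have "a_op (int n) (\<lambda>U. g (\<lambda>k. bas U k)) T = g (\<lambda>k. a_op (int n) (\<lambda>U. bas U k) T)"
    by (rule flin_swap[OF a_op_flin assms(2)]) (use assms(1) in simp)
  then show ?thesis by (simp add: *)
qed

text \<open>Moving the annihilation operators of a copy that starts in \<open>\<nu>\<close> and ends in \<open>T\<close> onto
  the transposed matrix element, they become creation operators.\<close>

lemma transpose_E2:
  fixes \<Phi> :: "nat \<Rightarrow> maya \<Rightarrow> maya \<Rightarrow> complex"
  assumes \<Phi>0: "\<And>S T. \<Phi> 0 S T = u * (vac S * bas \<nu> T)"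
    and \<Phi>s: "\<And>j S T. \<Phi> (Suc j) S T = (\<Sum>\<^sub>\<infinity>n\<in>{1..}. 1 / of_nat n *
      (x n * a_op (int n) (\<Phi> j S) T + creation n (\<lambda>S'. a_op (int n) (\<Phi> j S') T) S
        + y n * creation n (\<lambda>S'. \<Phi> j S' T) S))"
  shows "\<Phi> j S T = u * (E2 y x ^^ j) (\<lambda>(S', T'). vac S' * bas T T') (S, \<nu>)"
proof (induction j arbitrary: S T)
  case 0
  then show ?case by (simp add: \<Phi>0 bas_def)
next
  case (Suc j)
  define H where "H T = (E2 y x ^^ j) (\<lambda>(S', T'). vac S' * bas T T')" for T
  have IH: "\<Phi> j S T = u * H T (S, \<nu>)" for S T unfolding H_def by (rule Suc)
  have ann: "a_op (int n) (\<Phi> j S) T = u * crB n (H T) (S, \<nu>)" if n: "n \<ge> 1" for n S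
  proof -
    \<comment> \<open>The diagram T enters \<open>H T\<close> only through its basis vector, so the
      annihilator acts on a finite functional evaluated at basis vectors, as in
      \<open>a_op_flin_transpose\<close>.\<close>
    define g where "g v = (E2 y x ^^ j) (\<lambda>(S', T'). vac S' * v T') (S, \<nu>)" for v :: fock
    have fg: "flin g" unfolding g_def case_prod_unfold
      by (rule flin_comp[OF lowering_flin_pow[OF lowering_E2]]) (intro flin_cmult flin_eval)
    have fa: "flin (\<lambda>v. a_op (int n) v T)" by (rule a_op_flin) (use n in simp)
    have "a_op (int n) (\<Phi> j S) T = a_op (int n) (\<lambda>i. u * g (bas i)) T"
      by (rule arg_cong2[where f = "\<lambda>v T. a_op (int n) v T"]) (simp_all add: IH g_def H_def fun_eq_iff)
    also have "\<dots> = u * a_op (int n) (\<lambda>i. g (bas i)) T" by (rule flin_scale[OF fa])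
    also have "a_op (int n) (\<lambda>i. g (bas i)) T = g (creation n (bas T))" by (rule a_op_flin_transpose[OF n fg])
    also have "g (creation n (bas T)) = crB n (H T) (S, \<nu>)"
    proof -
      have "(\<lambda>(S', T'). vac S' * creation n (bas T) T') = crB n (\<lambda>(S', T'). vac S' * bas T T')"
        by (simp add: crB_def flin_scale[OF creation_flin[OF n]] fun_eq_iff)
      \<comment> \<open>The creation operator arises innermost, on the initial vector, and is moved
        outside through the powers of \<open>E2\<close>, with which it commutes.\<close>
      then show ?thesis unfolding g_def H_def
        by (simp add: pow_commute[of "E2 y x" "crB n", OF E2_crB[OF n]])
    qed
    finally show ?thesis .
  qed
  have "\<Phi> (Suc j) S T = (\<Sum>\<^sub>\<infinity>n\<in>{1..}. u * (1 / of_nat n *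
      (x n * crB n (H T) (S, \<nu>) + crC n (H T) (S, \<nu>) + y n * crA n (H T) (S, \<nu>))))"
    unfolding \<Phi>s
  proof (intro infsum_cong)
    fix n :: nat assume "n \<in> {1..}"
    then have n: "n \<ge> 1" by simp
    show "1 / of_nat n *
      (x n * a_op (int n) (\<Phi> j S) T + creation n (\<lambda>S'. a_op (int n) (\<Phi> j S') T) S
        + y n * creation n (\<lambda>S'. \<Phi> j S' T) S) = u * (1 / of_nat n *
      (x n * crB n (H T) (S, \<nu>) + crC n (H T) (S, \<nu>) + y n * crA n (H T) (S, \<nu>)))"
      unfolding ann[OF n] IH flin_scale[OF creation_flin[OF n]]
      by (simp add: crC_def crA_def algebra_simps)
  qed
  also have "\<dots> = (\<Sum>\<^sub>\<infinity>n\<in>{1..energy2 (S, \<nu>)}. u * (1 / of_nat n *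
      (x n * crB n (H T) (S, \<nu>) + crC n (H T) (S, \<nu>) + y n * crA n (H T) (S, \<nu>))))"
    by (rule infsum_cong_neutral)
       (use modesD(2)[OF modes_crA, of _ "(S, \<nu>)"] modesD(2)[OF modes_crB, of _ "(S, \<nu>)"]
          modesD(2)[OF modes_crC, of _ "(S, \<nu>)"] in auto)
  also have "\<dots> = u * E2 y x (H T) (S, \<nu>)"
    by (simp add: E2_def serA_def serB_def serC_def ser_def sum.distrib[symmetric] sum_distrib_left algebra_simps)
  finally show ?case by (simp add: H_def)
qed

text \<open>Ending in the empty partition becomes, after transposition, starting from the vacuum,
  and the start \<nu> becomes the diagram at which the result is evaluated.\<close>

lemma transpose_op_exp_E2:
  fixes \<Phi> :: "nat \<Rightarrow> maya \<Rightarrow> maya \<Rightarrow> complex"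
  assumes "\<And>S T. \<Phi> 0 S T = u * (vac S * bas \<nu> T)"
    and "\<And>j S T. \<Phi> (Suc j) S T = (\<Sum>\<^sub>\<infinity>n\<in>{1..}. 1 / of_nat n *
      (x n * a_op (int n) (\<Phi> j S) T + creation n (\<lambda>S'. a_op (int n) (\<Phi> j S') T) S
        + y n * creation n (\<lambda>S'. \<Phi> j S' T) S))"
  shows "(\<Sum>j. \<Phi> j S (maya_of empty_ptn) / fact j) = u * op_exp (E2 y x) vac2 (S, \<nu>)"
proof -
  have v: "vac2 = (\<lambda>(S', T'). vac S' * bas (maya_of empty_ptn) T')" by (simp add: vac2_def vac_bas)
  have "(\<Sum>j. \<Phi> j S (maya_of empty_ptn) / fact j)
      = (\<Sum>j. if j \<le> energy2 (S, \<nu>) then u * ((E2 y x ^^ j) vac2 (S, \<nu>) / fact j) else 0)"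
    unfolding transpose_E2[OF assms] v[symmetric]
    by (intro suminf_cong) (use lowering_pow_zero[OF lowering_E2] in \<open>auto simp: not_le\<close>)
  also have "\<dots> = (\<Sum>j\<le>energy2 (S, \<nu>). u * ((E2 y x ^^ j) vac2 (S, \<nu>) / fact j))"
    by (subst suminf_finite[of "{..energy2 (S, \<nu>)}"]) auto
  finally show ?thesis
    by (simp add: op_exp_finite[OF lowering_E2 order_refl] sum_distrib_left)
qed

section \<open>Horizontal strips\<close>

text \<open>The index of the gap of \<open>- occ (maya_of l)\<close> containing \<open>x\<close>: \<open>l\<close> and \<open>S\<close> differ by a horizontal
  strip iff the complement of \<open>S\<close> has exactly one element in each gap.\<close>

definition gidx :: "ptn \<Rightarrow> int \<Rightarrow> nat" where
  "gidx l x = (LEAST i. hi l i \<le> x)"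

definition strip :: "ptn \<Rightarrow> maya \<Rightarrow> bool" where
  "strip l S \<longleftrightarrow> bij_betw (gidx l) (- occ S) UNIV"

lemma gidx_le: assumes l: "l \<in> partitions" shows "gidx l x \<le> i \<longleftrightarrow> hi l i \<le> x"
proof
  obtain L where L: "\<And>i. i \<ge> L \<Longrightarrow> l i = 0" using ptn_vanish[OF l] by blast
  have "hi l (L + nat \<bar>x\<bar>) \<le> x" using L[of "L + nat \<bar>x\<bar>"] by simp
  then have 1: "hi l (gidx l x) \<le> x" unfolding gidx_def by (rule LeastI)
  assume "gidx l x \<le> i"
  then have "hi l i \<le> hi l (gidx l x)" using hi_strict[OF l, of "gidx l x" i] by (cases "gidx l x = i") auto
  then show "hi l i \<le> x" using 1 by simp
next
  assume "hi l i \<le> x"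
  then show "gidx l x \<le> i" unfolding gidx_def by (rule Least_le)
qed

lemma gidx_antimono: assumes l: "l \<in> partitions" and "x \<le> y" shows "gidx l y \<le> gidx l x"
proof -
  have "hi l (gidx l x) \<le> x" using gidx_le[OF l, of x "gidx l x"] by blast
  then show ?thesis using gidx_le[OF l, of y "gidx l x"] assms(2) by linarith
qed

lemma gidx_between:
  assumes l: "l \<in> partitions" and "x \<le> y" "y \<le> z" "gidx l x = gidx l z" shows "gidx l y = gidx l x"
  using gidx_antimono[OF l assms(2)] gidx_antimono[OF l assms(3)] assms(4) by linarith

lemma bij_betw_swap:
  assumes "a \<notin> B" "b \<notin> B" "f a = f b"
  shows "bij_betw f (insert a B) U \<longleftrightarrow> bij_betw f (insert b B) U"
  using assms by (simp add: bij_betw_def inj_on_insert)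

text \<open>Here k turns into a hole and j is filled. If each gap already holds one hole, only the
  hole in the gap of k qualifies as j; no hole lies between them, so the sign is +1. If an exchange
  qualifies although S is no strip, some gap holds two holes; either of them may be filled, no third
  hole lies between them, and the two signs cancel.\<close>

lemma strip_inner:
  assumes l: "l \<in> partitions" and k: "k \<in> occ S"
  defines "C \<equiv> - occ S"
  defines "P \<equiv> \<lambda>j. bij_betw (gidx l) (insert k (C - {j})) UNIV"
  shows "(\<Sum>j\<in>{j \<in> C. k < j}. (- 1) ^ card (C \<inter> {k<..<j}) * (if P j then 1 else 0))
    = (if strip l S \<and> (\<exists>j\<in>C. k < j \<and> gidx l j = gidx l k) then 1 else 0 :: complex)"
proof -
  let ?g = "gidx l"
  have kC: "k \<notin> C" using k by (simp add: C_def)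
  obtain M where M: "bd M S" using bd_ex by blast
  have "{j \<in> C. k < j} \<subseteq> {k<..<M}" using bd_less[OF M] by (auto simp: C_def)
  then have fin: "finite {j \<in> C. k < j}" by (rule finite_subset) simp
  have PS: "P j \<longleftrightarrow> strip l S" if "j \<in> C" "?g j = ?g k" for j
  proof -
    have "insert j (C - {j}) = C" using that by blast
    then show ?thesis unfolding P_def strip_def C_def[symmetric]
      using bij_betw_swap[of k "C - {j}" j ?g UNIV] kC that by simp
  qed
  have PP: "P a \<longleftrightarrow> P b" if "a \<in> C" "b \<in> C" "?g a = ?g b" "a \<noteq> b" for a b
  proof -
    let ?B = "insert k (C - {a, b})"
    have "insert k (C - {a}) = insert b ?B" "insert k (C - {b}) = insert a ?B" using that kC by auto
    moreover have "a \<notin> ?B" "b \<notin> ?B" using that kC by auto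
    ultimately show ?thesis unfolding P_def using bij_betw_swap[of b ?B a ?g UNIV] that by simp
  qed
  have Pinj: "x = y" if "P j" "x \<in> insert k (C - {j})" "y \<in> insert k (C - {j})" "?g x = ?g y" for j x y
  proof -
    have "inj_on ?g (insert k (C - {j}))" using that(1) unfolding P_def bij_betw_def by blast
    then show ?thesis using that(4,2,3) by (rule inj_onD)
  qed
  show ?thesis
  proof (cases "\<exists>j\<in>C. P j")
    case False
    then have "\<not> (strip l S \<and> (\<exists>j\<in>C. k < j \<and> ?g j = ?g k))" using PS by blast
    then show ?thesis using False by (simp add: sum.neutral)
  next
    case True
    then obtain j0 where j0: "j0 \<in> C" "P j0" by blast
    have "?g ` insert k (C - {j0}) = UNIV" using j0(2) unfolding P_def bij_betw_def by (rule conjunct2)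
    then have "?g j0 \<in> ?g ` insert k (C - {j0})" by (simp only: UNIV_I)
    \<comment> \<open>After \<open>j0\<close> has been filled, its gap must contain another hole e.
      Whether e is the new hole k decides between the two cases.\<close>
    then obtain e where e0: "?g j0 = ?g e" "e \<in> insert k (C - {j0})" by (rule imageE)
    note e = e0(2) e0(1)[symmetric]
    show ?thesis
    proof (cases "e = k")
      case True
      then have g: "?g k = ?g j0" using e by simp
      have S: "strip l S" using PS[OF j0(1)] g j0(2) by simp
      have not: "\<not> P j" if "j \<in> C" "j \<noteq> j0" for j
        using Pinj[of j k j0] that g j0(1) kC by blast
      have uniq: "j = j0" if "j \<in> C" "?g j = ?g k" for j
        using PS[OF that] S not[OF that(1)] by blast
      have em: "C \<inter> {k<..<j0} = {}" if "k < j0"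
      proof -
        have False if x: "x \<in> C" "k < x" "x < j0" for x
        proof -
          have "?g x = ?g k"
            by (rule gidx_between[OF l less_imp_le[OF x(2)] less_imp_le[OF x(3)] g])
          then show False using uniq[OF x(1)] x(3) by blast
        qed
        then show ?thesis by auto
      qed
      have "(\<Sum>j\<in>{j \<in> C. k < j}. (- 1) ^ card (C \<inter> {k<..<j}) * (if P j then 1 else 0 :: complex))
          = (\<Sum>j\<in>{j \<in> C. k < j}. if j = j0 then 1 else 0)"
        using not j0(2) em by (intro sum.cong) auto
      also have "\<dots> = (if k < j0 then 1 else 0)" using fin j0 by simp
      also have "\<dots> = (if strip l S \<and> (\<exists>j\<in>C. k < j \<and> ?g j = ?g k) then 1 else 0)"
      proof -
        have "(\<exists>j\<in>C. k < j \<and> ?g j = ?g k) \<longleftrightarrow> k < j0" using uniq j0(1) g[symmetric] by blast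
        then show ?thesis using S by simp
      qed
      finally show ?thesis .
    next
      case False
      then have e': "e \<in> C" "e \<noteq> j0" using e by auto
      have nS: "\<not> strip l S"
      proof
        assume "strip l S"
        then have "inj_on ?g C" unfolding strip_def C_def[symmetric] bij_betw_def by blast
        then have "e = j0" using e(2) e'(1) j0(1) by (rule inj_onD)
        then show False using e'(2) by simp
      qed
      have gk: "?g k \<noteq> ?g j0"
      proof
        assume "?g k = ?g j0"
        then have "?g k = ?g e" using e(2) by (rule trans[OF _ sym])
        then have "k = e" by (intro Pinj[OF j0(2) _ e(1)]) simp_all
        then show False using False by simp
      qed
      define a b where "a = min e j0" and "b = max e j0"
      have ab: "a \<in> C" "b \<in> C" "a < b" "?g a = ?g b" "?g k \<noteq> ?g a" "P a" "P b"
        using e' e(2) j0 gk PP[OF e'(1) j0(1) e(2) e'(2)] by (simp_all add: a_def b_def min_def max_def)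
      have not: "\<not> P j" if "j \<in> C" "j \<noteq> a" "j \<noteq> b" for j
        using Pinj[of j a b] that ab by blast
      \<comment> \<open>A gap is an interval, and k lies in another one, so both holes lie on the
        same side of k.\<close>
      have kab: "k < a \<longleftrightarrow> k < b"
      proof
        assume "k < b"
        show "k < a"
        proof (rule ccontr)
          assume "\<not> k < a"
          then have "a \<le> k" by simp
          then have "?g k = ?g a" by (rule gidx_between[OF l _ less_imp_le[OF \<open>k < b\<close>] ab(4)])
          then show False using ab(5) by blast
        qed
      qed (use ab in simp)
      have sg: "C \<inter> {k<..<b} = insert a (C \<inter> {k<..<a})" if "k < a"
      proof -
        have False if x: "x \<in> C" "a < x" "x < b" for x
        proof -
          have "?g x = ?g b" unfolding ab(4)[symmetric]
            by (rule gidx_between[OF l less_imp_le[OF x(2)] less_imp_le[OF x(3)] ab(4)])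
          then have "x = b" using x ab by (intro Pinj[OF ab(6)]) auto
          then show False using x(3) by simp
        qed
        then show ?thesis using that ab by force
      qed
      have "(\<Sum>j\<in>{j \<in> C. k < j}. (- 1) ^ card (C \<inter> {k<..<j}) * (if P j then 1 else 0 :: complex))
          = (\<Sum>j\<in>{j \<in> C. k < j} \<inter> {a, b}. (- 1) ^ card (C \<inter> {k<..<j}))"
        using not ab fin by (intro sum.mono_neutral_cong_right) auto
      also have "\<dots> = 0"
      proof (cases "k < a")
        case True
        then have "{j \<in> C. k < j} \<inter> {a, b} = {a, b}" using ab kab by auto
        then show ?thesis using ab True sg by simp
      next
        case False
        then have "{j \<in> C. k < j} \<inter> {a, b} = {}" using kab by auto
        then show ?thesis by simp
      qed
      finally show ?thesis using nS by simp
    qed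
  qed
qed

text \<open>The gap index of the i-th hole is strictly increasing in i and takes every value, so it
  can only be i.\<close>

lemma gidx_hi: "m \<in> partitions \<Longrightarrow> l \<in> partitions \<Longrightarrow> strip l (maya_of m) \<Longrightarrow> gidx l (hi m i) = i"
proof -
  assume m: "m \<in> partitions" and l: "l \<in> partitions" and s: "strip l (maya_of m)"
  define h where "h i = gidx l (hi m i)" for i
  have b: "bij_betw (gidx l) (range (hi m)) UNIV" using s unfolding strip_def notocc_mp[OF m] .
  have inj: "i = j" if "h i = h j" for i j
  proof -
    have "inj_on (gidx l) (range (hi m))" using b unfolding bij_betw_def by (rule conjunct1)
    then have "hi m i = hi m j" using that unfolding h_def by (rule inj_onD) (rule rangeI)+
    then show ?thesis by (rule injD[OF inj_hi[OF m]])
  qed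
  have less: "h i < h j" if "i < j" for i j
  proof -
    have "h i \<le> h j" unfolding h_def
      by (rule gidx_antimono[OF l less_imp_le[OF hi_strict[OF m that]]])
    moreover have "h i \<noteq> h j" using inj[of i j] that by blast
    ultimately show ?thesis by simp
  qed
  have "range h = gidx l ` range (hi m)" unfolding h_def by (rule image_image[symmetric])
  also have "\<dots> = UNIV" using b unfolding bij_betw_def by (rule conjunct2)
  finally have "range h = UNIV" .
  then have r: "range (\<lambda>i. int (h i)) = range int" using image_image[of int h UNIV] by simp
  have "(\<lambda>i. int (h i)) = int"
    by (rule strict_enum_unique[OF _ _ r]) (use less in simp_all)
  then show "gidx l (hi m i) = i" by (simp add: fun_eq_iff h_def)
qed

lemma strip_mp:
  assumes m: "m \<in> partitions" and l: "l \<in> partitions"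
  shows "strip l (maya_of m) \<longleftrightarrow> (\<forall>i. l i \<le> m i \<and> m (Suc i) \<le> l i)"
proof
  assume s: "strip l (maya_of m)"
  have "l i \<le> m i" for i using gidx_le[OF l, of "hi m i" i] gidx_hi[OF m l s, of i] by simp
  moreover have "m (Suc i) \<le> l i" for i
    using gidx_le[OF l, of "hi m (Suc i)" i] gidx_hi[OF m l s, of "Suc i"] by simp
  ultimately show "\<forall>i. l i \<le> m i \<and> m (Suc i) \<le> l i" by blast
next
  assume a: "\<forall>i. l i \<le> m i \<and> m (Suc i) \<le> l i"
  have g: "gidx l (hi m i) = i" for i
  proof (rule antisym)
    have "l i \<le> m i" using a by blast
    then show "gidx l (hi m i) \<le> i" using gidx_le[OF l, of "hi m i" i] by simp
    show "i \<le> gidx l (hi m i)"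
    proof (cases i)
      case (Suc n)
      have "m (Suc n) \<le> l n" using a by blast
      then have "\<not> hi l n \<le> hi m i" using Suc by simp
      then show ?thesis using gidx_le[OF l, of "hi m i" n] Suc by simp
    qed simp
  qed
  show "strip l (maya_of m)" unfolding strip_def notocc_mp[OF m]
    by (rule bij_betw_byWitness[of _ "hi m"]) (auto simp: g)
qed

lemma psize_vanish: "(\<And>i. i \<ge> L \<Longrightarrow> l i = 0) \<Longrightarrow> psize l = (\<Sum>i<L. l i)"
  unfolding psize_def by (rule sum.mono_neutral_left) (use vanish_less[of L l] in auto)

lemma psize_mono:
  assumes "m \<in> partitions" "\<And>i. l i \<le> m i" shows "psize l \<le> psize m"
proof -
  obtain L where L: "\<And>i. i \<ge> L \<Longrightarrow> m i = 0" using ptn_vanish[OF assms(1)] by blast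
  have L': "\<And>i. i \<ge> L \<Longrightarrow> l i = 0" using L assms(2) by (metis le_zero_eq)
  have "psize m = sum m {..<L}" "psize l = sum l {..<L}"
    by (rule psize_vanish, rule L, assumption, rule psize_vanish, rule L', assumption)
  then show ?thesis using sum_mono[of "{..<L}" l m] assms(2) by simp
qed

lemma psize_mono_eq:
  assumes "m \<in> partitions" "\<And>i. l i \<le> m i" "psize l = psize m" shows "l = m"
proof -
  obtain L where L: "\<And>i. i \<ge> L \<Longrightarrow> m i = 0" using ptn_vanish[OF assms(1)] by blast
  have L': "\<And>i. i \<ge> L \<Longrightarrow> l i = 0" using L assms(2) by (metis le_zero_eq)
  have "psize m = sum m {..<L}" "psize l = sum l {..<L}"
    by (rule psize_vanish, rule L, assumption, rule psize_vanish, rule L', assumption)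
  then have e: "(\<Sum>i<L. l i) = (\<Sum>i<L. m i)" using assms(3) by simp
  show ?thesis
  proof (rule ccontr)
    assume "l \<noteq> m"
    then obtain i where i: "l i < m i" using assms(2) by (metis ext le_neq_implies_less)
    have "i < L" using vanish_less[of L m i] L i by simp
    then have "(\<Sum>i<L. l i) < (\<Sum>i<L. m i)" using i assms(2) by (intro sum_strict_mono_ex1) auto
    then show False using e by simp
  qed
qed

lemma strip_energy: "neutral S \<Longrightarrow> l \<in> partitions \<Longrightarrow> strip l S \<Longrightarrow> energy (maya_of l) \<le> energy S"
  by (metis neutral_ex strip_mp energy_mp psize_mono)

text \<open>Gap i begins at \<open>hi l i\<close> and its only hole is \<open>hi m i\<close>. The
  particles counted are the labels from the former up to the latter, one for each cell that the
  strip adds in row i.\<close>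

lemma strip_card:
  assumes m: "m \<in> partitions" and l: "l \<in> partitions" and s: "strip l (maya_of m)"
  defines "Q \<equiv> {k \<in> occ (maya_of m). \<exists>j\<in>- occ (maya_of m). k < j \<and> gidx l j = gidx l k}"
  shows "card Q = energy (maya_of m) - energy (maya_of l)"
proof -
  obtain L where L: "\<And>i. i \<ge> L \<Longrightarrow> m i = 0" using ptn_vanish[OF m] by blast
  have ml: "l i \<le> m i" "m (Suc i) \<le> l i" for i using s strip_mp[OF m l] by auto
  have L': "\<And>i. i \<ge> L \<Longrightarrow> l i = 0" using L ml by (metis le_zero_eq)
  let ?I = "SIGMA i:{..<L}. {hi l i..<hi m i}"
  have gk: "gidx l k = i" if "hi l i \<le> k" "k < hi m i" for i k
  proof (rule antisym)
    show "gidx l k \<le> i" using gidx_le[OF l, of k i] that by simp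
    show "i \<le> gidx l k"
    proof (cases i)
      case (Suc n)
      have "\<not> hi l n \<le> k" using ml(2)[of n] that(2) Suc by simp
      then show ?thesis using gidx_le[OF l, of k n] Suc by simp
    qed simp
  qed
  have "Q = snd ` ?I"
  proof (intro set_eqI iffI)
    fix k assume "k \<in> Q"
    then obtain j where j: "j \<in> range (hi m)" "k < j" "gidx l j = gidx l k"
      unfolding Q_def notocc_mp[OF m] by blast
    then obtain i where i: "j = hi m i" by blast
    have "gidx l k = i" using j(3) gidx_hi[OF m l s, of i] i by simp
    then have k: "hi l i \<le> k" using gidx_le[OF l, of k i] by simp
    have "i < L" using vanish_less[of L m i] L k j(2) i by force
    then have "(i, k) \<in> ?I" using k j i by simp
    then show "k \<in> snd ` ?I" by force
  next
    fix k assume "k \<in> snd ` ?I"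
    then obtain i where i: "hi l i \<le> k" "k < hi m i" by auto
    have "k \<in> occ (maya_of m)"
    proof (rule ccontr)
      assume "k \<notin> occ (maya_of m)"
      then have "k \<in> range (hi m)" using notocc_mp[OF m] by blast
      then obtain j where "k = hi m j" by blast
      then show False using gidx_hi[OF m l s, of j] gk[OF i] i by simp
    qed
    moreover have "hi m i \<in> - occ (maya_of m)" unfolding notocc_mp[OF m] by blast
    moreover have "gidx l (hi m i) = gidx l k" using gidx_hi[OF m l s, of i] gk[OF i] by simp
    ultimately show "k \<in> Q" unfolding Q_def using i by blast
  qed
  moreover have "inj_on snd ?I"
  proof (rule inj_onI)
    fix p p' assume p: "p \<in> ?I" "p' \<in> ?I" "snd p = snd p'"
    obtain i k where 1: "p = (i, k)" by (cases p)
    obtain i' k' where 2: "p' = (i', k')" by (cases p')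
    show "p = p'" using p gk[of i k] gk[of i' k'] unfolding 1 2 by simp
  qed
  ultimately have "card Q = card ?I" by (simp add: card_image)
  also have "\<dots> = (\<Sum>i<L. m i - l i)" by (simp add: nat_diff_distrib')
  also have "\<dots> = (\<Sum>i<L. m i) - (\<Sum>i<L. l i)" by (rule sum_subtractf_nat) (rule ml)
  also have "(\<Sum>i<L. m i) = energy (maya_of m)"
    unfolding energy_mp[OF m] by (rule psize_vanish[symmetric]) (rule L)
  also have "(\<Sum>i<L. l i) = energy (maya_of l)"
    unfolding energy_mp[OF l] by (rule psize_vanish[symmetric]) (rule L')
  finally show ?thesis .
qed

text \<open>The length of a hop determines its mode n, so summing over modes and starting labels
  amounts to summing over inversions.\<close>

lemma vser_inversions:
  "vser c v S = - (\<Sum>(k, j)\<in>inversions S. c (nat (j - k)) * (- 1) ^ card (occ S \<inter> {k<..<j}) * v (moved k j S))"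
proof -
  obtain M where M: "bd M S" using bd_ex by blast
  define N where "N = energy S + nat (2 * M)"
  define h where "h = (\<lambda>(k, j). if (k, j) \<in> inversions S then c (nat (j - k)) * (- 1) ^ card (occ S \<inter> {k<..<j}) * v (moved k j S) else 0)"
  let ?Q = "{(k, j). - M \<le> k \<and> k < M \<and> k < j \<and> j \<le> k + int N}"
  have "vser c v S = (\<Sum>n = 1..N. c n * creation n v S)"
    by (rule ser_bound[OF modes_creation]) (simp add: N_def)
  also have "\<dots> = (\<Sum>n = 1..N. - (\<Sum>k\<in>{- M..<M}. h (k, k + int n)))"
  proof (intro sum.cong refl)
    fix n assume "n \<in> {1..N}"
    then have n: "n \<ge> 1" by simp
    have "c n * hop k (k + int n) v S = h (k, k + int n)" for k
      using n by (simp add: hop_sign h_def inversions_def)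
    then show "c n * creation n v S = - (\<Sum>k\<in>{- M..<M}. h (k, k + int n))"
      unfolding creation_def using a_op_creation[of "int n" M S v] M n by (simp add: sum_distrib_left)
  qed
  also have "\<dots> = - (\<Sum>p\<in>{1..N} \<times> {- M..<M}. h (snd p, snd p + int (fst p)))"
    by (simp add: sum_negf sum.cartesian_product case_prod_unfold)
  also have "(\<Sum>p\<in>{1..N} \<times> {- M..<M}. h (snd p, snd p + int (fst p))) = sum h ?Q"
    by (rule sum.reindex_bij_witness[of _ "\<lambda>(k, j). (nat (j - k), k)" "\<lambda>(n, k). (k, k + int n)"]) auto
  also have "\<dots> = sum h (inversions S)"
  proof (rule sum.mono_neutral_right)
    have "?Q \<subseteq> {- M..<M} \<times> {- M..M + int N}" by auto
    then show "finite ?Q" by (rule finite_subset) simp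
    have "k < M \<and> - M \<le> k \<and> k < j \<and> j \<le> k + int N" if "(k, j) \<in> inversions S" for k j
      using inversions_sub[OF M] that unfolding N_def by (auto simp: inversions_def)
    then show "inversions S \<subseteq> ?Q" by auto
  qed (auto simp: h_def)
  also have "\<dots> = (\<Sum>(k, j)\<in>inversions S. c (nat (j - k)) * (- 1) ^ card (occ S \<inter> {k<..<j}) * v (moved k j S))"
    by (rule sum.cong) (auto simp: h_def)
  finally show ?thesis .
qed

text \<open>Newton's identity \<open>n h\<^sub>n = \<Sum> p\<^sub>i h\<^sub>n\<^sub>-\<^sub>i\<close> for one variable.\<close>

lemma strip_newton:
  fixes z :: complex
  assumes l: "l \<in> partitions" and S: "neutral S"
  defines "F \<equiv> \<lambda>S. if strip l S then z ^ (energy S - energy (maya_of l)) else 0"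
  shows "(of_nat (energy S) - of_nat (energy (maya_of l))) * F S = vser (\<lambda>n. (- 1) ^ n * z ^ n) F S"
proof -
  let ?e = "energy (maya_of l)" and ?C = "- occ S"
  obtain m where m: "m \<in> partitions" "S = maya_of m" using neutral_ex[OF S] by blast
  define f where "f k j = (- 1) ^ card (?C \<inter> {k<..<j}) * (if strip l (moved k j S) then 1 else 0 :: complex)" for k j
  have "vser (\<lambda>n. (- 1) ^ n * z ^ n) F S = (\<Sum>p\<in>inversions S. z ^ (energy S - ?e) * f (fst p) (snd p))"
    unfolding vser_inversions sum_negf[symmetric]
  proof (rule sum.cong[OF refl])
    fix p assume p: "p \<in> inversions S"
    obtain k j where kj: "p = (k, j)" by (cases p)
    define n where "n = nat (j - k)"
    have i: "k \<in> occ S" "j \<notin> occ S" "k < j" using p by (auto simp: kj inversions_def)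
    have en: "energy S = energy (moved k j S) + n" using energy_moved[OF i] i by (simp add: n_def)
    \<comment> \<open>Each of the n - 1 labels between k and j is a particle or a hole. The factor
      (-1)^n in the coefficients thus trades the sign that counts particles for one that counts
      holes, as in \<open>strip_inner\<close>.\<close>
    have sign: "- ((- 1) ^ n * (- 1) ^ card (occ S \<inter> {k<..<j})) = (- 1 :: complex) ^ card (?C \<inter> {k<..<j})"
    proof -
      have "card (occ S \<inter> {k<..<j}) + card (?C \<inter> {k<..<j}) = card {k<..<j}"
      proof -
        have "(occ S \<inter> {k<..<j}) \<union> (?C \<inter> {k<..<j}) = {k<..<j}" by blast
        moreover have "(occ S \<inter> {k<..<j}) \<inter> (?C \<inter> {k<..<j}) = {}" by blast
        ultimately show ?thesis
          using card_Un_disjoint[of "occ S \<inter> {k<..<j}" "?C \<inter> {k<..<j}"] by simp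
      qed
      then have "n = Suc (card (occ S \<inter> {k<..<j}) + card (?C \<inter> {k<..<j}))" using i by (simp add: n_def)
      then show ?thesis by (simp add: power_add)
    qed
    \<comment> \<open>The power of z does not depend on the hop: the coefficient supplies z^n, and
      the energy has dropped by n. Only a signed count of hops remains.\<close>
    have "z ^ n * F (moved k j S) = z ^ (energy S - ?e) * (if strip l (moved k j S) then 1 else 0)"
    proof (cases "strip l (moved k j S)")
      case True
      then have "?e \<le> energy (moved k j S)" using strip_energy[OF _ l] neutral_moved[OF i] S by blast
      then have "energy S - ?e = n + (energy (moved k j S) - ?e)" using en by simp
      then show ?thesis using True by (simp add: F_def power_add)
    qed (simp add: F_def)
    then have "- ((- 1) ^ n * (- 1) ^ card (occ S \<inter> {k<..<j})) * (z ^ n * F (moved k j S)) = z ^ (energy S - ?e) * f k j"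
      unfolding sign f_def by simp
    then show "- (case p of (k, j) \<Rightarrow> (- 1) ^ nat (j - k) * z ^ nat (j - k) * (- 1) ^ card (occ S \<inter> {k<..<j}) * F (moved k j S))
        = z ^ (energy S - ?e) * f (fst p) (snd p)"
      by (simp add: kj n_def[symmetric] mult_ac)
  qed
  also have "\<dots> = z ^ (energy S - ?e) * (\<Sum>p\<in>inversions S. f (fst p) (snd p))" by (simp add: sum_distrib_left)
  also have "(\<Sum>p\<in>inversions S. f (fst p) (snd p)) = (if strip l S then of_nat (energy S - ?e) else 0)"
  proof -
    obtain M where M: "bd M S" using bd_ex by blast
    let ?K = "occ S \<inter> {- M..<M}"
    have ck: "finite {j \<in> ?C. k < j}" for k
    proof (rule finite_subset)
      show "{j \<in> ?C. k < j} \<subseteq> {k<..<M}" using bd_less[OF M] by auto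
    qed simp
    have inv: "inversions S = (SIGMA k:?K. {j \<in> ?C. k < j})"
      using inversions_sub[OF M] unfolding inversions_def by auto
    have "(\<Sum>p\<in>inversions S. f (fst p) (snd p)) = (\<Sum>k\<in>?K. \<Sum>j\<in>{j \<in> ?C. k < j}. f k j)"
      unfolding inv using ck by (subst sum.Sigma) (auto simp: case_prod_unfold)
    also have "\<dots> = (\<Sum>k\<in>?K. if strip l S \<and> (\<exists>j\<in>?C. k < j \<and> gidx l j = gidx l k) then 1 else 0)"
    proof (intro sum.cong refl)
      fix k assume k: "k \<in> ?K"
      have "- occ (moved k j S) = insert k (?C - {j})" if "j \<in> ?C" "k < j" for j
        using that k by (auto simp: occ_moved)
      then have "f k j = (- 1) ^ card (?C \<inter> {k<..<j}) * (if bij_betw (gidx l) (insert k (?C - {j})) UNIV then 1 else 0)"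
        if "j \<in> {j \<in> ?C. k < j}" for j using that by (simp add: f_def strip_def)
      then have "(\<Sum>j\<in>{j \<in> ?C. k < j}. f k j)
          = (\<Sum>j\<in>{j \<in> ?C. k < j}. (- 1) ^ card (?C \<inter> {k<..<j}) * (if bij_betw (gidx l) (insert k (?C - {j})) UNIV then 1 else 0))"
        by (rule sum.cong[OF refl])
      also have "\<dots> = (if strip l S \<and> (\<exists>j\<in>?C. k < j \<and> gidx l j = gidx l k) then 1 else 0)"
        using k by (intro strip_inner[OF l]) simp
      finally show "(\<Sum>j\<in>{j \<in> ?C. k < j}. f k j) = \<dots>" .
    qed
    also have "\<dots> = (if strip l S then of_nat (energy S - ?e) else 0)"
    proof (cases "strip l S")
      case True
      let ?Q = "{k \<in> occ S. \<exists>j\<in>?C. k < j \<and> gidx l j = gidx l k}"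
      have "(\<Sum>k\<in>?K. if strip l S \<and> (\<exists>j\<in>?C. k < j \<and> gidx l j = gidx l k) then 1 else 0)
          = (\<Sum>k\<in>{k \<in> ?K. \<exists>j\<in>?C. k < j \<and> gidx l j = gidx l k}. 1 :: complex)"
        using True by (simp add: sum.If_cases Int_def)
      also have "{k \<in> ?K. \<exists>j\<in>?C. k < j \<and> gidx l j = gidx l k} = ?Q"
      proof -
        have "- M \<le> k \<and> k < M" if "k \<in> occ S" "j \<in> ?C" "k < j" for k j
          using bd_ge[OF M that(1)] bd_less[OF M, of j] that by simp
        then show ?thesis by auto
      qed
      also have "(\<Sum>k\<in>?Q. 1 :: complex) = of_nat (card ?Q)" by simp
      also have "card ?Q = energy S - ?e" using strip_card[OF m(1) l] True unfolding m(2) by simp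
      finally show ?thesis using True by simp
    qed simp
    finally show ?thesis .
  qed
  finally have "vser (\<lambda>n. (- 1) ^ n * z ^ n) F S = F S * of_nat (energy S - ?e)"
    by (simp add: F_def)
  moreover have "of_nat (energy S - ?e) = (of_nat (energy S) - of_nat ?e :: complex)" if "strip l S"
    using strip_energy[OF S l that] by (rule of_nat_diff)
  ultimately show ?thesis by (cases "strip l S") (auto simp: F_def)
qed

lemma half_vertex_strip:
  assumes l: "l \<in> partitions" and m: "m \<in> partitions"
  shows "half_vertex (\<lambda>n. (- 1) ^ n * z ^ n) (bas (maya_of l)) (maya_of m) = (if strip l (maya_of m) then z ^ (psize m - psize l) else 0)"
proof -
  have "half_vertex (\<lambda>n. (- 1) ^ n * z ^ n) (bas (maya_of l)) (maya_of m)
      = (if strip l (maya_of m) then z ^ (energy (maya_of m) - energy (maya_of l)) else 0)"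
  proof (rule half_vertex_unique[OF strip_newton[OF l]])
    fix S assume S: "neutral S" "energy S = energy (maya_of l)"
    obtain k where k: "k \<in> partitions" "S = maya_of k" using neutral_ex[OF S(1)] by blast
    have "strip l (maya_of k) \<longleftrightarrow> l = k"
    proof
      assume "strip l (maya_of k)"
      then show "l = k" using strip_mp[OF k(1) l] S(2) psize_mono_eq[OF k(1), of l]
        by (simp add: k(2) energy_mp[OF l] energy_mp[OF k(1)])
    next
      assume "l = k"
      then show "strip l (maya_of k)" using strip_mp[OF k(1) l] ptn_antimono[OF l] by simp
    qed
    moreover have "maya_of k = maya_of l \<longleftrightarrow> k = l" using inj_onD[OF inj_mp _ k(1) l] by blast
    ultimately show "(if strip l S then z ^ (energy S - energy (maya_of l)) else 0) = bas (maya_of l) S"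
      using S(2) by (auto simp: k(2) bas_def)
  qed (use neutral_mp[OF m] in simp_all)
  then show ?thesis by (simp add: energy_mp l m)
qed

section \<open>Skew Schur functions\<close>

definition ssyt_lt :: "nat \<Rightarrow> ptn \<Rightarrow> ptn \<Rightarrow> (nat \<times> nat \<Rightarrow> nat) set" where
  "ssyt_lt M l e = {T \<in> ssyt l e. \<forall>c\<in>skew_cells l e. T c < M}"

definition schur_lt :: "nat \<Rightarrow> ptn \<Rightarrow> ptn \<Rightarrow> (nat \<Rightarrow> complex) \<Rightarrow> complex" where
  "schur_lt M l e x = (if e \<le> l then \<Sum>T\<in>ssyt_lt M l e. \<Prod>c\<in>skew_cells l e. x (T c) else 0)"

lemma finite_skew_cells: "l \<in> partitions \<Longrightarrow> finite (skew_cells l e)"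
  by (rule finite_subset[OF _ finite_cells]) (auto simp: skew_cells_def cells_def)

lemma card_skew_cells:
  assumes "l \<in> partitions" "e \<in> partitions" "e \<le> l"
  shows "card (skew_cells l e) = psize l - psize e"
proof -
  have "cells e \<subseteq> cells l" using assms(3) by (auto simp: cells_def le_fun_def intro: less_le_trans)
  moreover have "skew_cells l e = cells l - cells e" by (auto simp: cells_def skew_cells_def)
  ultimately show ?thesis
    using card_Diff_subset[OF finite_cells[OF assms(2)], of "cells l"] by (simp add: card_cells assms)
qed

lemma ssyt_outD: "T \<in> ssyt l e \<Longrightarrow> c \<notin> skew_cells l e \<Longrightarrow> T c = 0"
  unfolding ssyt_def by blast

lemma inj_restrict_ssyt: "inj_on (\<lambda>T. restrict T (skew_cells l e)) (ssyt l e)"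
proof (rule inj_onI)
  fix T T' assume T: "T \<in> ssyt l e" "T' \<in> ssyt l e" "restrict T (skew_cells l e) = restrict T' (skew_cells l e)"
  show "T = T'"
  proof
    fix c show "T c = T' c"
    proof (cases "c \<in> skew_cells l e")
      case True
      then show ?thesis using fun_cong[OF T(3), of c] by simp
    next
      case False
      then show ?thesis using ssyt_outD[OF T(1)] ssyt_outD[OF T(2)] by simp
    qed
  qed
qed

lemma restrict_ssyt_lt:
  "(\<lambda>T. restrict T (skew_cells l e)) ` ssyt_lt M l e \<subseteq> PiE (skew_cells l e) (\<lambda>_. {..<M})"
  by (auto simp: ssyt_lt_def)

lemma inj_restrict_ssyt_lt: "inj_on (\<lambda>T. restrict T (skew_cells l e)) (ssyt_lt M l e)"
  by (rule inj_on_subset[OF inj_restrict_ssyt]) (auto simp: ssyt_lt_def)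

lemma finite_ssyt_lt: "l \<in> partitions \<Longrightarrow> finite (ssyt_lt M l e)"
  by (rule finite_imageD[OF finite_subset[OF restrict_ssyt_lt] inj_restrict_ssyt_lt])
     (auto intro: finite_PiE finite_skew_cells)

lemma ssyt_lt_0: assumes "e \<le> l" shows "ssyt_lt 0 l e = (if e = l then {\<lambda>_. 0} else {})"
proof (cases "e = l")
  case True
  then have "skew_cells l e = {}" by (auto simp: skew_cells_def)
  then show ?thesis using True by (auto simp: ssyt_lt_def ssyt_def)
next
  case False
  then obtain i where "e i \<noteq> l i" by auto
  then have "(i, e i) \<in> skew_cells l e" using assms by (auto simp: skew_cells_def le_fun_def le_neq_implies_less)
  then show ?thesis using False by (auto simp: ssyt_lt_def)
qed

lemma schur_lt_0: "schur_lt 0 l e x = (if l = e then 1 else 0)"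
proof (cases "l = e")
  case True
  then have "skew_cells l e = {}" by (auto simp: skew_cells_def)
  then show ?thesis using True by (simp add: schur_lt_def ssyt_lt_0)
qed (auto simp: schur_lt_def ssyt_lt_0)

definition interm :: "ptn \<Rightarrow> ptn \<Rightarrow> ptn set" where
  "interm l e = {k \<in> partitions. e \<le> k \<and> k \<le> l \<and> (\<forall>i. l (Suc i) \<le> k i)}"

lemma inj_cells: "inj cells"
proof (rule injI)
  fix k k' assume "cells k = cells k'"
  then have "j < k i \<longleftrightarrow> j < k' i" for i j by (auto simp: cells_def set_eq_iff)
  from this[of "k i" i for i] this[of "k' i" i for i] show "k = k'"
    by (intro ext) (metis less_irrefl linorder_neqE_nat)
qed

lemma finite_interm: assumes "l \<in> partitions" shows "finite (interm l e)"
proof (rule finite_imageD)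
  have "cells ` interm l e \<subseteq> Pow (cells l)"
    by (auto simp: interm_def cells_def le_fun_def intro: less_le_trans)
  then show "finite (cells ` interm l e)" using finite_cells[OF assms] by (auto intro: finite_subset)
qed (rule inj_on_subset[OF inj_cells], simp)

text \<open>The cells of a tableau with entries smaller than \<open>M\<close>, together with \<open>e\<close>, form a partition;
  the cells with entry \<open>M\<close> form a horizontal strip.\<close>

definition below :: "nat \<Rightarrow> ptn \<Rightarrow> ptn \<Rightarrow> (nat \<times> nat \<Rightarrow> nat) \<Rightarrow> ptn" where
  "below M l e T i = card {j. j < l i \<and> (j < e i \<or> T (i, j) < M)}"

definition extend :: "nat \<Rightarrow> ptn \<Rightarrow> ptn \<Rightarrow> (nat \<times> nat \<Rightarrow> nat) \<Rightarrow> nat \<times> nat \<Rightarrow> nat" where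
  "extend M l k T c = (if c \<in> skew_cells l k then M else T c)"

lemma ssyt_rowD: "T \<in> ssyt l e \<Longrightarrow> (i, j) \<in> skew_cells l e \<Longrightarrow> (i, j') \<in> skew_cells l e \<Longrightarrow> j \<le> j' \<Longrightarrow> T (i, j) \<le> T (i, j')"
  unfolding ssyt_def by (cases "j = j'") auto

lemma ssyt_colD: "T \<in> ssyt l e \<Longrightarrow> (i, j) \<in> skew_cells l e \<Longrightarrow> (i', j) \<in> skew_cells l e \<Longrightarrow> i < i' \<Longrightarrow> T (i, j) < T (i', j)"
  unfolding ssyt_def by blast

lemma ssytI:
  assumes "\<And>c. c \<notin> skew_cells l e \<Longrightarrow> T c = 0"
    and "\<And>i j j'. (i, j) \<in> skew_cells l e \<Longrightarrow> (i, j') \<in> skew_cells l e \<Longrightarrow> j < j' \<Longrightarrow> T (i, j) \<le> T (i, j')"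
    and "\<And>i i' j. (i, j) \<in> skew_cells l e \<Longrightarrow> (i', j) \<in> skew_cells l e \<Longrightarrow> i < i' \<Longrightarrow> T (i, j) < T (i', j)"
  shows "T \<in> ssyt l e"
  unfolding ssyt_def using assms by blast

lemma skew_cells_iff: "(i, j) \<in> skew_cells l e \<longleftrightarrow> e i \<le> j \<and> j < l i"
  by (simp add: skew_cells_def)

lemma below_less:
  assumes T: "T \<in> ssyt l e"
  shows "j < below M l e T i \<longleftrightarrow> j < l i \<and> (j < e i \<or> T (i, j) < M)"
proof -
  have "{j. j < l i \<and> (j < e i \<or> T (i, j) < M)} = {..<below M l e T i}" unfolding below_def
  proof (rule finite_downset)
    show "finite {j. j < l i \<and> (j < e i \<or> T (i, j) < M)}"
      by (rule finite_subset[of _ "{..<l i}"]) auto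
    fix j' j assume j: "j \<in> {j. j < l i \<and> (j < e i \<or> T (i, j) < M)}" "j' \<le> j"
    show "j' \<in> {j. j < l i \<and> (j < e i \<or> T (i, j) < M)}"
    proof (cases "j' < e i")
      case False
      then have "T (i, j') \<le> T (i, j)" using j by (intro ssyt_rowD[OF T]) (auto simp: skew_cells_iff)
      then show ?thesis using j False by auto
    qed (use j in auto)
  qed
  then show ?thesis by auto
qed

lemma le_by_less: "(\<And>j. j < a \<Longrightarrow> j < b) \<Longrightarrow> a \<le> (b::nat)"
  by (metis less_irrefl not_le)

lemma below_interm:
  assumes l: "l \<in> partitions" and e: "e \<in> partitions" and el: "e \<le> l" and T: "T \<in> ssyt_lt (Suc M) l e"
  shows "below M l e T \<in> interm l e"
proof -
  have T': "T \<in> ssyt l e" and TM: "\<And>c. c \<in> skew_cells l e \<Longrightarrow> T c < Suc M" using T by (auto simp: ssyt_lt_def)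
  note bl = below_less[OF T', of _ M]
  have eb: "e i \<le> below M l e T i" for i
    by (rule le_by_less) (use bl el in \<open>auto simp: le_fun_def intro: less_le_trans\<close>)
  have lb: "below M l e T i \<le> l i" for i by (rule le_by_less) (use bl in auto)
  have sb: "l (Suc i) \<le> below M l e T i" for i
  proof (rule le_by_less)
    fix j assume j: "j < l (Suc i)"
    have jl: "j < l i" using j ptn_antimono[OF l, of i "Suc i"] by simp
    show "j < below M l e T i"
    proof (rule ccontr)
      assume "\<not> ?thesis"
      then have n: "e i \<le> j" "M \<le> T (i, j)" using bl[of j i] jl by auto
      have "e (Suc i) \<le> j" using n ptn_antimono[OF e, of i "Suc i"] by simp
      then have c: "(Suc i, j) \<in> skew_cells l e" "(i, j) \<in> skew_cells l e" using j jl n by (auto simp: skew_cells_iff)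
      have "T (i, j) < T (Suc i, j)" using ssyt_colD[OF T' c(2,1)] by simp
      then show False using TM[OF c(1)] n by simp
    qed
  qed
  obtain L where L: "\<And>i. i \<ge> L \<Longrightarrow> l i = 0" using ptn_vanish[OF l] by blast
  have "below M l e T \<in> partitions"
  proof (rule ptnI[where L = L])
    fix i j :: nat assume "i \<le> j"
    then show "below M l e T j \<le> below M l e T i"
      by (rule lift_Suc_antimono_le[rotated]) (rule order_trans[OF lb sb])
  next
    fix i assume "L \<le> i"
    then show "below M l e T i = 0" using lb[of i] L[of i] by simp
  qed
  then show ?thesis unfolding interm_def le_fun_def using eb lb sb by blast
qed

lemma extend_ssyt:
  assumes l: "l \<in> partitions" and k: "k \<in> interm l e" and T: "T \<in> ssyt_lt M k e"
  shows "extend M l k T \<in> ssyt_lt (Suc M) l e"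
proof -
  have kp: "k \<in> partitions" and ek: "\<And>i. e i \<le> k i" and kl: "\<And>i. k i \<le> l i" and s: "\<And>i. l (Suc i) \<le> k i"
    using k by (auto simp: interm_def le_fun_def)
  have T': "T \<in> ssyt k e" and TM: "\<And>c. c \<in> skew_cells k e \<Longrightarrow> T c < M" using T by (auto simp: ssyt_lt_def)
  have E1: "extend M l k T (i, j) = M" if "k i \<le> j" "j < l i" for i j
    using that by (simp add: extend_def skew_cells_iff)
  have E2: "extend M l k T (i, j) = T (i, j)" if "j < k i" for i j
    using that by (simp add: extend_def skew_cells_iff)
  have E3: "T (i, j) < M" if "j < k i" "e i \<le> j" for i j
    using TM that by (simp add: skew_cells_iff)
  have Ele: "extend M l k T (i, j) \<le> M" if "j < l i" "e i \<le> j" for i j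
    using E1[of i j] E2[of j i] E3[of j i] that by (cases "j < k i") auto
  have "extend M l k T \<in> ssyt l e"
  proof (rule ssytI)
    fix c assume "c \<notin> skew_cells l e"
    obtain i j where c: "c = (i, j)" by (cases c)
    have "c \<notin> skew_cells l k" "c \<notin> skew_cells k e"
      using \<open>c \<notin> skew_cells l e\<close> ek[of i] kl[of i] unfolding c skew_cells_iff by auto
    then show "extend M l k T c = 0" using ssyt_outD[OF T'] by (simp add: extend_def)
  next
    fix i j j' assume c: "(i, j) \<in> skew_cells l e" "(i, j') \<in> skew_cells l e" "j < j'"
    show "extend M l k T (i, j) \<le> extend M l k T (i, j')"
    proof (cases "j' < k i")
      case True
      then have "T (i, j) \<le> T (i, j')" using c by (intro ssyt_rowD[OF T']) (auto simp: skew_cells_iff)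
      then show ?thesis using E2 True c(3) by simp
    next
      case False
      then show ?thesis using E1[of i j'] Ele[of j i] c by (auto simp: skew_cells_iff)
    qed
  next
    fix i i' j assume c: "(i, j) \<in> skew_cells l e" "(i', j) \<in> skew_cells l e" "i < i'"
    have "l i' \<le> l (Suc i)" using c(3) by (intro ptn_antimono[OF l]) simp
    then have ji: "j < k i" using c(2) s[of i] by (simp add: skew_cells_iff)
    show "extend M l k T (i, j) < extend M l k T (i', j)"
    proof (cases "j < k i'")
      case True
      then have "T (i, j) < T (i', j)" using c ji by (intro ssyt_colD[OF T']) (auto simp: skew_cells_iff)
      then show ?thesis using E2 True ji by simp
    next
      case False
      then have "extend M l k T (i', j) = M" using E1 c(2) by (simp add: skew_cells_iff)
      then show ?thesis using E2[OF ji] E3[OF ji] c(1) by (simp add: skew_cells_iff)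
    qed
  qed
  moreover have "extend M l k T c < Suc M" if "c \<in> skew_cells l e" for c
    using Ele that by (cases c) (auto simp: skew_cells_iff less_Suc_eq_le)
  ultimately show ?thesis by (simp add: ssyt_lt_def)
qed

lemma below_extend:
  assumes k: "k \<in> interm l e" and T: "T \<in> ssyt_lt M k e"
  shows "below M l e (extend M l k T) = k"
proof
  fix i
  have ek: "e i \<le> k i" and kl: "k i \<le> l i" using k by (auto simp: interm_def le_fun_def)
  have TM: "T (i, j) < M" if "e i \<le> j" "j < k i" for j
    using T that by (auto simp: ssyt_lt_def skew_cells_iff)
  have "{j. j < l i \<and> (j < e i \<or> extend M l k T (i, j) < M)} = {..<k i}"
  proof (intro set_eqI iffI)
    fix j assume "j \<in> {j. j < l i \<and> (j < e i \<or> extend M l k T (i, j) < M)}"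
    then show "j \<in> {..<k i}" using ek by (auto simp: extend_def skew_cells_iff split: if_splits)
  next
    fix j assume "j \<in> {..<k i}"
    then show "j \<in> {j. j < l i \<and> (j < e i \<or> extend M l k T (i, j) < M)}"
      using kl TM[of j] by (cases "j < e i") (auto simp: extend_def skew_cells_iff)
  qed
  then show "below M l e (extend M l k T) i = k i" by (simp add: below_def)
qed

lemma schur_lt_Suc:
  assumes l: "l \<in> partitions" and e: "e \<in> partitions" and el: "e \<le> l"
  shows "schur_lt (Suc M) l e x = (\<Sum>k\<in>interm l e. x M ^ (psize l - psize k) * schur_lt M k e x)"
proof -
  let ?w = "\<lambda>l e T. \<Prod>c\<in>skew_cells l e. x (T c)"
  \<comment> \<open>Tableaux take the value 0 off their shape, so restricting to the smaller shape
    has to erase the entries M.\<close>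
  define res where "res T = (\<lambda>c. if c \<in> skew_cells (below M l e T) e then T c else 0)" for T :: "nat \<times> nat \<Rightarrow> nat"
  have "(\<Sum>p\<in>(SIGMA k:interm l e. ssyt_lt M k e). x M ^ (psize l - psize (fst p)) * ?w (fst p) e (snd p))
      = (\<Sum>T\<in>ssyt_lt (Suc M) l e. ?w l e T)"
  proof (rule sum.reindex_bij_witness[of _ "\<lambda>T. (below M l e T, res T)" "\<lambda>(k, T). extend M l k T"])
    fix p assume "p \<in> (SIGMA k:interm l e. ssyt_lt M k e)"
    then obtain k T where p: "p = (k, T)" and k: "k \<in> interm l e" and T: "T \<in> ssyt_lt M k e" by blast
    have kp: "k \<in> partitions" and ek: "e \<le> k" and kl: "k \<le> l" using k by (auto simp: interm_def)
    have "res (extend M l k T) = T"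
    proof
      fix c show "res (extend M l k T) c = T c"
      proof (cases "c \<in> skew_cells k e")
        case True
        then have "c \<notin> skew_cells l k" by (cases c) (auto simp: skew_cells_iff)
        then show ?thesis using True by (simp add: res_def below_extend[OF k T] extend_def)
      next
        case False
        have "T \<in> ssyt k e" using T by (simp add: ssyt_lt_def)
        then have "T c = 0" using False by (rule ssyt_outD)
        then show ?thesis using False by (simp add: res_def below_extend[OF k T])
      qed
    qed
    then show "(\<lambda>T. (below M l e T, res T)) (case p of (k, T) \<Rightarrow> extend M l k T) = p"
      by (simp add: p below_extend[OF k T])
    show "(case p of (k, T) \<Rightarrow> extend M l k T) \<in> ssyt_lt (Suc M) l e"
      using extend_ssyt[OF l k T] by (simp add: p)
    have "skew_cells l e = skew_cells l k \<union> skew_cells k e"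
    proof (rule set_eqI)
      fix c show "c \<in> skew_cells l e \<longleftrightarrow> c \<in> skew_cells l k \<union> skew_cells k e"
        using le_funD[OF ek] le_funD[OF kl] by (cases c) (auto simp: skew_cells_iff intro: order_trans less_le_trans)
    qed
    moreover have "skew_cells l k \<inter> skew_cells k e = {}" by (auto simp: skew_cells_def)
    ultimately have "?w l e (extend M l k T)
        = (\<Prod>c\<in>skew_cells l k. x (extend M l k T c)) * (\<Prod>c\<in>skew_cells k e. x (extend M l k T c))"
      using prod.union_disjoint[OF finite_skew_cells[OF l] finite_skew_cells[OF kp]] by simp
    also have "(\<Prod>c\<in>skew_cells l k. x (extend M l k T c)) = x M ^ (psize l - psize k)"
      by (simp add: extend_def card_skew_cells[OF l kp kl])
    also have "(\<Prod>c\<in>skew_cells k e. x (extend M l k T c)) = ?w k e T"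
      by (rule prod.cong) (auto simp: extend_def skew_cells_def)
    finally show "?w l e (case p of (k, T) \<Rightarrow> extend M l k T) = x M ^ (psize l - psize (fst p)) * ?w (fst p) e (snd p)"
      by (simp add: p)
  next
    fix T assume T: "T \<in> ssyt_lt (Suc M) l e"
    have T': "T \<in> ssyt l e" and TM: "\<And>c. c \<in> skew_cells l e \<Longrightarrow> T c < Suc M" using T by (auto simp: ssyt_lt_def)
    let ?k = "below M l e T"
    have k: "?k \<in> interm l e" by (rule below_interm[OF l e el T])
    have kl: "?k \<le> l" and ek: "e \<le> ?k" using k by (auto simp: interm_def)
    have sub: "c \<in> skew_cells l e" "T c < M" if "c \<in> skew_cells ?k e" for c
      using that below_less[OF T', of _ M] le_funD[OF kl] by (cases c; auto simp: skew_cells_iff intro: less_le_trans)+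
    have "res T \<in> ssyt ?k e"
    proof (rule ssytI)
      fix i j j' assume "(i, j) \<in> skew_cells ?k e" "(i, j') \<in> skew_cells ?k e" "j < j'"
      then show "res T (i, j) \<le> res T (i, j')"
        using ssyt_rowD[OF T' sub(1) sub(1), of i j j'] by (simp add: res_def)
    next
      fix i i' j assume "(i, j) \<in> skew_cells ?k e" "(i', j) \<in> skew_cells ?k e" "i < i'"
      then show "res T (i, j) < res T (i', j)"
        using ssyt_colD[OF T' sub(1) sub(1), of i j i'] by (simp add: res_def)
    qed (simp add: res_def)
    then have "res T \<in> ssyt_lt M ?k e" using sub(2) by (simp add: ssyt_lt_def res_def)
    then show "(below M l e T, res T) \<in> (SIGMA k:interm l e. ssyt_lt M k e)" using k by simp
    have "extend M l ?k (res T) c = T c" for c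
    proof (cases "c \<in> skew_cells l ?k")
      case True
      obtain i j where c: "c = (i, j)" by (cases c)
      have "e i \<le> j" "j < l i" using True le_funD[OF ek, of i] by (auto simp: c skew_cells_iff)
      then have "T c < Suc M" "\<not> T c < M"
        using TM[of c] True below_less[OF T', of j M i] by (auto simp: c skew_cells_iff)
      then show ?thesis using True by (simp add: extend_def)
    next
      case False
      show ?thesis
      proof (cases "c \<in> skew_cells ?k e")
        case True
        then show ?thesis using False by (simp add: extend_def res_def)
      next
        case F: False
        have "c \<notin> skew_cells l e" using False F by (cases c) (auto simp: skew_cells_iff)
        then show ?thesis using False F ssyt_outD[OF T'] by (simp add: extend_def res_def)
      qed
    qed
    then show "(case (below M l e T, res T) of (k, T) \<Rightarrow> extend M l k T) = T" by auto
  qed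
  also have "(\<Sum>p\<in>(SIGMA k:interm l e. ssyt_lt M k e). x M ^ (psize l - psize (fst p)) * ?w (fst p) e (snd p))
      = (\<Sum>k\<in>interm l e. \<Sum>T\<in>ssyt_lt M k e. x M ^ (psize l - psize k) * ?w k e T)"
    using finite_interm[OF l] finite_ssyt_lt by (subst sum.Sigma) (auto simp: interm_def case_prod_unfold)
  also have "\<dots> = (\<Sum>k\<in>interm l e. x M ^ (psize l - psize k) * schur_lt M k e x)"
    by (intro sum.cong refl) (auto simp: schur_lt_def interm_def sum_distrib_left)
  finally show ?thesis using el by (simp add: schur_lt_def)
qed

lemma schur_lt_half_vertex:
  assumes e: "e \<in> partitions" and l: "l \<in> partitions"
  shows "schur_lt M l e x = half_vertex (\<lambda>n. (- 1) ^ n * (\<Sum>i<M. x i ^ n)) (bas (maya_of e)) (maya_of l)"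
  using l
proof (induction M arbitrary: l)
  case 0
  have "half_vertex (\<lambda>n. (- 1) ^ n * (\<Sum>i<0. x i ^ n)) (bas (maya_of e)) (maya_of l) = bas (maya_of e) (maya_of l)"
    by (rule half_vertex_unique) (auto simp: ser_def bas_def neutral_mp 0)
  moreover have "maya_of l = maya_of e \<longleftrightarrow> l = e" using inj_onD[OF inj_mp _ 0 e] by blast
  ultimately show ?case by (simp add: schur_lt_0 bas_def)
next
  case (Suc M)
  let ?a = "\<lambda>n. (- 1) ^ n * x M ^ n" and ?b = "\<lambda>n. (- 1) ^ n * (\<Sum>i<M. x i ^ n)"
  let ?f = "\<lambda>k. (if strip k (maya_of l) then x M ^ (psize l - psize k) else 0) * schur_lt M k e x"
  have "(\<lambda>n. (- 1) ^ n * (\<Sum>i<Suc M. x i ^ n)) = (\<lambda>n. ?a n + ?b n)"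
    by (auto simp: algebra_simps)
  then have "half_vertex (\<lambda>n. (- 1) ^ n * (\<Sum>i<Suc M. x i ^ n)) (bas (maya_of e)) (maya_of l) = half_vertex ?a (half_vertex ?b (bas (maya_of e))) (maya_of l)"
    by (simp only: half_vertex_add)
  also have "\<dots> = (\<Sum>\<^sub>\<infinity>k\<in>partitions. half_vertex ?a (bas (maya_of k)) (maya_of l) * half_vertex ?b (bas (maya_of e)) (maya_of k))"
    by (rule half_vertex_expand[OF neutral_mp[OF Suc.prems]])
  also have "\<dots> = (\<Sum>\<^sub>\<infinity>k\<in>partitions. ?f k)"
    by (rule infsum_cong) (simp add: half_vertex_strip Suc)
  also have "\<dots> = schur_lt (Suc M) l e x"
  proof (cases "e \<le> l")
    case True
    have "(\<Sum>\<^sub>\<infinity>k\<in>partitions. ?f k) = (\<Sum>\<^sub>\<infinity>k\<in>interm l e. ?f k)"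
    proof (rule infsum_cong_neutral)
      fix k assume k: "k \<in> partitions - interm l e"
      show "?f k = 0"
      proof (rule ccontr)
        assume "?f k \<noteq> 0"
        then have "strip k (maya_of l)" "schur_lt M k e x \<noteq> 0" by (auto split: if_splits)
        then have "\<forall>i. k i \<le> l i \<and> l (Suc i) \<le> k i" "e \<le> k"
          using strip_mp[OF Suc.prems] k by (auto simp: schur_lt_def split: if_splits)
        then show False using k by (auto simp: interm_def le_fun_def)
      qed
    qed (auto simp: interm_def)
    also have "\<dots> = (\<Sum>k\<in>interm l e. ?f k)" using finite_interm[OF Suc.prems] by simp
    also have "\<dots> = (\<Sum>k\<in>interm l e. x M ^ (psize l - psize k) * schur_lt M k e x)"
      by (rule sum.cong) (use strip_mp[OF Suc.prems] in \<open>auto simp: interm_def le_fun_def\<close>)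
    finally show ?thesis using schur_lt_Suc[OF Suc.prems e True] by simp
  next
    case False
    \<comment> \<open>The strip gives k \<le> l and the Schur factor gives e \<le> k, so no
      intermediate k exists and both sides vanish.\<close>
    have "?f k = 0" if k: "k \<in> partitions" for k
    proof (rule ccontr)
      assume "?f k \<noteq> 0"
      then have "strip k (maya_of l)" "schur_lt M k e x \<noteq> 0" by (auto split: if_splits)
      then have "\<forall>i. k i \<le> l i" "e \<le> k"
        using strip_mp[OF Suc.prems k] by (auto simp: schur_lt_def split: if_splits)
      then have "e \<le> l" by (meson le_fun_def order_trans)
      then show False using False by simp
    qed
    then have "(\<Sum>\<^sub>\<infinity>k\<in>partitions. ?f k) = 0" by (intro infsum_0) auto
    then show ?thesis using False by (simp add: schur_lt_def)
  qed
  finally show ?case by simp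
qed

text \<open>Forgetting the tableau conditions bounds every finite partial sum of norms by the
  product over the cells of the sum of all |x_i|, so the series converges absolutely. The tableaux
  with entries below M exhaust all tableaux, which turns the unordered sum into a limit over
  M.\<close>

lemma schur_lt_tendsto:
  assumes l: "l \<in> partitions" and x: "summable (\<lambda>i. norm (x i))"
  shows "(\<lambda>M. schur_lt M l e x) \<longlonglongrightarrow> skew_schur l e x"
proof (cases "e \<le> l")
  case True
  let ?f = "\<lambda>T. \<Prod>c\<in>skew_cells l e. x (T c)"
  let ?D = "skew_cells l e"
  have ex: "\<exists>M. F \<subseteq> ssyt_lt M l e" if "finite F" "F \<subseteq> ssyt l e" for F
  proof -
    have "finite (\<Union>T\<in>F. T ` ?D)" using that finite_skew_cells[OF l] by auto
    then obtain M where "\<forall>n\<in>(\<Union>T\<in>F. T ` ?D). n < M" using finite_nat_set_iff_bounded by blast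
    then show ?thesis using that by (intro exI[of _ M]) (auto simp: ssyt_lt_def)
  qed
  have mono: "ssyt_lt M l e \<subseteq> ssyt_lt M' l e" if "M \<le> M'" for M M'
    using that by (auto simp: ssyt_lt_def)
  have "(\<lambda>T. norm (?f T)) summable_on ssyt l e"
  proof (rule nonneg_bdd_above_summable_on)
    show "bdd_above (sum (\<lambda>T. norm (?f T)) ` {F. F \<subseteq> ssyt l e \<and> finite F})"
    proof (rule bdd_aboveI2)
      fix F assume "F \<in> {F. F \<subseteq> ssyt l e \<and> finite F}"
      then obtain M where M: "F \<subseteq> ssyt_lt M l e" using ex[of F] by auto
      have "sum (\<lambda>T. norm (?f T)) F \<le> (\<Sum>T\<in>ssyt_lt M l e. norm (?f T))"
        by (rule sum_mono2[OF finite_ssyt_lt[OF l] M]) simp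
      also have "\<dots> = (\<Sum>T\<in>ssyt_lt M l e. \<Prod>c\<in>?D. norm (x (restrict T ?D c)))"
        by (simp add: prod_norm[symmetric])
      also have "\<dots> = (\<Sum>T\<in>(\<lambda>T. restrict T ?D) ` ssyt_lt M l e. \<Prod>c\<in>?D. norm (x (T c)))"
        by (rule sum.reindex[OF inj_restrict_ssyt_lt, unfolded comp_def, symmetric])
      also have "\<dots> \<le> (\<Sum>T\<in>PiE ?D (\<lambda>_. {..<M}). \<Prod>c\<in>?D. norm (x (T c)))"
        by (rule sum_mono2[OF _ restrict_ssyt_lt]) (auto intro!: finite_PiE finite_skew_cells[OF l] prod_nonneg)
      also have "\<dots> = (\<Prod>c\<in>?D. \<Sum>i<M. norm (x i))"
        by (rule prod_sum_PiE[symmetric]) (auto intro: finite_skew_cells[OF l])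
      also have "\<dots> \<le> (\<Prod>c\<in>?D. \<Sum>i. norm (x i))"
        by (intro prod_mono conjI sum_nonneg sum_le_suminf x) auto
      finally show "sum (\<lambda>T. norm (?f T)) F \<le> (\<Prod>c\<in>?D. \<Sum>i. norm (x i))" .
    qed
  qed simp
  then have "?f summable_on ssyt l e" by (rule Infinite_Sum.abs_summable_summable)
  then have "(?f has_sum infsum ?f (ssyt l e)) (ssyt l e)" by (rule has_sum_infsum)
  then have lim: "(sum ?f \<longlongrightarrow> infsum ?f (ssyt l e)) (finite_subsets_at_top (ssyt l e))"
    by (simp add: has_sum_def)
  have "filterlim (\<lambda>M. ssyt_lt M l e) (finite_subsets_at_top (ssyt l e)) sequentially"
    unfolding filterlim_finite_subsets_at_top
  proof (intro allI impI)
    fix X assume "finite X \<and> X \<subseteq> ssyt l e"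
    then obtain M where M: "X \<subseteq> ssyt_lt M l e" using ex by blast
    show "\<forall>\<^sub>F y in sequentially. finite (ssyt_lt y l e) \<and> X \<subseteq> ssyt_lt y l e \<and> ssyt_lt y l e \<subseteq> ssyt l e"
    proof (rule eventually_sequentiallyI)
      fix y assume "M \<le> y"
      then show "finite (ssyt_lt y l e) \<and> X \<subseteq> ssyt_lt y l e \<and> ssyt_lt y l e \<subseteq> ssyt l e"
        using M mono[of M y] finite_ssyt_lt[OF l] by (auto simp: ssyt_lt_def)
    qed
  qed
  from filterlim_compose[OF lim this] show ?thesis
    using True by (simp add: schur_lt_def[abs_def] skew_schur_def)
qed (simp add: schur_lt_def skew_schur_def)

lemma flin_tendsto:
  assumes "flin f" "\<And>i. (\<lambda>M. g M i) \<longlonglongrightarrow> h i" shows "(\<lambda>M. f (g M)) \<longlonglongrightarrow> f h"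
proof -
  obtain R c where "\<And>v. f v = (\<Sum>i\<in>R. c i * v i)" using assms(1) by (auto simp: flin_def)
  then show ?thesis using assms(2) by (auto intro!: tendsto_intros)
qed

text \<open>At a fixed diagram the exponential is a polynomial in finitely many of the
  coefficients.\<close>

lemma half_vertex_tendsto:
  assumes "\<And>n. n \<ge> 1 \<Longrightarrow> (\<lambda>M. c M n) \<longlonglongrightarrow> d n"
  shows "(\<lambda>M. half_vertex (c M) v S) \<longlonglongrightarrow> half_vertex d v S"
proof -
  have "(\<lambda>M. (vser (\<lambda>n. c M n / of_nat n) ^^ j) v S) \<longlonglongrightarrow> (vser (\<lambda>n. d n / of_nat n) ^^ j) v S" for j S
  proof (induction j arbitrary: S)
    case (Suc j)
    have "(\<lambda>M. c M n / of_nat n * creation n ((vser (\<lambda>n. c M n / of_nat n) ^^ j) v) S)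
        \<longlonglongrightarrow> d n / of_nat n * creation n ((vser (\<lambda>n. d n / of_nat n) ^^ j) v) S" if "n \<in> {1..energy S}" for n
      by (intro tendsto_mult tendsto_divide tendsto_const assms flin_tendsto[OF creation_flin] Suc) (use that in auto)
    moreover have "(vser b ^^ Suc j) v S = (\<Sum>n = 1..energy S. b n * creation n ((vser b ^^ j) v) S)" for b
      by (simp add: ser_def[of energy b creation "(vser b ^^ j) v"])
    ultimately show ?case by (simp only: tendsto_sum)
  qed simp
  then show ?thesis unfolding half_vertex_def op_exp_finite[OF lowering_vser order_refl]
    by (intro tendsto_sum tendsto_divide tendsto_const) auto
qed

lemma summable_norm_power:
  fixes x :: "nat \<Rightarrow> complex"
  assumes "summable (\<lambda>i. norm (x i))" "n \<ge> 1" shows "summable (\<lambda>i. x i ^ n)"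
proof (rule summable_comparison_test_ev[OF _ assms(1)])
  have "(\<lambda>i. norm (x i)) \<longlonglongrightarrow> 0" by (rule summable_LIMSEQ_zero[OF assms(1)])
  then have "\<forall>\<^sub>F i in sequentially. norm (x i) < 1" by (rule order_tendstoD) simp
  then show "\<forall>\<^sub>F i in sequentially. norm (x i ^ n) \<le> norm (x i)"
  proof (rule eventually_mono)
    fix i assume "norm (x i) < 1"
    then show "norm (x i ^ n) \<le> norm (x i)"
      using power_decreasing[OF assms(2), of "norm (x i)"] by (simp add: norm_power)
  qed
qed

lemma skew_schur_half_vertex:
  assumes l: "l \<in> partitions" and e: "e \<in> partitions" and x: "summable (\<lambda>i. norm (x i))"
  shows "skew_schur l e x = half_vertex (\<lambda>n. (- 1) ^ n * (\<Sum>i. x i ^ n)) (bas (maya_of e)) (maya_of l)"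
proof (rule LIMSEQ_unique[OF schur_lt_tendsto[OF l x]])
  show "(\<lambda>M. schur_lt M l e x) \<longlonglongrightarrow> half_vertex (\<lambda>n. (- 1) ^ n * (\<Sum>i. x i ^ n)) (bas (maya_of e)) (maya_of l)"
    unfolding schur_lt_half_vertex[OF e l]
    by (intro half_vertex_tendsto tendsto_mult tendsto_const summable_LIMSEQ summable_norm_power[OF x])
qed

text \<open>Flipping multiplies the n-th coefficient by -(-1)^n, which turns (-1)^n p_n into -p_n.
  This form applies where the exponent has no alternating sign, as in the S-dual ket.\<close>

lemma skew_schur_conj_half_vertex:
  assumes l: "l \<in> partitions" and e: "e \<in> partitions" and x: "summable (\<lambda>i. norm (x i))"
  shows "skew_schur (conjugate l) (conjugate e) x = half_vertex (\<lambda>n. - (\<Sum>i. x i ^ n)) (bas (maya_of e)) (maya_of l)"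
proof -
  have "(\<lambda>n. - ((- 1) ^ n) * ((- 1) ^ n * (\<Sum>i. x i ^ n))) = (\<lambda>n. - (\<Sum>i. x i ^ n))"
    by (simp add: mult.assoc[symmetric] power_mult_distrib[symmetric])
  then show ?thesis
    unfolding skew_schur_half_vertex[OF conj_ptn[OF l] conj_ptn[OF e] x] flip_mp[OF l, symmetric]
      flip_mp[OF e, symmetric] half_vertex_bas_flip by simp
qed

lemma skew_schur_scale:
  assumes l: "l \<in> partitions" and e: "e \<in> partitions"
  shows "skew_schur l e (\<lambda>i. c * x i) = c ^ (psize l - psize e) * skew_schur l e x"
proof (cases "e \<le> l")
  case True
  have "(\<Prod>d\<in>skew_cells l e. c * x (T d)) = c ^ (psize l - psize e) * (\<Prod>d\<in>skew_cells l e. x (T d))" for T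
    by (simp add: prod.distrib card_skew_cells[OF l e True])
  then show ?thesis using True by (simp add: skew_schur_def infsum_cmult_right')
qed (simp add: skew_schur_def)

section \<open>The intertwiners\<close>

text \<open>The factors are exponentials exp(c_n) with |c_n| \<le> (n + 1) |q|^(n+1) for large n, so
  the product is the exponential of a convergent series. The theorem divides by this value.\<close>

lemma norm_vac_nonzero:
  assumes "norm q < 1" shows "norm_vac q \<noteq> 0"
proof -
  define c where "c n = - of_nat (n + 1) / 2 * Ln (1 - q ^ (n + 1))" for n
  have ne: "1 - q ^ (n + 1) \<noteq> 0" for n
  proof
    assume "1 - q ^ (n + 1) = 0"
    then have "norm (q ^ (n + 1)) = 1" by simp
    moreover have "norm q ^ Suc n < 1"
      using mult_left_le[of "norm q ^ n" "norm q"] power_le_one[of "norm q" n] assms by simp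
    ultimately show False by (simp add: norm_power norm_mult)
  qed
  have "summable c"
  proof (rule summable_comparison_test_ev)
    show "summable (\<lambda>n. norm q * (of_nat (Suc n) * norm q ^ n))"
      using geometric_deriv_sums[of "norm q"] assms by (intro summable_mult) (auto simp: sums_iff)
    have "(\<lambda>n. norm q ^ (n + 1)) \<longlonglongrightarrow> 0"
      using LIMSEQ_ignore_initial_segment[OF LIMSEQ_power_zero[of "norm q"], of 1] assms by simp
    then have "\<forall>\<^sub>F n in sequentially. norm q ^ (n + 1) < 1 / 2" by (rule order_tendstoD) simp
    then show "\<forall>\<^sub>F n in sequentially. norm (c n) \<le> norm q * (of_nat (Suc n) * norm q ^ n)"
    proof (rule eventually_mono)
      fix n assume "norm q ^ (n + 1) < 1 / 2"
      then have "norm (Ln (1 + - (q ^ (n + 1)))) \<le> 2 * norm (- (q ^ (n + 1)))"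
        by (intro norm_Ln_le) (simp add: norm_power norm_mult)
      then have "norm (Ln (1 - q ^ (n + 1))) \<le> 2 * norm q ^ (n + 1)"
        by (simp add: norm_power norm_mult)
      then have "(of_nat (n + 1) / 2) * norm (Ln (1 - q ^ (n + 1))) \<le> (of_nat (n + 1) / 2) * (2 * norm q ^ (n + 1))"
        by (intro mult_left_mono) auto
      moreover have "norm (c n) = (of_nat (n + 1) / 2) * norm (Ln (1 - q ^ (n + 1)))"
        unfolding c_def norm_mult norm_divide norm_minus_cancel norm_of_nat by simp
      ultimately show "norm (c n) \<le> norm q * (of_nat (Suc n) * norm q ^ n)"
        by (simp add: algebra_simps)
    qed
  qed
  then have "(\<Prod>n. exp (c n)) = exp (suminf c)" by (rule prodinf_exp)
  moreover have "(1 - q ^ (n + 1)) powr (- of_nat (n + 1) / 2) = exp (c n)" for n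
    unfolding powr_def c_def using ne[of n] by simp
  ultimately show ?thesis by (simp add: norm_vac_def)
qed

section \<open>Eigenvalues as power sums, the S-dual vacua and the two exponentials\<close>

lemma suminf_finite_change:
  fixes f g :: "nat \<Rightarrow> complex"
  assumes "summable g" "\<And>i. i \<ge> L \<Longrightarrow> f i = g i"
  shows "suminf f = suminf g + (\<Sum>i<L. f i - g i)"
proof -
  have "(\<lambda>i. f i - g i) sums (\<Sum>i<L. f i - g i)"
    by (rule sums_finite) (use assms(2) in auto)
  from sums_add[OF summable_sums[OF assms(1)] this] show ?thesis by (simp add: sums_iff)
qed

text \<open>This is q^(1/2) times the sequence q^(-\<lambda>-\<rho>), and \<open>yseq\<close> is
  q^(-1/2) times the one for the conjugate partition. They are integral powers of q, as they occur
  in the eigenvalues of b_n; the extra factors are removed at the end by homogeneity.\<close>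

definition xseq :: "complex \<Rightarrow> ptn \<Rightarrow> nat \<Rightarrow> complex" where
  "xseq q l i = q powi (- hi l i)"

definition yseq :: "complex \<Rightarrow> ptn \<Rightarrow> nat \<Rightarrow> complex" where
  "yseq q l i = q powi (lo l i)"

lemma op_exp_diag:
  assumes "\<And>v i. A v i = c i * v i" shows "op_exp A v i = exp (c i) * v i"
proof -
  have "(A ^^ j) v i = c i ^ j * v i" for j by (induction j) (simp_all add: assms)
  moreover have "(\<lambda>j. c i ^ j * v i / fact j) sums (exp (c i) * v i)"
    using sums_mult2[OF exp_converges[of "c i"], of "v i"] by (simp add: scaleR_conv_of_real field_simps)
  ultimately show ?thesis by (simp add: op_exp_def sums_iff)
qed

lemma op_power_L0:
  assumes q0: "q \<noteq> 0" shows "op_power q L0_op v S = q ^ energy S * v S"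
proof -
  have "op_power q L0_op v S = exp (Ln q * of_nat (energy S)) * v S"
    unfolding op_power_def by (rule op_exp_diag) (simp add: L0_op_eq)
  also have "exp (Ln q * of_nat (energy S)) = q ^ energy S"
    using q0 exp_of_nat_mult[of "energy S" "Ln q"] by (simp add: mult.commute)
  finally show ?thesis .
qed

lemma op_power_L0_minus:
  assumes q0: "q \<noteq> 0" shows "op_power q (\<lambda>v S. - L0_op v S) v S = inverse (q ^ energy S) * v S"
proof -
  have "op_power q (\<lambda>v S. - L0_op v S) v S = exp (- (Ln q * of_nat (energy S))) * v S"
    unfolding op_power_def by (rule op_exp_diag) (simp add: L0_op_eq)
  also have "exp (- (Ln q * of_nat (energy S))) = inverse (q ^ energy S)"
    using q0 exp_of_nat_mult[of "energy S" "Ln q"] by (simp add: mult.commute exp_minus)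
  finally show ?thesis .
qed

text \<open>Each label contributes the square of a half-integer. In charge zero the quarters cancel
  and the eigenvalue is the integer \<open>kappa l\<close>, so that the branch of the logarithm
  drops out; hence the restriction to diagrams of partitions.\<close>

lemma op_power_w:
  assumes q0: "q \<noteq> 0" and l: "l \<in> partitions"
  shows "op_power q (\<lambda>v S. of_int N * w_op v S) v (maya_of l) = q powi (N * kappa l) * v (maya_of l)"
proof -
  let ?c = "\<lambda>S. Ln q * (of_int N * excess (\<lambda>j. (of_int j + 1 / 2)\<^sup>2) S)"
  have e: "excess (\<lambda>j. (of_int j + 1 / 2)\<^sup>2) (maya_of l) = of_int (kappa l)"
    using w_op_mp[OF l, of "\<lambda>_. 1"] by (simp add: w_op_eq)
  have "op_power q (\<lambda>v S. of_int N * w_op v S) v (maya_of l) = exp (?c (maya_of l)) * v (maya_of l)"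
    unfolding op_power_def by (rule op_exp_diag) (simp add: w_op_eq)
  also have "?c (maya_of l) = of_int (N * kappa l) * Ln q" unfolding e by simp
  also have "exp (of_int (N * kappa l) * Ln q) = q powi (N * kappa l)"
    using exp_power_int[of "Ln q" "N * kappa l"] q0 by simp
  finally show ?thesis .
qed

text \<open>The one-copy analogue of \<open>transpose_E2\<close>, for the annihilators in the S-dual
  bra: the start T and the final S exchange roles, and a half vertex operator remains.\<close>

lemma transpose_half_vertex:
  fixes c :: "nat \<Rightarrow> complex"
  defines "A \<equiv> \<lambda>v S. \<Sum>\<^sub>\<infinity>n\<in>{1::nat..}. a_op (int n) v S / of_nat n * c n"
  shows "op_exp A (\<lambda>S. k * bas T S) S = k * half_vertex c (bas S) T"
proof -
  let ?J = "vser (\<lambda>n. c n / of_nat n)"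
  have "(A ^^ j) (\<lambda>S. k * bas T S) S = k * (?J ^^ j) (bas S) T" for j S
  proof (induction j arbitrary: S)
    case 0
    then show ?case by (simp add: bas_def)
  next
    case (Suc j)
    define g where "g v = (?J ^^ j) v T" for v
    have fg: "flin g" unfolding g_def by (rule lowering_flin_pow[OF lowering_vser])
    have "(A ^^ j) (\<lambda>S. k * bas T S) = (\<lambda>S. k * g (bas S))" using Suc by (simp add: g_def fun_eq_iff)
    then have "(A ^^ Suc j) (\<lambda>S. k * bas T S) S = (\<Sum>\<^sub>\<infinity>n\<in>{1::nat..}. a_op (int n) (\<lambda>S. k * g (bas S)) S / of_nat n * c n)"
      by (simp add: A_def)
    also have "\<dots> = (\<Sum>\<^sub>\<infinity>n\<in>{1::nat..}. k * (c n / of_nat n * creation n ((?J ^^ j) (bas S)) T))"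
    proof (rule infsum_cong)
      fix n :: nat assume "n \<in> {1..}"
      then have n: "n \<ge> 1" by simp
      have "a_op (int n) (\<lambda>S. k * g (bas S)) S = k * a_op (int n) (\<lambda>S. g (bas S)) S"
        by (rule flin_scale[OF a_op_flin]) (use n in simp)
      also have "a_op (int n) (\<lambda>S. g (bas S)) S = g (creation n (bas S))" by (rule a_op_flin_transpose[OF n fg])
      also have "g (creation n (bas S)) = creation n ((?J ^^ j) (bas S)) T"
      proof -
        have "?J (creation n v) = creation n (?J v)" for v
          by (rule ser_commute1[OF modes_creation modesD(1)[OF modes_creation n]]) (use n in \<open>simp add: creation_commute\<close>)
        then show ?thesis unfolding g_def using pow_commute[of ?J "creation n" j "bas S"] by simp
      qed
      finally show "a_op (int n) (\<lambda>S. k * g (bas S)) S / of_nat n * c n = k * (c n / of_nat n * creation n ((?J ^^ j) (bas S)) T)"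
        by simp
    qed
    also have "\<dots> = k * (\<Sum>\<^sub>\<infinity>n\<in>{1::nat..}. c n / of_nat n * creation n ((?J ^^ j) (bas S)) T)" by (rule infsum_cmult_right')
    also have "\<dots> = k * (?J ^^ Suc j) (bas S) T" by (simp only: ser_infsum[OF modes_creation] funpow.simps comp_def)
    finally show ?case .
  qed
  then have "op_exp A (\<lambda>S. k * bas T S) S = (\<Sum>j. k * ((?J ^^ j) (bas S) T / fact j))"
    unfolding op_exp_def by simp
  also have "\<dots> = (\<Sum>j\<le>energy T. k * ((?J ^^ j) (bas S) T / fact j))"
    by (rule suminf_finite) (use lowering_pow_zero[OF lowering_vser] in auto)
  also have "\<dots> = k * half_vertex c (bas S) T"
    unfolding half_vertex_def op_exp_finite[OF lowering_vser order_refl] by (simp add: sum_distrib_left)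
  finally show ?thesis .
qed

context
  fixes q :: complex
  assumes q0: "q \<noteq> 0" and q1: "norm q < 1"
begin

lemma qpow1: "n \<ge> 1 \<Longrightarrow> norm (q ^ n) < 1"
  using power_Suc_less_one[of "norm q" "n - 1"] q1 q0 by (simp add: norm_power)

lemma summable_xseq: assumes "l \<in> partitions" shows "summable (\<lambda>i. norm (xseq q l i))"
proof -
  obtain L where L: "\<And>i. i \<ge> L \<Longrightarrow> l i = 0" using ptn_vanish[OF assms] by blast
  have "\<forall>\<^sub>F i in sequentially. norm (xseq q l i) = norm q * norm q ^ i"
  proof (rule eventually_sequentiallyI)
    fix i assume "L \<le> i"
    then have "- hi l i = int (Suc i)" using L[of i] by simp
    then show "norm (xseq q l i) = norm q * norm q ^ i"
      unfolding xseq_def by (simp add: power_int_def norm_power norm_mult nat_add_distrib)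
  qed
  then have "summable (\<lambda>i. norm (xseq q l i)) = summable (\<lambda>i. norm q * norm q ^ i)" by (rule summable_cong)
  then show ?thesis using q1 by (simp add: summable_mult summable_geometric)
qed

lemma summable_yseq: assumes "l \<in> partitions" shows "summable (\<lambda>i. norm (yseq q l i))"
proof -
  obtain L where L: "\<And>i. i \<ge> L \<Longrightarrow> conjugate l i = 0" using ptn_vanish[OF conj_ptn[OF assms]] by blast
  have "\<forall>\<^sub>F i in sequentially. norm (yseq q l i) = norm q ^ i"
  proof (rule eventually_sequentiallyI)
    fix i assume "L \<le> i"
    then have "lo l i = int i" using L[of i] by simp
    then show "norm (yseq q l i) = norm q ^ i" unfolding yseq_def by (simp add: norm_power)
  qed
  then have "summable (\<lambda>i. norm (yseq q l i)) = summable (\<lambda>i. norm q ^ i)" by (rule summable_cong)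
  then show ?thesis using q1 by (simp add: summable_geometric)
qed

text \<open>The constant in b_n is minus the geometric series of the vacuum sequence q^(i+1). It
  cancels the vacuum part that \<open>excess\<close> subtracts, so that the full power sum over the
  rows remains.\<close>

lemma b_op_pos:
  assumes l: "l \<in> partitions" and n: "n \<ge> 1"
  shows "b_op q (int n) v (maya_of l) = - (\<Sum>i. xseq q l i ^ n) * v (maya_of l)"
proof -
  obtain L where L: "\<And>i. i \<ge> L \<Longrightarrow> l i = 0" using ptn_vanish[OF l] by blast
  let ?g = "\<lambda>i. (q ^ n) * (q ^ n) ^ i"
  have geo: "?g sums (q ^ n * (1 / (1 - q ^ n)))"
    by (intro sums_mult geometric_sums qpow1 n)
  have gq: "q powi (- int n * (- int i - 1)) = ?g i" for i
  proof -
    have "- int n * (- int i - 1) = int (n + n * i)" by (simp add: algebra_simps)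
    then show ?thesis by (simp only: power_int_of_nat) (simp add: power_add power_mult)
  qed
  have xq: "q powi (- int n * hi l i) = xseq q l i ^ n" for i
  proof -
    have "- int n * hi l i = - hi l i * int n" by (simp add: algebra_simps)
    then show ?thesis by (simp only: power_int_mult power_int_of_nat xseq_def)
  qed
  have eq: "xseq q l i ^ n = ?g i" if "i \<ge> L" for i
    using xq[of i] gq[of i] L[OF that] by simp
  have "excess f (maya_of l) = (\<Sum>i<L. f (hi l i) - f (- int i - 1))" for f
    by (rule excess_hi[OF l L])
  from this[of "\<lambda>j. q powi (- int n * j)"]
  have "excess (\<lambda>j. q powi (- int n * j)) (maya_of l) = (\<Sum>i<L. xseq q l i ^ n - ?g i)"
    unfolding gq xq .
  also have "\<dots> = (\<Sum>i. xseq q l i ^ n) - q ^ n * (1 / (1 - q ^ n))"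
    using suminf_finite_change[OF sums_summable[OF geo], of L "\<lambda>i. xseq q l i ^ n"] eq sums_unique[OF geo] by simp
  also have "q ^ n * (1 / (1 - q ^ n)) = - (1 / (1 - q powi (- int n)))"
  proof -
    have "q ^ n \<noteq> 1" using qpow1[OF n] by auto
    then show ?thesis using q0 by (simp add: power_int_minus field_simps)
  qed
  finally show ?thesis unfolding b_op_eq by (simp add: algebra_simps)
qed

text \<open>The sign is opposite to that in \<open>b_op_pos\<close>, since columns index particles
  while \<open>excess\<close> counts holes.\<close>

lemma b_op_neg:
  assumes l: "l \<in> partitions" and n: "n \<ge> 1"
  shows "b_op q (- int n) v (maya_of l) = (\<Sum>i. yseq q l i ^ n) * v (maya_of l)"
proof -
  obtain L where L: "\<And>i. i \<ge> L \<Longrightarrow> conjugate l i = 0" using ptn_vanish[OF conj_ptn[OF l]] by blast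
  let ?g = "\<lambda>i. (q ^ n) ^ i"
  have geo: "?g sums (1 / (1 - q ^ n))"
    by (intro geometric_sums qpow1 n)
  have gq: "q powi (- (- int n) * int i) = ?g i" for i
  proof -
    have "- (- int n) * int i = int (n * i)" by simp
    then show ?thesis by (simp only: power_int_of_nat) (simp add: power_mult)
  qed
  have yq: "q powi (- (- int n) * lo l i) = yseq q l i ^ n" for i
  proof -
    have "- (- int n) * lo l i = lo l i * int n" by (simp add: algebra_simps)
    then show ?thesis by (simp only: power_int_mult power_int_of_nat yseq_def)
  qed
  have eq: "yseq q l i ^ n = ?g i" if "i \<ge> L" for i
    using yq[of i] gq[of i] L[OF that] by simp
  have "excess f (maya_of l) = (\<Sum>i<L. f (int i) - f (lo l i))" for f
    by (rule excess_lo[OF l L])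
  from this[of "\<lambda>j. q powi (- (- int n) * j)"]
  have "excess (\<lambda>j. q powi (- (- int n) * j)) (maya_of l) = (\<Sum>i<L. ?g i - yseq q l i ^ n)"
    unfolding gq yq .
  also have "\<dots> = - (\<Sum>i<L. yseq q l i ^ n - ?g i)" unfolding sum_negf[symmetric] by (rule sum.cong) auto
  also have "\<dots> = 1 / (1 - q ^ n) - (\<Sum>i. yseq q l i ^ n)"
    using suminf_finite_change[OF sums_summable[OF geo], of L "\<lambda>i. yseq q l i ^ n"] eq sums_unique[OF geo] by simp
  finally have e: "excess (\<lambda>j. q powi (- (- int n) * j)) (maya_of l) = 1 / (1 - q ^ n) - (\<Sum>i. yseq q l i ^ n)" .
  show ?thesis unfolding b_op_eq e by simp
qed

text \<open>The exponent has the coefficients -p_n(1, q, q^2, ...), so the conjugate shape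
  appears.\<close>

lemma S_ket_eval: assumes l: "l \<in> partitions"
  shows "S_ket q (maya_of l) = norm_vac q * skew_schur (conjugate l) empty_ptn (\<lambda>i. q ^ i)"
proof -
  define c where "c n = (\<Sum>i. q ^ (i * n))" for n
  have "op_exp (\<lambda>v S. - (\<Sum>\<^sub>\<infinity>n\<in>{1::nat..}. a_op (- int n) v S / of_nat n * c n)) vac = half_vertex (\<lambda>n. - c n) vac"
  proof -
    have "- (\<Sum>\<^sub>\<infinity>n\<in>{1::nat..}. a_op (- int n) v S / of_nat n * c n)
        = (\<Sum>\<^sub>\<infinity>n\<in>{1::nat..}. a_op (- int n) v S / of_nat n * (- c n))" for v S
      by (simp add: infsum_uminus)
    then show ?thesis using half_vertex_vac_infsum[of "\<lambda>n. - c n" vac] by simp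
  qed
  then have "S_ket q (maya_of l) = norm_vac q * half_vertex (\<lambda>n. - c n) vac (maya_of l)"
    by (simp add: S_ket_def c_def)
  also have "c = (\<lambda>n. \<Sum>i. (q ^ i) ^ n)" by (simp add: c_def power_mult fun_eq_iff)
  also have "half_vertex (\<lambda>n. - (\<Sum>i. (q ^ i) ^ n)) vac (maya_of l) = skew_schur (conjugate l) (conjugate empty_ptn) (\<lambda>i. q ^ i)"
    unfolding vac_bas
    by (rule skew_schur_conj_half_vertex[OF l empty_ptn, symmetric]) (use q1 in \<open>simp add: norm_power summable_geometric\<close>)
  finally show ?thesis by (simp add: conj_empty)
qed

text \<open>Taking the variables to be -q^(i+1) extracts the factor (-1)^n from the power sums, so
  that the Schur function of l itself appears, as the vertex in \<open>Phi\<close> demands.\<close>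

lemma S_bra_eval: assumes l: "l \<in> partitions"
  shows "S_bra q (\<lambda>S. k * bas (maya_of l) S) = norm_vac q * (k * skew_schur l empty_ptn (\<lambda>i. - (q ^ (i + 1))))"
proof -
  have c: "(\<Sum>i. q ^ ((i + 1) * n)) = (- 1) ^ n * (\<Sum>i. (- (q ^ (i + 1))) ^ n)" if n: "n \<ge> 1" for n
  proof -
    have s: "summable (\<lambda>i. (- (q ^ (i + 1))) ^ n)"
      by (rule summable_norm_power[OF _ n]) (use q1 in \<open>simp add: norm_power norm_mult summable_mult summable_geometric\<close>)
    have "q ^ ((i + 1) * n) = (- 1) ^ n * (- (q ^ (i + 1))) ^ n" for i
      by (simp only: power_mult power_mult_distrib[symmetric]) simp
    then show ?thesis using suminf_mult[OF s, of "(- 1) ^ n"] by simp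
  qed
  have "S_bra q (\<lambda>S. k * bas (maya_of l) S)
      = norm_vac q * op_exp (\<lambda>v S. \<Sum>\<^sub>\<infinity>n\<in>{1::nat..}. a_op (int n) v S / of_nat n * ((- 1) ^ n * (\<Sum>i. (- (q ^ (i + 1))) ^ n)))
          (\<lambda>S. k * bas (maya_of l) S) (maya_of empty_ptn)"
  proof -
    have "(\<lambda>v S. \<Sum>\<^sub>\<infinity>n\<in>{1::nat..}. a_op (int n) v S / of_nat n * (\<Sum>i. q ^ ((i + 1) * n)))
        = (\<lambda>v S. \<Sum>\<^sub>\<infinity>n\<in>{1::nat..}. a_op (int n) v S / of_nat n * ((- 1) ^ n * (\<Sum>i. (- (q ^ (i + 1))) ^ n)))"
      by (intro ext infsum_cong arg_cong2[where f = "(*)"] refl c) simp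
    then show ?thesis by (simp add: S_bra_def bra_eval[OF empty_ptn])
  qed
  also have "\<dots> = norm_vac q * (k * half_vertex (\<lambda>n. (- 1) ^ n * (\<Sum>i. (- (q ^ (i + 1))) ^ n)) (bas (maya_of empty_ptn)) (maya_of l))"
    by (simp only: transpose_half_vertex)
  also have "half_vertex (\<lambda>n. (- 1) ^ n * (\<Sum>i. (- (q ^ (i + 1))) ^ n)) (bas (maya_of empty_ptn)) (maya_of l)
      = skew_schur l empty_ptn (\<lambda>i. - (q ^ (i + 1)))"
    by (rule skew_schur_half_vertex[OF l empty_ptn, symmetric])
       (use q1 in \<open>simp add: norm_power norm_mult summable_mult summable_geometric\<close>)
  finally show ?thesis .
qed

text \<open>Copy 1 enters only through diagonal operators, so its diagram can be frozen at
  \<open>la\<close>. There -(-1)^n b_n and (-1)^n b_(-n) become (-1)^n times the power sums of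
  \<open>xseq\<close> and \<open>yseq\<close>, so after transposing copy 3 both half vertex
  operators yield unconjugated skew Schur functions.\<close>

lemma exp_E_star:
  assumes la: "la \<in> partitions" and mu: "mu \<in> partitions" and nu: "nu \<in> partitions"
    and G: "\<And>S T. G (maya_of la, S, T) = u * (vac S * bas (maya_of nu) T)"
  shows "op_exp (E_star q) G (maya_of la, maya_of mu, maya_of empty_ptn)
    = u * (\<Sum>\<^sub>\<infinity>e\<in>partitions. skew_schur mu e (yseq q la) * skew_schur nu e (xseq q la))"
proof -
  let ?x = "\<lambda>n. (- 1) ^ n * (\<Sum>i. xseq q la i ^ n)" and ?y = "\<lambda>n. (- 1) ^ n * (\<Sum>i. yseq q la i ^ n)"
  define \<Phi> where "\<Phi> j S T = (E_star q ^^ j) G (maya_of la, S, T)" for j S T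
  have "(\<Sum>j. \<Phi> j (maya_of mu) (maya_of empty_ptn) / fact j) = u * op_exp (E2 ?y ?x) vac2 (maya_of mu, maya_of nu)"
  proof (rule transpose_op_exp_E2)
    show "\<Phi> 0 S T = u * (vac S * bas (maya_of nu) T)" for S T by (simp add: \<Phi>_def G)
    fix j S T
    define F where "F = (E_star q ^^ j) G"
    have P: "\<Phi> j S = (\<lambda>T. F (maya_of la, S, T))" for S by (simp add: \<Phi>_def F_def fun_eq_iff)
    show "\<Phi> (Suc j) S T = (\<Sum>\<^sub>\<infinity>n\<in>{1..}. 1 / of_nat n *
      (?x n * a_op (int n) (\<Phi> j S) T + creation n (\<lambda>S'. a_op (int n) (\<Phi> j S') T) S
        + ?y n * creation n (\<lambda>S'. \<Phi> j S' T) S))"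
      unfolding P
    proof -
      have "\<Phi> (Suc j) S T = E_star q F (maya_of la, S, T)" by (simp add: \<Phi>_def F_def)
      also have "\<dots> = (\<Sum>\<^sub>\<infinity>n\<in>{1..}. 1 / of_nat n *
        (?x n * a_op (int n) (\<lambda>T. F (maya_of la, S, T)) T + creation n (\<lambda>S'. a_op (int n) (\<lambda>T. F (maya_of la, S', T)) T) S
        + ?y n * creation n (\<lambda>S'. F (maya_of la, S', T)) S))"
        unfolding E_star_def
      proof (intro infsum_cong arg_cong2[where f = "(*)"] refl)
        fix n :: nat assume "n \<in> {1..}"
        then have n: "n \<ge> 1" by simp
        show "- ((- 1) ^ n) * on1 (b_op q (int n)) (on3 (a_op (int n)) F) (maya_of la, S, T) +
            on2 (a_op (- int n)) (on3 (a_op (int n)) F) (maya_of la, S, T) +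
            (- 1) ^ n * on1 (b_op q (- int n)) (on2 (a_op (- int n)) F) (maya_of la, S, T)
          = ?x n * a_op (int n) (\<lambda>T. F (maya_of la, S, T)) T + creation n (\<lambda>S'. a_op (int n) (\<lambda>T. F (maya_of la, S', T)) T) S
            + ?y n * creation n (\<lambda>S'. F (maya_of la, S', T)) S"
          by (simp add: on1_def[of "b_op q _"] b_op_pos[OF la n] b_op_neg[OF la n]) (simp add: on2_def on3_def creation_def)
      qed
      finally show "\<Phi> (Suc j) S T = \<dots>" .
    qed
  qed
  moreover have "op_exp (E_star q) G (maya_of la, maya_of mu, maya_of empty_ptn) = (\<Sum>j. \<Phi> j (maya_of mu) (maya_of empty_ptn) / fact j)"
    by (simp add: op_exp_def \<Phi>_def)
  moreover have "op_exp (E2 ?y ?x) vac2 (maya_of mu, maya_of nu)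
      = (\<Sum>\<^sub>\<infinity>e\<in>partitions. skew_schur mu e (yseq q la) * skew_schur nu e (xseq q la))"
    unfolding op_exp_E2_vac[OF neutral_mp[OF mu] neutral_mp[OF nu]]
    by (intro infsum_cong) (simp add: skew_schur_half_vertex mu nu summable_xseq[OF la] summable_yseq[OF la])
  ultimately show ?thesis by simp
qed

text \<open>Compared with \<open>exp_E_star\<close> the signs of the b_n are reversed, which calls
  for the conjugate shapes at negated variables. The diagram \<open>S1\<close> stays general because
  the S-dual bra later acts on the whole vector in copy 1; the b_n being diagonal, that vector is
  supported at \<open>la\<close>.\<close>

lemma exp_E_op:
  assumes la: "la \<in> partitions" and mu: "mu \<in> partitions" and nu: "nu \<in> partitions"
  shows "op_exp (E_op q) (tensor3 (ket la) (ket mu) vac) (S1, maya_of empty_ptn, maya_of nu)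
    = bas (maya_of la) S1 * (\<Sum>\<^sub>\<infinity>e\<in>partitions.
        skew_schur (conjugate nu) e (\<lambda>i. - yseq q la i) * skew_schur (conjugate mu) e (\<lambda>i. - xseq q la i))"
proof -
  define G where "G = tensor3 (ket la) (ket mu) vac"
  define \<beta> where "\<beta> n = - excess (\<lambda>j. q powi (- n * j)) S1 + 1 / (1 - q powi (- n))" for n
  let ?x = "\<lambda>n. (- 1) ^ n * \<beta> (int n)" and ?y = "\<lambda>n. - ((- 1) ^ n) * \<beta> (- int n)"
  \<comment> \<open>Now copy 3 is the one in which modes are created and copy 2 the one to be
    transposed, hence the reversed order of \<open>S\<close> and \<open>T\<close>.\<close>
  define \<Phi> where "\<Phi> j S T = (E_op q ^^ j) G (S1, T, S)" for j S T
  have b: "b_op q n v S1 = \<beta> n * v S1" for n v by (simp add: b_op_eq \<beta>_def)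
  have "(\<Sum>j. \<Phi> j (maya_of nu) (maya_of empty_ptn) / fact j) = bas (maya_of la) S1 * op_exp (E2 ?y ?x) vac2 (maya_of nu, maya_of mu)"
  proof (rule transpose_op_exp_E2)
    show "\<Phi> 0 S T = bas (maya_of la) S1 * (vac S * bas (maya_of mu) T)" for S T
      by (simp add: \<Phi>_def G_def tensor3_def ket_bas la mu)
    fix j S T
    define F where "F = (E_op q ^^ j) G"
    have P: "\<Phi> j S = (\<lambda>T. F (S1, T, S))" for S by (simp add: \<Phi>_def F_def fun_eq_iff)
    have "\<Phi> (Suc j) S T = E_op q F (S1, T, S)" by (simp add: \<Phi>_def F_def)
    also have "\<dots> = (\<Sum>\<^sub>\<infinity>n\<in>{1..}. 1 / of_nat n *
      (?x n * a_op (int n) (\<lambda>T. F (S1, T, S)) T + creation n (\<lambda>S'. a_op (int n) (\<lambda>T. F (S1, T, S')) T) S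
      + ?y n * creation n (\<lambda>S'. F (S1, T, S')) S))"
      unfolding E_op_def
    proof (intro infsum_cong arg_cong2[where f = "(*)"] refl)
      fix n :: nat assume "n \<in> {1..}"
      then have n: "n \<ge> 1" by simp
      have "on2 (a_op (int n)) (on3 (a_op (- int n)) F) (S1, T, S)
          = creation n (\<lambda>S'. a_op (int n) (\<lambda>T. F (S1, T, S')) T) S"
        using flin_swap[of "\<lambda>v. a_op (int n) v T" "\<lambda>v. creation n v S" "\<lambda>T S. F (S1, T, S)"] a_op_flin[of "int n" T] creation_flin[OF n, of S] n
        by (simp add: on2_def on3_def creation_def)
      then show "(- 1) ^ n * on1 (b_op q (int n)) (on2 (a_op (int n)) F) (S1, T, S) +
          on2 (a_op (int n)) (on3 (a_op (- int n)) F) (S1, T, S) -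
          (- 1) ^ n * on1 (b_op q (- int n)) (on3 (a_op (- int n)) F) (S1, T, S)
        = ?x n * a_op (int n) (\<lambda>T. F (S1, T, S)) T + creation n (\<lambda>S'. a_op (int n) (\<lambda>T. F (S1, T, S')) T) S
          + ?y n * creation n (\<lambda>S'. F (S1, T, S')) S"
        by (simp add: on1_def[of "b_op q _"] b) (simp add: on2_def on3_def creation_def)
    qed
    finally show "\<Phi> (Suc j) S T = (\<Sum>\<^sub>\<infinity>n\<in>{1..}. 1 / of_nat n *
      (?x n * a_op (int n) (\<Phi> j S) T + creation n (\<lambda>S'. a_op (int n) (\<Phi> j S') T) S
        + ?y n * creation n (\<lambda>S'. \<Phi> j S' T) S))" unfolding P .
  qed
  moreover have "op_exp (E_op q) G (S1, maya_of empty_ptn, maya_of nu) = (\<Sum>j. \<Phi> j (maya_of nu) (maya_of empty_ptn) / fact j)"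
    by (simp add: op_exp_def \<Phi>_def)
  moreover have "op_exp (E2 ?y ?x) vac2 (maya_of nu, maya_of mu)
      = (\<Sum>\<^sub>\<infinity>e\<in>partitions. skew_schur (conjugate nu) e (\<lambda>i. - yseq q la i) * skew_schur (conjugate mu) e (\<lambda>i. - xseq q la i))"
    if S1: "S1 = maya_of la"
  proof -
    have neg: "(- 1) ^ n * (\<Sum>i. z i ^ n) = (\<Sum>i. (- z i) ^ n)" if "summable (\<lambda>i. norm (z i))" "n \<ge> 1" for z :: "nat \<Rightarrow> complex" and n
      using suminf_mult[OF summable_norm_power[OF that], of "(- 1) ^ n"]
      by (simp add: power_mult_distrib[symmetric])
    have x: "?x n = - (\<Sum>i. (- xseq q la i) ^ n)" if "n \<ge> 1" for n
    proof -
      have "\<beta> (int n) = - (\<Sum>i. xseq q la i ^ n)"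
        using b[of "int n" "\<lambda>_. 1"] b_op_pos[OF la that, of "\<lambda>_. 1"] by (simp add: S1)
      then show ?thesis using neg[OF summable_xseq[OF la] that] by simp
    qed
    have y: "?y n = - (\<Sum>i. (- yseq q la i) ^ n)" if "n \<ge> 1" for n
    proof -
      have "\<beta> (- int n) = (\<Sum>i. yseq q la i ^ n)"
        using b[of "- int n" "\<lambda>_. 1"] b_op_neg[OF la that, of "\<lambda>_. 1"] by (simp add: S1)
      then show ?thesis using neg[OF summable_yseq[OF la] that] by simp
    qed
    have Gc: "half_vertex c = half_vertex d" if "\<And>n. n \<ge> 1 \<Longrightarrow> c n = d n" for c d
    proof -
      have "vser (\<lambda>n. c n / of_nat n) = vser (\<lambda>n. d n / of_nat n)"
        by (intro ext) (auto simp: ser_def that intro!: sum.cong)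
      then show ?thesis by (simp add: half_vertex_def)
    qed
    have gx: "half_vertex ?x = half_vertex (\<lambda>n. - (\<Sum>i. (- xseq q la i) ^ n))" by (rule Gc) (rule x)
    have gy: "half_vertex ?y = half_vertex (\<lambda>n. - (\<Sum>i. (- yseq q la i) ^ n))" by (rule Gc) (rule y)
    \<comment> \<open>Conjugating the outer shapes has conjugated the intermediate one as well; the
      sum over all partitions is invariant under this.\<close>
    have bij: "bij_betw conjugate partitions partitions"
      by (rule bij_betw_byWitness[of _ conjugate]) (auto simp: conj_conj conj_ptn)
    have "op_exp (E2 ?y ?x) vac2 (maya_of nu, maya_of mu) = (\<Sum>\<^sub>\<infinity>e\<in>partitions.
        skew_schur (conjugate nu) (conjugate e) (\<lambda>i. - yseq q la i) * skew_schur (conjugate mu) (conjugate e) (\<lambda>i. - xseq q la i))"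
      unfolding op_exp_E2_vac[OF neutral_mp[OF nu] neutral_mp[OF mu]] gx gy
      by (intro infsum_cong) (simp add: skew_schur_conj_half_vertex mu nu summable_xseq[OF la] summable_yseq[OF la])
    also have "\<dots> = (\<Sum>\<^sub>\<infinity>e\<in>partitions.
        skew_schur (conjugate nu) e (\<lambda>i. - yseq q la i) * skew_schur (conjugate mu) e (\<lambda>i. - xseq q la i))"
      by (rule infsum_reindex_bij_betw[OF bij])
    finally show ?thesis .
  qed
  ultimately show ?thesis unfolding G_def[symmetric] by (cases "S1 = maya_of la") (simp_all add: bas_def)
qed

end

section \<open>Half-integer powers of q, homogeneity and the coefficients of the
  intertwiners\<close>

lemma xseq_q_seq: "qh \<noteq> 0 \<Longrightarrow> xseq (qh\<^sup>2) l = (\<lambda>i. qh * q_seq qh l i)"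
proof
  fix i assume "qh \<noteq> 0"
  have "xseq (qh\<^sup>2) l i = qh powi (2 * - hi l i)"
    unfolding xseq_def power_int_mult by simp
  also have "2 * - hi l i = 1 + (- 2 * int (l i) + 2 * (int i + 1) - 1)" by simp
  also have "qh powi \<dots> = qh * q_seq qh l i"
    unfolding q_seq_def using \<open>qh \<noteq> 0\<close> by (subst power_int_add) simp_all
  finally show "xseq (qh\<^sup>2) l i = qh * q_seq qh l i" .
qed

lemma yseq_q_seq: "qh \<noteq> 0 \<Longrightarrow> yseq (qh\<^sup>2) l = (\<lambda>i. inverse qh * q_seq qh (conjugate l) i)"
proof
  fix i assume "qh \<noteq> 0"
  have "yseq (qh\<^sup>2) l i = qh powi (2 * lo l i)"
    unfolding yseq_def power_int_mult by simp
  also have "2 * lo l i = - 1 + (- 2 * int (conjugate l i) + 2 * (int i + 1) - 1)" by simp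
  also have "qh powi \<dots> = inverse qh * q_seq qh (conjugate l) i"
    unfolding q_seq_def using \<open>qh \<noteq> 0\<close> by (subst power_int_add) (simp_all add: power_int_minus)
  finally show "yseq (qh\<^sup>2) l i = inverse qh * q_seq qh (conjugate l) i" .
qed

lemma qpow_q_seq: "qh \<noteq> 0 \<Longrightarrow> (qh\<^sup>2) ^ i = inverse qh * q_seq qh empty_ptn i"
  using fun_cong[OF yseq_q_seq[of qh empty_ptn], of i] by (simp add: yseq_def conj_empty) (simp add: empty_ptn_def)

lemma psize_empty: "psize empty_ptn = 0"
  by (simp add: psize_def empty_ptn_def)

lemma skew_schur_nonzero: "skew_schur l e x \<noteq> 0 \<Longrightarrow> e \<le> l"
  by (auto simp: skew_schur_def split: if_splits)

text \<open>By homogeneity the intermediate e carries the factor (a b)^(-|e|), which is 1. So the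
  factors q^(1/2) and q^(-1/2) on the two sets of variables can be pulled out of the whole
  sum.\<close>

lemma skew_schur_scale_sum:
  assumes m: "m \<in> partitions" and n: "n \<in> partitions" and ab: "a * b = 1"
  shows "(\<Sum>\<^sub>\<infinity>e\<in>partitions. skew_schur m e (\<lambda>i. a * x i) * skew_schur n e (\<lambda>i. b * y i))
    = a ^ psize m * b ^ psize n * (\<Sum>\<^sub>\<infinity>e\<in>partitions. skew_schur m e x * skew_schur n e y)"
proof -
  have "skew_schur m e (\<lambda>i. a * x i) * skew_schur n e (\<lambda>i. b * y i)
      = a ^ psize m * b ^ psize n * (skew_schur m e x * skew_schur n e y)" if e: "e \<in> partitions" for e
  proof (cases "skew_schur m e x = 0 \<or> skew_schur n e y = 0")
    case True
    then show ?thesis by (auto simp: skew_schur_scale[OF m e] skew_schur_scale[OF n e])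
  next
    case False
    then have "e \<le> m" "e \<le> n" using skew_schur_nonzero by blast+
    then have le: "psize e \<le> psize m" "psize e \<le> psize n"
      using psize_mono[OF m] psize_mono[OF n] by (auto simp: le_fun_def)
    have "a ^ psize m * b ^ psize n = (a * b) ^ psize e * (a ^ (psize m - psize e) * b ^ (psize n - psize e))"
      using le by (simp add: power_mult_distrib mult_ac flip: power_add)
    then show ?thesis by (simp add: skew_schur_scale[OF m e] skew_schur_scale[OF n e] ab)
  qed
  then have "(\<Sum>\<^sub>\<infinity>e\<in>partitions. skew_schur m e (\<lambda>i. a * x i) * skew_schur n e (\<lambda>i. b * y i))
    = (\<Sum>\<^sub>\<infinity>e\<in>partitions. a ^ psize m * b ^ psize n * (skew_schur m e x * skew_schur n e y))"
    by (rule infsum_cong)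
  then show ?thesis by (simp add: infsum_cmult_right')
qed

lemma sign_cancel: "((- 1) powi N) ^ m * ((- 1) ^ m) powi N = (1 :: complex)"
proof -
  have "((- 1) powi N) ^ m = ((- 1) ^ m) powi N * (1 :: complex)"
    by (simp add: power_int_power power_int_power' mult.commute)
  moreover have "((- 1) ^ m) powi N * ((- 1) ^ m) powi N = (1 :: complex)"
    by (simp add: power_int_mult_distrib[symmetric] power_mult_distrib[symmetric])
  ultimately show ?thesis by simp
qed

lemma framing_power: "framing qh l powi N = ((- 1) ^ psize l) powi N * qh powi (N * kappa l)"
  by (simp add: framing_def power_int_mult_distrib power_int_mult[symmetric] mult.commute)

text \<open>The signs of the prefactors cancel against those of the framing factors, and
  f_\<mu>^(-1) cancels the power of q with exponent \<kappa>_\<mu>/2 in the vertex.\<close>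

lemma Phi_star_simp:
  assumes "qh \<noteq> 0" "nu \<in> partitions"
  shows "Phi_star qh N la mu nu = qh ^ psize la * qh powi (N * kappa la) * inverse qh ^ psize mu * qh ^ psize nu *
    skew_schur (conjugate la) empty_ptn (q_seq qh empty_ptn) *
    (\<Sum>\<^sub>\<infinity>e\<in>partitions. skew_schur nu e (q_seq qh la) * skew_schur mu e (q_seq qh (conjugate la)))"
proof -
  have 1: "((- 1) powi N * qh) ^ psize la * framing qh la powi N = qh ^ psize la * qh powi (N * kappa la)"
    using sign_cancel[of N "psize la"] by (simp add: framing_power power_mult_distrib mult_ac)
  have 2: "(- (qh powi (- 1))) ^ psize mu * framing qh mu powi (- 1) * qh powi kappa mu = inverse qh ^ psize mu"
  proof -
    have "(- (qh powi (- 1))) ^ psize mu = (- 1) ^ psize mu * inverse qh ^ psize mu"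
      by (simp add: power_int_minus flip: power_mult_distrib)
    moreover have "framing qh mu powi (- 1) * qh powi kappa mu = (- 1) ^ psize mu"
    proof -
      have "inverse ((- 1) ^ psize mu) = (- 1 :: complex) ^ psize mu" by (simp flip: power_inverse)
      moreover have "inverse (qh powi kappa mu) * qh powi kappa mu = 1" using assms(1) by simp
      ultimately show ?thesis by (simp add: framing_def power_int_minus mult.assoc)
    qed
    moreover have "(- 1) ^ psize mu * (- 1) ^ psize mu = (1 :: complex)"
      by (simp flip: power_mult_distrib)
    moreover have "a * i * F * Q = i" if "F * Q = a" "a * a = 1" for a i F Q :: complex
    proof -
      have "a * i * F * Q = a * (F * Q) * i" by (simp only: mult_ac)
      then show ?thesis using that by simp
    qed
    ultimately show ?thesis by simp
  qed
  have "Phi_star qh N la mu nu = (((- 1) powi N * qh) ^ psize la * framing qh la powi N) *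
     ((- (qh powi (- 1))) ^ psize mu * framing qh mu powi (- 1) * qh powi kappa mu) * qh ^ psize nu *
     skew_schur (conjugate la) empty_ptn (q_seq qh empty_ptn) *
    (\<Sum>\<^sub>\<infinity>e\<in>partitions. skew_schur nu e (q_seq qh la) * skew_schur mu e (q_seq qh (conjugate la)))"
    unfolding Phi_star_def top_vertex_def conj_conj[OF assms(2)] by (simp only: mult_ac)
  then show ?thesis unfolding 1 2 by (simp only: mult_ac)
qed

text \<open>The second index of the vertex is \<mu>', and \<kappa> changes sign under conjugation,
  so the power of q in f_\<mu> cancels while its sign (-1)^|\<mu>| survives.\<close>

lemma Phi_simp:
  assumes "qh \<noteq> 0" "la \<in> partitions" "mu \<in> partitions"
  shows "Phi qh N la mu nu = (- inverse qh) ^ psize la * qh powi (- N * kappa la) * (- qh) ^ psize mu * (- inverse qh) ^ psize nu *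
    skew_schur la empty_ptn (q_seq qh empty_ptn) *
    (\<Sum>\<^sub>\<infinity>e\<in>partitions. skew_schur (conjugate nu) e (q_seq qh (conjugate la)) * skew_schur (conjugate mu) e (q_seq qh la))"
proof -
  have 1: "(- ((- 1) powi N) * qh powi (- 1)) ^ psize la * framing qh la powi (- N)
      = (- inverse qh) ^ psize la * qh powi (- N * kappa la)"
  proof -
    have "(- 1) powi (- N) = (- 1 :: complex) powi N" by (simp add: power_int_minus flip: power_int_inverse)
    then have "- ((- 1) powi N) * qh powi (- 1) = (- 1) powi (- N) * (- inverse qh)"
      by (simp add: power_int_minus)
    moreover have "a * b * (d * X) = b * X" if "a * d = 1" for a b d X :: complex
    proof -
      have "a * b * (d * X) = a * d * (b * X)" by (simp only: mult_ac)
      then show ?thesis using that by simp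
    qed
    ultimately show ?thesis by (simp only: framing_power power_mult_distrib sign_cancel)
  qed
  have 2: "qh ^ psize mu * framing qh mu * qh powi kappa (conjugate mu) = (- qh) ^ psize mu"
  proof -
    have "qh powi kappa mu * qh powi (- kappa mu) = 1" using assms(1) by (simp add: power_int_minus)
    then have "framing qh mu * qh powi kappa (conjugate mu) = (- 1) ^ psize mu"
      by (simp add: framing_def kappa_conj[OF assms(3)] mult.assoc)
    then show ?thesis by (simp add: mult.assoc power_minus[of qh])
  qed
  have 3: "(- (qh powi (- 1))) ^ psize nu = (- inverse qh) ^ psize nu" by (simp add: power_int_minus)
  have "Phi qh N la mu nu = ((- ((- 1) powi N) * qh powi (- 1)) ^ psize la * framing qh la powi (- N)) *
     (qh ^ psize mu * framing qh mu * qh powi kappa (conjugate mu)) * (- (qh powi (- 1))) ^ psize nu *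
    skew_schur la empty_ptn (q_seq qh empty_ptn) *
    (\<Sum>\<^sub>\<infinity>e\<in>partitions. skew_schur (conjugate nu) e (q_seq qh (conjugate la)) * skew_schur (conjugate mu) e (q_seq qh la))"
    unfolding Phi_def top_vertex_def conj_conj[OF assms(2)] by (simp only: mult_ac)
  then show ?thesis unfolding 1 2 3 by (simp only: mult_ac)
qed

theorem theorem4p6:
  fixes q qh :: complex and N :: int
  assumes "0 < norm q" and "norm q < 1" and "qh\<^sup>2 = q"
  shows "\<forall>la\<in>partitions. \<forall>mu\<in>partitions. \<forall>nu\<in>partitions.
    Phi_star qh N la mu nu =
      inverse (norm_vac q) *
      pair3 (bra la) (bra mu) (bra empty_ptn)
        (op_exp (E_star q)
          (on1 (op_power qh (\<lambda>v S. of_int N * w_op v S))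
            (on1 (op_power q L0_op)
              (tensor3 (S_ket q) vac (ket nu))))) \<and>
    Phi qh N la mu nu =
      inverse (norm_vac q) *
      pair3 (S_bra q) (bra empty_ptn) (bra nu)
        (on1 (op_power q (\<lambda>v S. - L0_op v S))
          (on1 (op_power qh (\<lambda>v S. - of_int N * w_op v S))
            (op_exp (E_op q)
              (tensor3 (ket la) (ket mu) vac))))"
proof (intro ballI conjI)
  fix la mu nu assume la: "la \<in> partitions" and mu: "mu \<in> partitions" and nu: "nu \<in> partitions"
  have q0: "q \<noteq> 0" and qh0: "qh \<noteq> 0" using assms by auto
  have q1: "norm q < 1" by (rule assms(2))
  have nv: "norm_vac q \<noteq> 0" by (rule norm_vac_nonzero[OF q1])
  have qq: "q ^ n = qh ^ n * qh ^ n" for n unfolding assms(3)[symmetric] by (simp add: power2_eq_square power_mult_distrib)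
  have xs: "xseq q la = (\<lambda>i. qh * q_seq qh la i)" using xseq_q_seq[OF qh0, of la] assms(3) by simp
  have ys: "yseq q la = (\<lambda>i. inverse qh * q_seq qh (conjugate la) i)" using yseq_q_seq[OF qh0, of la] assms(3) by simp
  have qs: "q ^ i = inverse qh * q_seq qh empty_ptn i" for i using qpow_q_seq[OF qh0, of i] assms(3) by simp
  define G where "G = on1 (op_power qh (\<lambda>v S. of_int N * w_op v S))
            (on1 (op_power q L0_op) (tensor3 (S_ket q) vac (ket nu)))"
  define s0 where "s0 = skew_schur (conjugate la) empty_ptn (q_seq qh empty_ptn)"
  \<comment> \<open>Copy 1 contributes a scalar: the S-dual ket at \<open>la\<close> times the
    eigenvalues that the L_0 and w factors have there.\<close>
  define u where "u = qh powi (N * kappa la) * (q ^ psize la * (norm_vac q * (inverse qh ^ psize la * s0)))"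
  define Z where "Z = (\<Sum>\<^sub>\<infinity>e\<in>partitions. skew_schur mu e (q_seq qh (conjugate la)) * skew_schur nu e (q_seq qh la))"
  have Sk: "S_ket q (maya_of la) = norm_vac q * (inverse qh ^ psize la * s0)"
    unfolding S_ket_eval[OF q0 q1 la] qs skew_schur_scale[OF conj_ptn[OF la] empty_ptn] s0_def
    by (simp add: psize_conj[OF la] psize_empty)
  have G: "G (maya_of la, S, T) = u * (vac S * bas (maya_of nu) T)" for S T
    unfolding G_def on1_def
    by (simp add: op_power_w[OF qh0 la] op_power_L0[OF q0] tensor3_def Sk energy_mp[OF la] ket_bas[OF nu] u_def)
  have "pair3 (bra la) (bra mu) (bra empty_ptn) (op_exp (E_star q) G) = op_exp (E_star q) G (maya_of la, maya_of mu, maya_of empty_ptn)"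
    by (simp add: pair3_def bra_eval la mu empty_ptn)
  \<comment> \<open>The factors q^(-1/2) and q^(1/2) by which \<open>yseq\<close> and
    \<open>xseq\<close> differ from the sequences in the vertex produce the powers with exponents
    |\<mu>| and |\<nu>|.\<close>
  also have "\<dots> = u * (inverse qh ^ psize mu * qh ^ psize nu * Z)"
    unfolding exp_E_star[OF q0 q1 la mu nu G] unfolding xs ys Z_def
    by (subst skew_schur_scale_sum[OF mu nu]) (use qh0 in auto)
  finally show "Phi_star qh N la mu nu = inverse (norm_vac q) *
      pair3 (bra la) (bra mu) (bra empty_ptn)
        (op_exp (E_star q)
          (on1 (op_power qh (\<lambda>v S. of_int N * w_op v S))
            (on1 (op_power q L0_op)
              (tensor3 (S_ket q) vac (ket nu)))))"
    unfolding G_def[symmetric] Phi_star_simp[OF qh0 nu] s0_def[symmetric]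
    using nv qh0 by (simp add: u_def Z_def qq mult_ac power_inverse)
  define W where "W = (\<Sum>\<^sub>\<infinity>e\<in>partitions. skew_schur (conjugate nu) e (q_seq qh (conjugate la)) * skew_schur (conjugate mu) e (q_seq qh la))"
  define k where "k = inverse (q ^ psize la) * (qh powi (- N * kappa la) * ((- inverse qh) ^ psize nu * (- qh) ^ psize mu * W))"
  define H where "H = op_exp (E_op q) (tensor3 (ket la) (ket mu) vac)"
  have H: "H (S1, maya_of empty_ptn, maya_of nu) = bas (maya_of la) S1 * ((- inverse qh) ^ psize nu * (- qh) ^ psize mu * W)" for S1
  proof -
    have "(\<Sum>\<^sub>\<infinity>e\<in>partitions. skew_schur (conjugate nu) e (\<lambda>i. (- inverse qh) * q_seq qh (conjugate la) i) *
        skew_schur (conjugate mu) e (\<lambda>i. (- qh) * q_seq qh la i)) = (- inverse qh) ^ psize nu * (- qh) ^ psize mu * W"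
      unfolding W_def psize_conj[OF mu, symmetric] psize_conj[OF nu, symmetric]
      by (rule skew_schur_scale_sum[OF conj_ptn[OF nu] conj_ptn[OF mu]]) (use qh0 in simp)
    then show ?thesis unfolding H_def exp_E_op[OF q0 q1 la mu nu] xs ys by simp
  qed
  have D: "op_power q (\<lambda>v S. - L0_op v S) (op_power qh (\<lambda>v S. - of_int N * w_op v S) (\<lambda>S1. H (S1, maya_of empty_ptn, maya_of nu)))
      = (\<lambda>S. k * bas (maya_of la) S)"
  proof
    fix S
    have w: "op_power qh (\<lambda>v S. - of_int N * w_op v S) (\<lambda>S1. H (S1, maya_of empty_ptn, maya_of nu)) S
        = qh powi (- N * kappa la) * H (S, maya_of empty_ptn, maya_of nu)"
    proof (cases "S = maya_of la")
      case True
      then show ?thesis using op_power_w[OF qh0 la, of "- N"] by simp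
    next
      case False
      \<comment> \<open>Away from \<open>la\<close> the eigenvalue of w need not be an integer, but
        the vector vanishes there, so any scalar will do.\<close>
      have "op_power qh (\<lambda>v S. - of_int N * w_op v S) v S =
          exp (Ln qh * (- of_int N * excess (\<lambda>j. (of_int j + 1 / 2)\<^sup>2) S)) * v S" for v
        unfolding op_power_def by (rule op_exp_diag) (simp add: w_op_eq)
      then show ?thesis using False by (simp add: H bas_def)
    qed
    show "op_power q (\<lambda>v S. - L0_op v S) (op_power qh (\<lambda>v S. - of_int N * w_op v S) (\<lambda>S1. H (S1, maya_of empty_ptn, maya_of nu))) S
      = k * bas (maya_of la) S"
      unfolding op_power_L0_minus[OF q0] w unfolding H by (auto simp: bas_def k_def energy_mp[OF la])
  qed
  have "pair3 (S_bra q) (bra empty_ptn) (bra nu) (on1 (op_power q (\<lambda>v S. - L0_op v S))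
          (on1 (op_power qh (\<lambda>v S. - of_int N * w_op v S)) H)) = S_bra q (\<lambda>S. k * bas (maya_of la) S)"
    by (simp only: pair3_def on1_def bra_eval[OF nu] bra_eval[OF empty_ptn] case_prod_conv D)
  also have "\<dots> = norm_vac q * (k * ((- qh) ^ psize la * skew_schur la empty_ptn (q_seq qh empty_ptn)))"
  proof -
    \<comment> \<open>The power q^(i+1) is q^(1/2) times the entry of q^(-\<rho>), so negation and
      rescaling combine into the single factor -q^(1/2).\<close>
    have "(\<lambda>i. - (q ^ (i + 1))) = (\<lambda>i. (- qh) * q_seq qh empty_ptn i)"
      using qs qq[of 1] qh0 by (simp add: fun_eq_iff field_simps)
    then show ?thesis unfolding S_bra_eval[OF q0 q1 la]
      using skew_schur_scale[OF la empty_ptn, of "- qh"] by (simp add: psize_empty)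
  qed
  finally show "Phi qh N la mu nu = inverse (norm_vac q) *
      pair3 (S_bra q) (bra empty_ptn) (bra nu)
        (on1 (op_power q (\<lambda>v S. - L0_op v S))
          (on1 (op_power qh (\<lambda>v S. - of_int N * w_op v S))
            (op_exp (E_op q)
              (tensor3 (ket la) (ket mu) vac))))"
  proof -
    assume p: "pair3 (S_bra q) (bra empty_ptn) (bra nu) (on1 (op_power q (\<lambda>v S. - L0_op v S))
          (on1 (op_power qh (\<lambda>v S. - of_int N * w_op v S)) H)) =
       norm_vac q * (k * ((- qh) ^ psize la * skew_schur la empty_ptn (q_seq qh empty_ptn)))"
    \<comment> \<open>Here the sign in copy 1 is settled: q^(-L_0) turns (-q^(1/2))^|\<lambda>| into
      the prefactor (-q^(-1/2))^|\<lambda>| of \<open>Phi_simp\<close>.\<close>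
    have "inverse (q ^ psize la) * (- qh) ^ psize la = (- inverse qh) ^ psize la"
    proof -
      have "inverse q * (- qh) = - inverse qh"
        unfolding assms(3)[symmetric] using qh0 by (simp add: power2_eq_square)
      then show ?thesis by (simp only: power_inverse[symmetric] power_mult_distrib[symmetric])
    qed
    then show ?thesis unfolding H_def[symmetric] p Phi_simp[OF qh0 la mu] W_def[symmetric]
      using nv by (simp add: k_def mult_ac) 
  qed
qed

end
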